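(* Assume that: (1) $(A,B)$ is stabilizable; (2) $(C,A)$ is detectable; (3) for all $\lambda\in\sigma(S)$, $\operatorname{rank}\begin{pmatrix} A-\lambda I_n & B\\ C & 0\end{pmatrix}=n+p$; (4) all the eigenvalues of $S$ are on the unit circle; (5) $A$ has no eigenvalues with modulus greater than $1$. Let $(G_1,G_2)$ be the minimal $p$-copy internal model of $S$, with $G_1\in\mathbb{R}^{n_z\times n_z}$. Then there exist matrices $K_1\in\mathbb{R}^{m\times n_z}$, $K_2\in\mathbb{R}^{m\times n}$ and $L\in\mathbb{R}^{n\times p}$ such that the cooperative robust output regulation problem is solved by the distributed dynamic output feedback control law $$\begin{aligned}u_i(t)&=K_1\bar z_i(t-r_{com})+K_2\bar\eta_i(t-r_{com}),\\ \bar z_i(t+1)&=G_1\bar z_i(t)+G_2e_{vi}(t),\\ \bar\xi_i(t+1)&=A\bar\xi_i(t)+Bu_i(t-r_{con})-LC\bar\eta_i(t)+Le_{vi}(t),\qquad i=1,\dots,N,\end{aligned}$$ if and only if the digraph $\bar{\mathcal G}$ contains a directed spanning tree with the node $0$ as the root.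
   Context: **Plant.** $N$ followers, for $t\in\mathbb{Z}^+=\{0,1,\dots\}$: $$x_i(t+1)=\bar A_ix_i(t)+\bar B_iu_i(t-r_{con})+\bar E_iv(t),\quad y_i(t)=\bar C_ix_i(t),\quad i=1,\dots,N,$$ where $x_i(t)\in\mathbb{R}^n$, $u_i(t)\in\mathbb{R}^m$, $y_i(t)\in\mathbb{R}^p$, and $r_{con}\in\mathbb{Z}^+$ is the input delay. Here $\bar A_i=A+\delta_iA$, $\bar B_i=B+\delta_iB$, $\bar E_i=E+\delta_iE$, $\bar C_i=C+\delta_iC$, where $A,B,E,C$ are the nominal matrices and $\delta_iA,\delta_iB,\delta_iE,\delta_iC$ are the uncertain parts. The vector $w$ collects all entries of all the uncertain parts; the nominal system is the one with $w=0$. **Exosystem (leader).** $v(t+1)=Sv(t)$, with $v(t)\in\mathbb{R}^q$ and $S\in\mathbb{R}^{q\times q}$. The leader output is $y_0(t)=-Fv(t)$ with $F\in\mathbb{R}^{p\times q}$, and the regulated outputs are $e_i(t)=y_i(t)-y_0(t)$, $i=1,\dots,N$. **Graph.** $\bar{\mathcal G}=(\bar{\mathcal V},\bar{\mathcal E})$ is a digraph with node set $\bar{\mathcal V}=\{0,1,\dots,N\}$, where node $0$ is the leader and node $i$ is the $i$-th follower. It has weighted adjacency matrix $[a_{ij}]_{i,j=0}^N$ with $a_{ii}=0$, $a_{ij}>0\Leftrightarrow(j,i)\in\bar{\mathcal E}$, and $a_{ij}=a_{ji}$ if the edge $(i,j)$ is undirected (i.e. both $(i,j),(j,i)\in\bar{\mathcal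 E}$). The neighbor set of $i$ is $\bar{\mathcal N}_i=\{j:(j,i)\in\bar{\mathcal E}\}$. **Signals in the control law.** $r_{com}\in\mathbb{Z}^+$ is the communication delay, $\bar\xi_i(t)\in\mathbb{R}^n$ for $i=1,\dots,N$, $\bar\xi_0(t):=0$, and $$e_{vi}(t)=\sum_{j\in\bar{\mathcal N}_i}a_{ij}(y_i(t)-y_j(t)),\qquad \bar\eta_i(t)=\sum_{j\in\bar{\mathcal N}_i}a_{ij}\big(\bar\xi_i(t)-\bar\xi_j(t)\big).$$ Under the change of variables $z_i(t)=\bar z_i(t-r_{com})$, $\xi_i(t)=\bar\xi_i(t-r_{com})$, the law uses only the delayed signals $e_{vi}(t-r_{com})$. **Internal model.** $(G_1,G_2)$ is a minimal $p$-copy internal model of $S$ if $G_1=I_p\otimes\beta$ and $G_2=I_p\otimes\sigma$, where $\beta$ is a constant square matrix whose characteristic polynomial equals the minimal polynomial of $S$, and $\sigma$ is a constant column vector such that $(\beta,\sigma)$ is controllable. **Problem.** A control law solves the (discrete-time linear) cooperative robust output regulation problem if the closed-loop system satisfies: (Property 1) the nominal closed-loop system ($w=0$) is exponentially stable when $v=0$; (Property 2) there is an open neighborhood $W$ of $w=0$ such that, for every $w\in W$ and all initial conditions of the plant, controller and exosystem, $\lim_{t\to\infty}e_i(t)=0$ for $i=1,\dots,N$. Initial conditions of the delayed closed-loop states are arbitrary functions on $\{-r,\dots,0\}$, with $r=r_{com}+r_{con}$. $\sigma(S)$ denotes the spectrum of $S$; $\otimes$ is the Kronecker product. *)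

theory Defs
  imports "HOL-Analysis.Analysis" "HOL-Computational_Algebra.Polynomial"
begin

subsection \<open>Matrices\<close>

abbreviation cmatrix :: "real^'n^'k \<Rightarrow> complex^'n^'k" where
  "cmatrix \<equiv> map_matrix complex_of_real"

definition spectrum :: "real^'n^'n \<Rightarrow> complex set" where
  "spectrum M = {\<mu>. \<exists>x. x \<noteq> 0 \<and> cmatrix M *v x = \<mu> *s x}"

definition schur :: "real^'n^'n \<Rightarrow> bool" where
  "schur M \<longleftrightarrow> (\<forall>\<mu>\<in>spectrum M. cmod \<mu> < 1)"

definition stabilizable :: "real^'n^'n \<Rightarrow> real^'m^'n \<Rightarrow> bool" where
  "stabilizable A B \<longleftrightarrow> (\<exists>K. schur (A + B ** K))"

definition detectable :: "real^'n^'p \<Rightarrow> real^'n^'n \<Rightarrow> bool" where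
  "detectable C A \<longleftrightarrow> (\<exists>L. schur (A + L ** C))"

primrec matpow :: "'a::semiring_1^'n^'n \<Rightarrow> nat \<Rightarrow> 'a^'n^'n" where
  "matpow M 0 = mat 1"
| "matpow M (Suc k) = M ** matpow M k"

text \<open>The dimension of the span of the columns below is the rank of the controllability
  matrix \<open>[B, A B, \<dots>, A\<^sup>n\<^sup>-\<^sup>1 B]\<close>.\<close>

definition controllable :: "real^'n^'n \<Rightarrow> real^'m^'n \<Rightarrow> bool" where
  "controllable A B \<longleftrightarrow> dim (\<Union>k<CARD('n). columns (matpow A k ** B)) = CARD('n)"

definition block_matrix ::
  "'a^'n^'k \<Rightarrow> 'a^'m^'k \<Rightarrow> 'a^'n^'p \<Rightarrow> 'a^'m^'p \<Rightarrow> 'a^('n::finite + 'm::finite)^('k::finite + 'p::finite)" where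
  "block_matrix M11 M12 M21 M22 = (\<chi> i j. case i of
      Inl k \<Rightarrow> (case j of Inl l \<Rightarrow> M11 $ k $ l | Inr l \<Rightarrow> M12 $ k $ l)
    | Inr k \<Rightarrow> (case j of Inl l \<Rightarrow> M21 $ k $ l | Inr l \<Rightarrow> M22 $ k $ l))"

definition kronecker :: "'a::times^'b^'c \<Rightarrow> 'a^'d^'e \<Rightarrow> 'a^('b::finite \<times> 'd::finite)^('c::finite \<times> 'e::finite)" where
  "kronecker M M' = (\<chi> i j. M $ fst i $ fst j * M' $ snd i $ snd j)"

definition char_poly :: "real^'n^'n \<Rightarrow> real poly" where
  "char_poly M = det (mat [:0, 1:] - map_matrix (\<lambda>c. [:c:]) M)"

definition poly_matrix :: "real poly \<Rightarrow> real^'n^'n \<Rightarrow> real^'n^'n" where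
  "poly_matrix f M = (\<Sum>k\<le>degree f. coeff f k *\<^sub>R matpow M k)"

definition is_min_poly :: "real^'n^'n \<Rightarrow> real poly \<Rightarrow> bool" where
  "is_min_poly M f \<longleftrightarrow> lead_coeff f = 1 \<and> poly_matrix f M = 0 \<and>
     (\<forall>g. g \<noteq> 0 \<and> poly_matrix g M = 0 \<longrightarrow> degree f \<le> degree g)"

text \<open>The type \<open>'s\<close> indexes the rows of \<open>\<beta>\<close>, so that \<open>CARD('s)\<close> is forced to be the degree of
  the minimal polynomial of \<open>S\<close>, and \<open>n\<^sub>z = CARD('p) * CARD('s)\<close>.  The product
  \<open>I\<^sub>p \<otimes> \<sigma>\<close> has its columns indexed by \<open>'p \<times> 1\<close>, which is identified with \<open>'p\<close>.\<close>

definition minimal_p_copy_internal_model ::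
  "real^'q^'q \<Rightarrow> real^('p::finite \<times> 's::finite)^('p \<times> 's) \<Rightarrow>
   real^'p^('p \<times> 's) \<Rightarrow> bool" where
  "minimal_p_copy_internal_model S G1 G2 \<longleftrightarrow>
     (\<exists>(\<beta> :: real^'s^'s) (\<sigma> :: real^1^'s).
        is_min_poly S (char_poly \<beta>) \<and> controllable \<beta> \<sigma> \<and>
        G1 = kronecker (mat 1) \<beta> \<and>
        G2 = (\<chi> i j. kronecker (mat 1 :: real^'p^'p) \<sigma> $ i $ (j, 1)))"


subsection \<open>The communication digraph\<close>

text \<open>The nodes are the elements of \<open>'N option\<close>: \<open>None\<close> is the leader (node \<open>0\<close>) and
  \<open>Some i\<close> is the follower \<open>i\<close>.\<close>

definition weighted_adjacency :: "('v \<times> 'v) set \<Rightarrow> ('v \<Rightarrow> 'v \<Rightarrow> real) \<Rightarrow> bool" where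
  "weighted_adjacency edges a \<longleftrightarrow>
     (\<forall>i. a i i = 0) \<and>
     (\<forall>i j. a i j > 0 \<longleftrightarrow> (j, i) \<in> edges) \<and>
     (\<forall>i j. (i, j) \<in> edges \<and> (j, i) \<in> edges \<longrightarrow> a i j = a j i)"

definition neighbors :: "('v \<times> 'v) set \<Rightarrow> 'v \<Rightarrow> 'v set" where
  "neighbors edges i = {j. (j, i) \<in> edges}"

text \<open>The node set is \<open>UNIV\<close>, so a directed tree contained in \<open>edges\<close> is spanning.\<close>

definition directed_tree :: "'v \<Rightarrow> ('v \<times> 'v) set \<Rightarrow> bool" where
  "directed_tree r T \<longleftrightarrow>
     (\<forall>i. (i, r) \<notin> T) \<and>
     (\<forall>j. j \<noteq> r \<longrightarrow> (\<exists>!i. (i, j) \<in> T)) \<and>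
     (\<forall>j. (r, j) \<in> T\<^sup>*)"

definition has_directed_spanning_tree :: "('v \<times> 'v) set \<Rightarrow> 'v \<Rightarrow> bool" where
  "has_directed_spanning_tree edges r \<longleftrightarrow> (\<exists>T\<subseteq>edges. directed_tree r T)"

text \<open>This gives \<open>e\<^sub>v\<^sub>i\<close> when \<open>f0\<close> and \<open>f\<close> are the outputs of the leader and the followers, and
  \<open>\<eta>\<^sub>i\<close> when \<open>f0 = 0\<close> and \<open>f\<close> gives the observer states.\<close>

definition relative_signal ::
  "('N::finite option \<times> 'N option) set \<Rightarrow> ('N option \<Rightarrow> 'N option \<Rightarrow> real) \<Rightarrow>
   'b::real_vector \<Rightarrow> ('N \<Rightarrow> 'b) \<Rightarrow> 'N \<Rightarrow> 'b" where
  "relative_signal edges a f0 f i =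
     (\<Sum>j\<in>neighbors edges (Some i). a (Some i) j *\<^sub>R (f i - case_option f0 f j))"


subsection \<open>The closed-loop system\<close>

text \<open>The matrices \<open>(A, B, E, C)\<close> of one follower.  The vector \<open>w\<close> of all the uncertain parts
  has the type \<open>('n, 'm, 'q, 'p) plant ^ 'N\<close>, and the follower \<open>i\<close> has the matrices
  \<open>(A, B, E, C) + w $ i\<close>.\<close>

type_synonym ('n, 'm, 'q, 'p) plant =
  "(real^'n^'n) \<times> (real^'m^'n) \<times> (real^'q^'n) \<times> (real^'n^'p)"

definition follower_output ::
  "('n::finite, 'm::finite, 'q::finite, 'p::finite) plant \<Rightarrow> ('n, 'm, 'q, 'p) plant^'N \<Rightarrow> (int \<Rightarrow> (real^'n)^'N) \<Rightarrow>
   int \<Rightarrow> 'N \<Rightarrow> real^'p" where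
  "follower_output P w x t i = (case P + w $ i of (A, B, E, C) \<Rightarrow> C *v (x t $ i))"

definition leader_output :: "real^'q^'p \<Rightarrow> (int \<Rightarrow> real^'q) \<Rightarrow> int \<Rightarrow> real^'p" where
  "leader_output F v t = - (F *v v t)"

definition regulated_output ::
  "('n::finite, 'm::finite, 'q::finite, 'p::finite) plant \<Rightarrow> ('n, 'm, 'q, 'p) plant^'N \<Rightarrow> real^'q^'p \<Rightarrow>
   (int \<Rightarrow> real^'q) \<Rightarrow> (int \<Rightarrow> (real^'n)^'N) \<Rightarrow> int \<Rightarrow> 'N \<Rightarrow> real^'p" where
  "regulated_output P w F v x t i = follower_output P w x t i - leader_output F v t"

definition control_input ::
  "('N::finite option \<times> 'N option) set \<Rightarrow> ('N option \<Rightarrow> 'N option \<Rightarrow> real) \<Rightarrow> nat \<Rightarrow>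
   real^'k^'m \<Rightarrow> real^'n^'m \<Rightarrow> (int \<Rightarrow> (real^'k)^'N) \<Rightarrow> (int \<Rightarrow> (real^'n)^'N) \<Rightarrow>
   int \<Rightarrow> 'N \<Rightarrow> real^'m" where
  "control_input edges a rcom K1 K2 z \<xi> t i =
     K1 *v (z (t - int rcom) $ i) +
     K2 *v relative_signal edges a 0 (($) (\<xi> (t - int rcom))) i"

text \<open>The signals are functions on all of \<open>int\<close>, but the equations are imposed for \<open>t \<ge> 0\<close>
  only.  They involve no time before \<open>- (rcom + rcon)\<close>, and they leave the values of the
  states on \<open>{- (rcom + rcon)..0}\<close> arbitrary; these are the initial conditions.  The states
  \<open>z\<close> and \<open>\<xi>\<close> are those of the controller before the change of variables.\<close>

definition closed_loop ::
  "('N::finite option \<times> 'N option) set \<Rightarrow> ('N option \<Rightarrow> 'N option \<Rightarrow> real) \<Rightarrow>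
   ('n::finite, 'm::finite, 'q::finite, 'p::finite) plant \<Rightarrow> real^'q^'q \<Rightarrow> real^'q^'p \<Rightarrow> nat \<Rightarrow> nat \<Rightarrow>
   real^'k^'k \<Rightarrow> real^'p^'k \<Rightarrow> real^'k^'m \<Rightarrow> real^'n^'m \<Rightarrow> real^'p^'n \<Rightarrow>
   ('n, 'm, 'q, 'p) plant^'N \<Rightarrow>
   (int \<Rightarrow> real^'q) \<Rightarrow> (int \<Rightarrow> (real^'n)^'N) \<Rightarrow> (int \<Rightarrow> (real^'k)^'N) \<Rightarrow>
   (int \<Rightarrow> (real^'n)^'N) \<Rightarrow> bool" where
  "closed_loop edges a P S F rcon rcom G1 G2 K1 K2 L w v x z \<xi> \<longleftrightarrow>
     (\<forall>t\<ge>0. v (t + 1) = S *v v t \<and>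
       (\<forall>i. let
           (A, B, E, C) = P;
           (A', B', E', C') = P + w $ i;
           u = control_input edges a rcom K1 K2 z \<xi> (t - int rcon) i;
           \<eta> = relative_signal edges a 0 (($) (\<xi> t)) i;
           ev = relative_signal edges a (leader_output F v t) (follower_output P w x t) i
         in
           x (t + 1) $ i = A' *v (x t $ i) + B' *v u + E' *v v t \<and>
           z (t + 1) $ i = G1 *v (z t $ i) + G2 *v ev \<and>
           \<xi> (t + 1) $ i = A *v (\<xi> t $ i) + B *v u - (L ** C) *v \<eta> + L *v ev))"

definition nominally_exp_stable ::
  "('N::finite option \<times> 'N option) set \<Rightarrow> ('N option \<Rightarrow> 'N option \<Rightarrow> real) \<Rightarrow>
   ('n::finite, 'm::finite, 'q::finite, 'p::finite) plant \<Rightarrow> real^'q^'q \<Rightarrow> real^'q^'p \<Rightarrow> nat \<Rightarrow> nat \<Rightarrow>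
   real^'k^'k \<Rightarrow> real^'p^'k \<Rightarrow> real^'k^'m \<Rightarrow> real^'n^'m \<Rightarrow> real^'p^'n \<Rightarrow> bool" where
  "nominally_exp_stable edges a P S F rcon rcom G1 G2 K1 K2 L \<longleftrightarrow>
     (\<exists>c>0. \<exists>\<gamma>. 0 < \<gamma> \<and> \<gamma> < 1 \<and>
       (\<forall>x z \<xi>. closed_loop edges a P S F rcon rcom G1 G2 K1 K2 L 0 (\<lambda>_. 0) x z \<xi> \<longrightarrow>
         (\<forall>t::nat. norm (x (int t), z (int t), \<xi> (int t)) \<le>
            c * \<gamma> ^ t * (MAX s\<in>{- int (rcom + rcon)..0}. norm (x s, z s, \<xi> s)))))"

definition solves_cooperative_robust_output_regulation ::
  "('N::finite option \<times> 'N option) set \<Rightarrow> ('N option \<Rightarrow> 'N option \<Rightarrow> real) \<Rightarrow>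
   ('n::finite, 'm::finite, 'q::finite, 'p::finite) plant \<Rightarrow> real^'q^'q \<Rightarrow> real^'q^'p \<Rightarrow> nat \<Rightarrow> nat \<Rightarrow>
   real^'k^'k \<Rightarrow> real^'p^'k \<Rightarrow> real^'k^'m \<Rightarrow> real^'n^'m \<Rightarrow> real^'p^'n \<Rightarrow> bool" where
  "solves_cooperative_robust_output_regulation edges a P S F rcon rcom G1 G2 K1 K2 L \<longleftrightarrow>
     nominally_exp_stable edges a P S F rcon rcom G1 G2 K1 K2 L \<and>
     (\<exists>W. open W \<and> 0 \<in> W \<and>
       (\<forall>w\<in>W. \<forall>v x z \<xi>. closed_loop edges a P S F rcon rcom G1 G2 K1 K2 L w v x z \<xi> \<longrightarrow>
         (\<forall>i. (\<lambda>t::nat. regulated_output P w F v x (int t) i) \<longlonglongrightarrow> 0)))"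

end

theory Submission
  imports Defs "HOL-Computational_Algebra.Fundamental_Theorem_Algebra"
begin

text \<open>Write \<open>H\<close> for the follower block of the graph Laplacian (\<open>network_matrix\<close>), so that the relative signals
are \<open>H\<close> applied to the tracking errors or to the observer states.

\<^emph>\<open>Sufficiency.\<close>  In the nominal loop the error \<open>d = x - \<xi>\<close> obeys \<open>d(t + 1) = A d(t) - L C (H d)(t)\<close>, and
once it has died out the pair \<open>((H \<xi>)\<^sub>i, z\<^sub>i)\<close> obeys an augmented plant with a delayed feedback in which
followers are again mixed by \<open>H\<close> only.  The set of modes belonging to one value \<open>\<zeta>\<close> is invariant under \<open>H\<close>,
so it contains an eigenvector of \<open>H\<close>: it suffices to stabilise \<open>A - \<mu> L C\<close> and the augmented plant with
loop gain \<open>\<mu> K\<close> for every eigenvalue \<open>\<mu>\<close> of \<open>H\<close> (\<open>network_decoupling\<close>).  A spanning tree rooted at the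
leader puts all these \<open>\<mu>\<close> into the open right half plane (\<open>network_matrix_spectrum_right_half_plane\<close>).
One gain has to serve all of them; both gains come from \<open>low_gain_feedback\<close>, the observer gain by
transposition and without delay.

\<^emph>\<open>Low gain.\<close>  Let all eigenvalues of \<open>A\<close> lie on the unit circle and solve \<open>A W A\<^sup>T = \<rho> (W + B B\<^sup>T)\<close> with
\<open>\<rho> < 1\<close>.  With \<open>P = W\<^sup>-\<^sup>1\<close> the function \<open>V(x) = x\<^sup>T P x\<close> satisfies \<open>V(A x) \<le> \<rho> V(x) + |B\<^sup>T P A x|\<^sup>2\<close>, and
the feedback \<open>- \<nu> \<mu> B\<^sup>T P A x\<close> with \<open>\<nu> Re \<mu> \<ge> 1\<close> removes the last term at the price of terms of the order
of \<open>B\<^sup>T P B\<close>.  These vanish as \<open>\<rho>\<close> tends to \<open>1\<close>: on the unit circle a control task can be spread over a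
long time at little cost (\<open>unit_circle_mean_value\<close>).  For the same reason a delay costs only a small
error once \<open>x(t)\<close> has been replaced by the prediction \<open>A\<^sup>r x(t - r)\<close>.  Eigenvalues inside the disc are
split off by a spectral projection.

\<^emph>\<open>From modes to trajectories.\<close>  Multiplication by the adjugate of the characteristic polynomial matrix
turns a delay system without modes \<open>|\<zeta>| \<ge> 1\<close> into scalar recurrences with all roots in the open disc
(\<open>delay_decay\<close>), and by compactness the absence of such modes persists under small perturbations of the
plant (\<open>no_unstable_mode_robust\<close>).  For regulation let \<open>f\<close> be the minimal polynomial of \<open>S\<close>.  Applying
\<open>f\<close> of the shift to the loop removes the exosystem, hence \<open>f\<close> of the shift sends every trajectory to a
decaying one.  In the internal model this filtered state is a combination of the vectors \<open>\<beta>\<^sup>k \<sigma>\<close> with the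
relative errors as coefficients, and controllability allows the error to be read off
(\<open>internal_model_error_tendsto_0\<close>).

\<^emph>\<open>Necessity.\<close>  The followers that the leader does not reach receive no signal from the others.  If they
start with equal data, all their relative signals vanish and their internal models run freely, with an
eigenvalue of modulus one (\<open>reachable_if_exp_stable\<close>).\<close>

section \<open>Polynomials in the shift operator\<close>

text \<open>This is \<open>p(\<Sigma>) y\<close> for the shift operator \<open>\<Sigma>\<close> on sequences.\<close>

definition shift_act :: "'a::comm_ring_1 poly \<Rightarrow> (nat \<Rightarrow> 'a) \<Rightarrow> nat \<Rightarrow> 'a" where
  "shift_act p y t = (\<Sum>k\<le>degree p. coeff p k * y (t + k))"

lemma shift_act_altdef:
  assumes "degree p \<le> n"
  shows "shift_act p y t = (\<Sum>k\<le>n. coeff p k * y (t + k))"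
  unfolding shift_act_def
  using assms by (intro sum.mono_neutral_left) (auto simp: coeff_eq_0)

lemma shift_act_0 [simp]: "shift_act 0 y t = 0"
  by (simp add: shift_act_def)

lemma shift_act_pCons: "shift_act (pCons c p) y t = c * y t + shift_act p y (Suc t)"
proof -
  have "shift_act (pCons c p) y t = (\<Sum>k\<le>Suc (degree p). coeff (pCons c p) k * y (t + k))"
    by (rule shift_act_altdef) (rule degree_pCons_le)
  also have "\<dots> = c * y t + (\<Sum>k\<le>degree p. coeff p k * y (t + Suc k))"
    by (subst sum.atMost_Suc_shift) simp
  finally show ?thesis by (simp add: shift_act_def)
qed

lemma shift_act_add: "shift_act (p + q) y t = shift_act p y t + shift_act q y t"
proof -
  let ?n = "max (degree p) (degree q)"
  have "shift_act (p + q) y t = (\<Sum>k\<le>?n. coeff (p + q) k * y (t + k))"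
    by (rule shift_act_altdef) (rule degree_add_le_max)
  then show ?thesis
    by (simp add: shift_act_altdef[of p ?n] shift_act_altdef[of q ?n] distrib_right sum.distrib)
qed

lemma shift_act_sum: "shift_act (sum f I) y t = (\<Sum>i\<in>I. shift_act (f i) y t)"
  by (induction I rule: infinite_finite_induct) (simp_all add: shift_act_add)

lemma shift_act_smult: "shift_act (smult c p) y t = c * shift_act p y t"
proof -
  have "shift_act (smult c p) y t = (\<Sum>k\<le>degree p. coeff (smult c p) k * y (t + k))"
    by (rule shift_act_altdef) (rule degree_smult_le)
  then show ?thesis by (simp add: shift_act_def sum_distrib_left mult.assoc)
qed

lemma shift_act_minus: "shift_act (- p) y t = - shift_act p y t"
  using shift_act_smult[of "-1" p y t] by simp

lemma shift_act_diff: "shift_act (p - q) y t = shift_act p y t - shift_act q y t"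
  using shift_act_add[of p "- q" y t] by (simp add: shift_act_minus)

lemma shift_act_shift: "shift_act p (\<lambda>s. y (s + d)) t = shift_act p y (t + d)"
  by (simp add: shift_act_def ac_simps)

text \<open>Sequences form a module over the polynomial ring; factoring a polynomial therefore solves a recurrence
one root at a time.\<close>

lemma shift_act_mult: "shift_act (p * q) y t = shift_act p (shift_act q y) t"
proof (induction p arbitrary: t)
  case (pCons c p)
  then show ?case
    by (simp add: shift_act_pCons shift_act_add shift_act_smult)
qed simp

lemma shift_act_monom: "shift_act (monom c n) y t = c * y (t + n)"
proof -
  have "shift_act (monom c n) y t = (\<Sum>k\<le>n. coeff (monom c n) k * y (t + k))"
    by (rule shift_act_altdef) (rule degree_monom_le)
  also have "\<dots> = (\<Sum>k\<le>n. if n = k then c * y (t + k) else 0)"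
    by (intro sum.cong) (auto simp: coeff_monom)
  finally show ?thesis by simp
qed

lemma shift_act_seq_sum: "shift_act p (\<lambda>s. \<Sum>i\<in>I. y i s) t = (\<Sum>i\<in>I. shift_act p (y i) t)"
  unfolding shift_act_def sum_distrib_left by (rule sum.swap)

lemma shift_act_seq_scale: "shift_act p (\<lambda>s. c * y s) t = c * shift_act p y t"
  unfolding shift_act_def sum_distrib_left by (intro sum.cong) (simp_all add: mult_ac)

lemma shift_act_seq_zero [simp]: "shift_act p (\<lambda>s. 0) t = 0"
  by (simp add: shift_act_def)

lemma poly_root_factor:
  fixes p :: "complex poly"
  assumes "p \<noteq> 0" and "degree p = Suc n"
  obtains \<mu> q where "p = q * [:- \<mu>, 1:]" "poly p \<mu> = 0" "q \<noteq> 0" "degree q = n"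
proof -
  have "\<not> constant (poly p)"
    using assms by (simp add: constant_degree)
  then obtain \<mu> where \<mu>: "poly p \<mu> = 0"
    using fundamental_theorem_of_algebra by blast
  then have "[:- \<mu>, 1:] dvd p"
    by (simp add: poly_eq_0_iff_dvd)
  then obtain q where q: "p = q * [:- \<mu>, 1:]"
    by (metis dvd_def mult.commute)
  with assms have "q \<noteq> 0" by auto
  then have "degree p = degree q + degree [:- \<mu>, 1:]"
    unfolding q by (intro degree_mult_eq) auto
  then have "degree q = n" using assms by simp
  with that[OF q \<mu> \<open>q \<noteq> 0\<close>] show thesis .
qed

lemma first_order_decay:
  fixes y :: "nat \<Rightarrow> complex"
  assumes "\<And>t. y (Suc t) = \<mu> * y t + u t" and "\<And>t. cmod (u t) \<le> K * \<gamma> ^ t"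
    and "cmod \<mu> < g" "\<gamma> \<le> g" "0 \<le> \<gamma>" "0 \<le> K"
  shows "cmod (y t) \<le> (cmod (y 0) + K / (g - cmod \<mu>)) * g ^ t"
proof (induction t)
  case 0
  then show ?case using assms by simp
next
  case (Suc t)
  let ?D = "cmod (y 0) + K / (g - cmod \<mu>)"
  have K: "K \<le> ?D * (g - cmod \<mu>)"
  proof -
    have "K = K / (g - cmod \<mu>) * (g - cmod \<mu>)" using assms(3) by simp
    also have "\<dots> \<le> ?D * (g - cmod \<mu>)" using assms(3) by (intro mult_right_mono) auto
    finally show ?thesis .
  qed
  have "cmod (y (Suc t)) \<le> cmod \<mu> * cmod (y t) + cmod (u t)"
    unfolding assms(1) by (metis norm_mult norm_triangle_ineq)
  also have "\<dots> \<le> cmod \<mu> * (?D * g ^ t) + K * g ^ t"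
    using Suc assms(2)[of t] power_mono[of \<gamma> g t] assms(4-6)
    by (intro add_mono mult_left_mono) (auto intro: order_trans mult_left_mono)
  also have "\<dots> = (cmod \<mu> * ?D + K) * g ^ t"
    by (simp add: algebra_simps)
  also have "\<dots> \<le> (?D * g) * g ^ t"
  proof (rule mult_right_mono)
    have "?D * (g - cmod \<mu>) = ?D * g - cmod \<mu> * ?D" by (simp add: right_diff_distrib)
    then show "cmod \<mu> * ?D + K \<le> ?D * g" using K by linarith
    show "0 \<le> g ^ t" using assms by simp
  qed
  finally show ?case by (simp add: mult_ac)
qed

text \<open>Splitting off a root \<open>\<mu>\<close>, the sequence \<open>u(t) = y(t + 1) - \<mu> y(t)\<close> obeys a recurrence of smaller order
and so decays, and \<open>first_order_decay\<close> passes this on to \<open>y\<close>.  The constants depend on \<open>p\<close> only, which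
is what makes the exponential bounds below uniform in the initial data.\<close>

lemma recurrence_decay:
  fixes p :: "complex poly"
  assumes "p \<noteq> 0" and "\<And>z. poly p z = 0 \<Longrightarrow> cmod z < 1"
  shows "\<exists>c>0. \<exists>\<gamma>. 0 < \<gamma> \<and> \<gamma> < 1 \<and>
    (\<forall>y. (\<forall>t. shift_act p y t = 0) \<longrightarrow>
      (\<forall>t. cmod (y t) \<le> c * \<gamma> ^ t * (\<Sum>k\<le>degree p. cmod (y k))))"
  using assms
proof (induction "degree p" arbitrary: p)
  case 0
  then obtain a where a: "p = [:a:]" "a \<noteq> 0"
    by (metis degree_eq_zeroE pCons_eq_0_iff)
  show ?case
    by (rule exI[of _ 1], simp, rule exI[of _ "1/2"]) (auto simp: a shift_act_pCons)
next
  case (Suc n)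
  then obtain \<mu> q where q: "p = q * [:- \<mu>, 1:]" "poly p \<mu> = 0" "q \<noteq> 0" "degree q = n"
    using poly_root_factor[of p n] by metis
  have "cmod z < 1" if "poly q z = 0" for z
    using Suc.prems(2)[of z] that by (simp add: q(1))
  from Suc.hyps(1)[OF q(4)[symmetric] q(3) this] obtain c \<gamma> where c: "c > 0" "0 < \<gamma>" "\<gamma> < 1"
    and decay: "\<And>y. (\<forall>t. shift_act q y t = 0) \<Longrightarrow>
      \<forall>t. cmod (y t) \<le> c * \<gamma> ^ t * (\<Sum>k\<le>degree q. cmod (y k))"
    by metis
  have \<mu>: "cmod \<mu> < 1" using Suc.prems(2) q(2) by blast
  \<comment> \<open>a rate below 1 that exceeds the modulus of the new root\<close>
  define g where "g = (max \<gamma> (cmod \<mu>) + 1) / 2"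
  have g: "cmod \<mu> < g" "\<gamma> \<le> g" "0 < g" "g < 1"
    using \<mu> c by (auto simp: g_def max_def)
  define C where "C = 1 + 2 * c / (g - cmod \<mu>)"
  have "C > 0" unfolding C_def using c g by (intro add_pos_nonneg) auto
  moreover have "cmod (y t) \<le> C * g ^ t * (\<Sum>k\<le>degree p. cmod (y k))"
    if y: "\<forall>t. shift_act p y t = 0" for y t
  proof -
    let ?s = "\<Sum>k\<le>degree p. cmod (y k)"
    define u where "u t = y (Suc t) - \<mu> * y t" for t
    have u: "u = shift_act [:- \<mu>, 1:] y"
      by (rule ext) (simp add: u_def shift_act_pCons)
    have dp: "degree p = Suc n" using Suc.hyps(2) by simp
    have "\<forall>t. shift_act q u t = 0"
      using y unfolding u q(1) by (simp only: shift_act_mult) simp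
    then have du: "\<forall>t. cmod (u t) \<le> c * \<gamma> ^ t * (\<Sum>k\<le>n. cmod (u k))"
      using decay[of u] q(4) by blast
    have "(\<Sum>k\<le>n. cmod (u k)) \<le> (\<Sum>k\<le>n. cmod (y (Suc k)) + cmod (y k))"
    proof (rule sum_mono)
      fix k
      have "cmod (u k) \<le> cmod (y (Suc k)) + cmod (\<mu> * y k)"
        unfolding u_def by (rule norm_triangle_ineq4)
      also have "cmod (\<mu> * y k) \<le> 1 * cmod (y k)"
        unfolding norm_mult using \<mu> by (intro mult_right_mono) auto
      finally show "cmod (u k) \<le> cmod (y (Suc k)) + cmod (y k)" by simp
    qed
    also have "\<dots> \<le> 2 * ?s"
    proof -
      have "(\<Sum>k\<le>n. cmod (y (Suc k))) \<le> ?s"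
        unfolding dp by (subst sum.atMost_Suc_shift) simp
      moreover have "(\<Sum>k\<le>n. cmod (y k)) \<le> ?s"
        unfolding dp by simp
      ultimately show ?thesis by (simp add: sum.distrib)
    qed
    finally have su: "(\<Sum>k\<le>n. cmod (u k)) \<le> 2 * ?s" .
    have "cmod (u t) \<le> (c * (2 * ?s)) * \<gamma> ^ t" for t
    proof -
      have "cmod (u t) \<le> c * \<gamma> ^ t * (\<Sum>k\<le>n. cmod (u k))" using du by blast
      also have "\<dots> \<le> c * \<gamma> ^ t * (2 * ?s)"
        using su c by (intro mult_left_mono) auto
      finally show ?thesis by (simp add: mult_ac)
    qed
    then have "cmod (y t) \<le> (cmod (y 0) + (c * (2 * ?s)) / (g - cmod \<mu>)) * g ^ t"
      using c g by (intro first_order_decay[of y \<mu> u _ \<gamma>]) (auto simp: u_def sum_nonneg)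
    also have "\<dots> \<le> (C * ?s) * g ^ t"
    proof (rule mult_right_mono)
      have "cmod (y 0) \<le> ?s"
        by (rule member_le_sum) auto
      then show "cmod (y 0) + c * (2 * ?s) / (g - cmod \<mu>) \<le> C * ?s"
        by (simp add: C_def algebra_simps)
    qed (use g in simp)
    finally show ?thesis by (simp add: mult_ac)
  qed
  ultimately show ?case using g by blast
qed

text \<open>For a root \<open>\<mu>\<close>, subtracting from \<open>y\<close> the mean of \<open>\<mu>\<^sup>-\<^sup>k y(t + k)\<close> over \<open>k = 1, \<dots>, M\<close> removes the factor \<open>X - \<mu>\<close> from
the recurrence, and this mean is itself bounded by the average of the moduli.  What matters is that \<open>c\<close> and
\<open>D\<close> do not depend on \<open>M\<close>: such a solution cannot be concentrated at one time.\<close>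

lemma unit_circle_mean_value:
  fixes p :: "complex poly"
  assumes "p \<noteq> 0" and "\<And>z. poly p z = 0 \<Longrightarrow> cmod z = 1"
  shows "\<exists>c\<ge>0. \<exists>D. \<forall>M\<ge>1. \<forall>y. (\<forall>t. shift_act p y t = 0) \<longrightarrow>
      cmod (y 0) \<le> c / real M * (\<Sum>k=1..D * M. cmod (y k))"
  using assms
proof (induction "degree p" arbitrary: p)
  case 0
  then obtain a where a: "p = [:a:]" "a \<noteq> 0"
    by (metis degree_eq_zeroE pCons_eq_0_iff)
  show ?case
    by (rule exI[of _ 0]) (auto simp: a shift_act_pCons)
next
  case (Suc n)
  then obtain \<mu> q where q: "p = q * [:- \<mu>, 1:]" "poly p \<mu> = 0" "q \<noteq> 0" "degree q = n"
    using poly_root_factor[of p n] by metis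
  have \<mu>: "cmod \<mu> = 1" using Suc.prems(2) q(2) by blast
  then have \<mu>0: "\<mu> \<noteq> 0" by auto
  have "cmod z = 1" if "poly q z = 0" for z
    using Suc.prems(2)[of z] that by (simp add: q(1))
  from Suc.hyps(1)[OF q(4)[symmetric] q(3) this] obtain c D where c: "c \<ge> 0"
    and IH: "\<And>M y. M \<ge> 1 \<Longrightarrow> (\<forall>t. shift_act q y t = 0) \<Longrightarrow>
      cmod (y 0) \<le> c / real M * (\<Sum>k=1..D * M. cmod (y k))"
    by metis
  have "cmod (y 0) \<le> (1 + c * (1 + real D)) / real M * (\<Sum>k=1..Suc D * M. cmod (y k))"
    if M: "M \<ge> 1" and y: "\<forall>t. shift_act p y t = 0" for M y
  proof -
    let ?s = "\<Sum>k=1..Suc D * M. cmod (y k)"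
    have M0: "real M > 0" using M by simp
    define avg where "avg t = (\<Sum>k=1..M. y (t + k) / \<mu> ^ k) / of_nat M" for t
    define w where "w t = y t - avg t" for t
    define u where "u = shift_act q y"
    \<comment> \<open>The weighted mean reproduces \<open>u = q(\<Sigma>) y\<close>, because u is a multiple of \<open>\<mu>\<^sup>t\<close>; hence q annihilates w.\<close>
    have "u (Suc t) = \<mu> * u t" for t
    proof -
      have "shift_act ([:- \<mu>, 1:] * q) y t = 0" using y unfolding q(1) by (simp only: mult.commute)
      then show ?thesis unfolding shift_act_mult by (simp add: shift_act_pCons u_def)
    qed
    then have uk: "u (t + k) = \<mu> ^ k * u t" for t k
      by (induction k) auto
    have qw: "\<forall>t. shift_act q w t = 0"
    proof
      fix t
      have "shift_act q w t = u t - shift_act q avg t"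
        unfolding shift_act_def w_def u_def by (simp add: right_diff_distrib sum_subtractf)
      also have "avg = (\<lambda>s. \<Sum>k=1..M. 1 / (of_nat M * \<mu> ^ k) * y (s + k))"
        by (rule ext) (simp add: avg_def sum_divide_distrib mult.commute)
      also have "shift_act q \<dots> t = (\<Sum>k=1..M. 1 / (of_nat M * \<mu> ^ k) * u (t + k))"
        by (simp only: shift_act_seq_sum shift_act_seq_scale shift_act_shift u_def)
      also have "\<dots> = (\<Sum>k=1..M. u t / of_nat M)"
        using \<mu>0 by (intro sum.cong) (simp_all add: uk)
      also have "\<dots> = u t" using M by simp
      finally show "shift_act q w t = 0" by simp
    qed
    have avg_le: "cmod (avg t) \<le> (\<Sum>k=1..M. cmod (y (t + k))) / real M" for t
    proof -
      have "cmod (avg t) = cmod (\<Sum>k=1..M. y (t + k) / \<mu> ^ k) / real M"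
        by (simp add: avg_def norm_divide)
      also have "\<dots> \<le> (\<Sum>k=1..M. cmod (y (t + k) / \<mu> ^ k)) / real M"
        by (intro divide_right_mono norm_sum) simp
      finally show ?thesis by (simp add: norm_divide norm_power \<mu>)
    qed
    have window: "(\<Sum>k=1..M. cmod (y (t + k))) \<le> ?s" if "t \<le> D * M" for t
    proof -
      have "(\<Sum>k=1..M. cmod (y (t + k))) = (\<Sum>k\<in>(+) t ` {1..M}. cmod (y k))"
        by (subst sum.reindex) (auto simp: inj_on_def)
      also have "\<dots> \<le> ?s"
        using that by (intro sum_mono2) auto
      finally show ?thesis .
    qed
    have "(\<Sum>k=1..D * M. cmod (w k)) \<le> (\<Sum>k=1..D * M. cmod (y k) + ?s / real M)"
    proof (rule sum_mono)
      fix k assume "k \<in> {1..D * M}"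
      then have "cmod (avg k) \<le> ?s / real M"
        using avg_le[of k] window[of k] M0
        by (meson atLeastAtMost_iff divide_right_mono less_imp_le order_trans)
      moreover have "cmod (w k) \<le> cmod (y k) + cmod (avg k)"
        unfolding w_def by (rule norm_triangle_ineq4)
      ultimately show "cmod (w k) \<le> cmod (y k) + ?s / real M" by linarith
    qed
    also have "\<dots> = (\<Sum>k=1..D * M. cmod (y k)) + real D * ?s"
      using M0 by (simp add: sum.distrib)
    also have "(\<Sum>k=1..D * M. cmod (y k)) \<le> ?s"
      by (intro sum_mono2) auto
    finally have "(\<Sum>k=1..D * M. cmod (w k)) \<le> (1 + real D) * ?s"
      by (simp add: algebra_simps)
    then have "c / real M * (\<Sum>k=1..D * M. cmod (w k)) \<le> c / real M * ((1 + real D) * ?s)"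
      using c by (intro mult_left_mono) auto
    with IH[OF M qw] have "cmod (w 0) \<le> c / real M * ((1 + real D) * ?s)"
      by linarith
    moreover have "cmod (avg 0) \<le> ?s / real M"
      using avg_le[of 0] window[of 0] M0
      by (meson divide_right_mono less_imp_le order_trans zero_le)
    moreover have "cmod (y 0) \<le> cmod (w 0) + cmod (avg 0)"
      unfolding w_def by (metis diff_add_cancel norm_triangle_ineq)
    ultimately have "cmod (y 0) \<le> c / real M * ((1 + real D) * ?s) + ?s / real M"
      by linarith
    also have "\<dots> = (1 + c * (1 + real D)) / real M * ?s"
      by (simp add: field_simps add_divide_distrib)
    finally show ?thesis .
  qed
  moreover have "1 + c * (1 + real D) \<ge> 0" using c by simp
  ultimately show ?case by blast
qed

section \<open>Adjugates, the Cayley-Hamilton theorem and invariant subspaces\<close>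

definition adjugate :: "'a::comm_ring_1^'n^'n \<Rightarrow> 'a^'n^'n" where
  "adjugate M = (\<chi> i j. det (\<chi> k. if k = i then axis j 1 else row k (transpose M)))"

text \<open>Entry \<open>(k, j)\<close> of the product is, by linearity in one row, the determinant of the matrix whose column \<open>k\<close>
is replaced by column \<open>j\<close>.  The identity is needed over polynomial rings, where Cramer's rule for fields
does not apply.\<close>

lemma adjugate_mult: "adjugate M ** M = mat (det M)"
proof -
  have "(\<Sum>i\<in>UNIV. adjugate M $ k $ i * M $ i $ j) = (if k = j then det M else 0)" for k j
  proof -
    let ?R = "\<lambda>v. det (\<chi> l. if l = k then v else row l (transpose M))"
    have "(\<Sum>i\<in>UNIV. adjugate M $ k $ i * M $ i $ j) = (\<Sum>i\<in>UNIV. ?R (M $ i $ j *s axis i 1))"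
      by (intro sum.cong refl) (simp add: adjugate_def det_row_mul mult.commute)
    also have "\<dots> = ?R (\<Sum>i\<in>UNIV. M $ i $ j *s axis i 1)"
      by (rule det_linear_row_sum[symmetric]) simp
    also have "(\<Sum>i\<in>UNIV. M $ i $ j *s axis i 1) = row j (transpose M)"
      by (simp add: vec_eq_iff row_def transpose_def axis_def if_distrib[of "(*) _"] cong: if_cong)
    also have "?R (row j (transpose M)) = (if k = j then det M else 0)"
    proof (cases "k = j")
      case True
      then have "(\<chi> l. if l = k then row j (transpose M) else row l (transpose M)) = transpose M"
        by (simp add: vec_eq_iff row_def)
      then show ?thesis using True by simp
    next
      case False
      then show ?thesis
        by (simp, intro det_identical_rows[of k j]) (simp_all add: row_def vec_eq_iff)
    qed
    finally show ?thesis .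
  qed
  then show ?thesis
    by (simp add: vec_eq_iff matrix_matrix_mult_def mat_def)
qed

text \<open>Multiplying the system by the adjugate decouples the coordinates.\<close>

lemma det_annihilates:
  fixes Q :: "'a::comm_ring_1 poly^'n^'n"
  assumes "\<And>i t. (\<Sum>j\<in>UNIV. shift_act (Q $ i $ j) (X j) t) = 0"
  shows "shift_act (det Q) (X k) t = 0"
proof -
  have "0 = (\<Sum>i\<in>UNIV. shift_act (adjugate Q $ k $ i) (\<lambda>t. \<Sum>j\<in>UNIV. shift_act (Q $ i $ j) (X j) t) t)"
    by (simp add: assms)
  also have "\<dots> = (\<Sum>i\<in>UNIV. \<Sum>j\<in>UNIV. shift_act (adjugate Q $ k $ i * Q $ i $ j) (X j) t)"
    by (simp add: shift_act_seq_sum shift_act_mult)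
  also have "\<dots> = (\<Sum>j\<in>UNIV. shift_act ((adjugate Q ** Q) $ k $ j) (X j) t)"
    by (subst sum.swap) (simp add: matrix_matrix_mult_def shift_act_sum)
  also have "\<dots> = (\<Sum>j\<in>UNIV. if k = j then shift_act (det Q) (X j) t else 0)"
    unfolding adjugate_mult by (intro sum.cong refl) (simp add: mat_def)
  finally show ?thesis by simp
qed

lemma poly_det: "poly (det Q) z = det (map_matrix (\<lambda>p. poly p z) Q)"
  by (simp add: det_def poly_sum poly_prod of_int_poly)

text \<open>The matrix \<open>X I - M\<close> over the polynomial ring.\<close>

definition char_matrix :: "'a::comm_ring_1^'n^'n \<Rightarrow> 'a poly^'n^'n" where
  "char_matrix M = mat [:0, 1:] - map_matrix (\<lambda>c. [:c:]) M"

lemma matpow_Suc_vec: "matpow M (Suc k) *v x = M *v (matpow M k *v x)"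
  by (simp add: matrix_vector_mul_assoc)

text \<open>The Cayley-Hamilton theorem in terms of orbits: \<open>X I - M\<close> annihilates \<open>M\<^sup>t x\<close>.\<close>

lemma char_matrix_annihilates:
  "shift_act (det (char_matrix M)) (\<lambda>t. (matpow M t *v x) $ k) t = 0"
proof (rule det_annihilates)
  fix i t
  have "(\<Sum>j\<in>UNIV. shift_act (char_matrix M $ i $ j) (\<lambda>t. (matpow M t *v x) $ j) t) =
      (\<Sum>j\<in>UNIV. (if i = j then (matpow M (Suc t) *v x) $ j else 0) - M $ i $ j * (matpow M t *v x) $ j)"
    by (intro sum.cong refl) (simp add: char_matrix_def mat_def shift_act_diff shift_act_pCons del: matpow.simps)
  also have "\<dots> = (matpow M (Suc t) *v x) $ i - (M *v (matpow M t *v x)) $ i"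
    by (simp add: sum_subtractf matrix_vector_mult_def[of M] del: matpow.simps)
  also have "\<dots> = 0" by (simp only: matpow_Suc_vec) simp
  finally show "(\<Sum>j\<in>UNIV. shift_act (char_matrix M $ i $ j) (\<lambda>t. (matpow M t *v x) $ j) t) = 0" .
qed

lemma poly_det_char_matrix: "poly (det (char_matrix M)) z = det (mat z - M)"
proof -
  have "map_matrix (\<lambda>p. poly p z) (char_matrix M) = mat z - M"
    by (simp add: vec_eq_iff char_matrix_def mat_def)
  then show ?thesis by (simp add: poly_det)
qed

lemma mat_vector_mult: "mat c *v x = c *s (x :: 'a::comm_semiring_1^'n)"
proof -
  have "(\<Sum>j\<in>UNIV. (if i = j then c else 0) * x $ j) = (\<Sum>j\<in>UNIV. if i = j then c * x $ j else 0)" for i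
    by (intro sum.cong) auto
  then show ?thesis
    by (simp add: vec_eq_iff matrix_vector_mult_def mat_def)
qed

lemma matrix_vector_mult_vector_scalar: "M *v (c *s x) = c *s (M *v (x :: 'a::comm_semiring_1^'n))"
  by (simp add: vec_eq_iff matrix_vector_mult_def sum_distrib_left mult_ac)

lemma det_eq_0_kernel:
  fixes M :: "'a::field^'n^'n"
  shows "det M = 0 \<longleftrightarrow> (\<exists>x. x \<noteq> 0 \<and> M *v x = 0)"
  using invertible_det_nz[of M] matrix_left_invertible_ker[of M] invertible_left_inverse[of M]
  by auto

lemma det_char_matrix_eq_0_iff:
  fixes M :: "'a::field^'n^'n"
  shows "poly (det (char_matrix M)) z = 0 \<longleftrightarrow> (\<exists>x. x \<noteq> 0 \<and> M *v x = z *s x)"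
proof -
  have "(mat z - M) *v x = 0 \<longleftrightarrow> M *v x = z *s x" for x
    by (auto simp: matrix_vector_mult_diff_rdistrib mat_vector_mult)
  then show ?thesis unfolding poly_det_char_matrix det_eq_0_kernel by auto
qed

lemma norm_vector_scalar_mult: "norm (c *s x) = cmod c * norm (x :: complex^'n)"
  unfolding norm_vec_def by (simp add: norm_mult L2_set_right_distrib)

lemma complex_vector_scaleR: "complex_of_real r *s x = r *\<^sub>R (x :: complex^'n)"
  unfolding vec_eq_iff vector_smult_component vector_scaleR_component by (simp add: scaleR_conv_of_real)

text \<open>A number larger than the operator norm is not an eigenvalue.\<close>

lemma det_char_matrix_neq_0: "det (char_matrix (M :: complex^'n^'n)) \<noteq> 0"
proof
  assume 0: "det (char_matrix M) = 0"
  have "linear ((*v) M)"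
    by (rule linearI) (simp_all add: matrix_vector_right_distrib matrix_vector_mult_vector_scalar
        flip: complex_vector_scaleR)
  then obtain K where K: "\<And>x. norm (M *v x) \<le> K * norm x"
    using linear_bounded by blast
  obtain x where x: "x \<noteq> 0" "M *v x = complex_of_real (\<bar>K\<bar> + 1) *s x"
    using det_char_matrix_eq_0_iff[of M "complex_of_real (\<bar>K\<bar> + 1)"] 0 by auto
  then have "(\<bar>K\<bar> + 1) * norm x \<le> K * norm x"
    using K[of x] by (simp add: norm_vector_scalar_mult flip: of_real_add)
  then show False using x(1) by (simp add: distrib_right) (smt (verit) mult_right_mono norm_ge_zero zero_less_norm_iff)
qed

text \<open>Starting from any nonzero vector of \<open>V\<close>, apply the factors \<open>M - \<mu>\<close> of an annihilating polynomial one
after the other; the last nonzero vector obtained is an eigenvector.\<close>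

lemma invariant_eigenvector:
  fixes M :: "complex^'n^'n"
  assumes add: "\<And>x y. x \<in> V \<Longrightarrow> y \<in> V \<Longrightarrow> x + y \<in> V"
    and scale: "\<And>c x. x \<in> V \<Longrightarrow> c *s x \<in> V"
    and inv: "\<And>x. x \<in> V \<Longrightarrow> M *v x \<in> V"
    and x: "x \<in> V" "x \<noteq> 0"
  obtains \<mu> y where "y \<in> V" "y \<noteq> 0" "M *v y = \<mu> *s y"
proof -
  have peel: "\<exists>\<mu> y. y \<in> V \<and> y \<noteq> 0 \<and> M *v y = \<mu> *s y"
    if "p \<noteq> 0" "x \<in> V" "x \<noteq> 0" "\<And>k t. shift_act p (\<lambda>t. (matpow M t *v x) $ k) t = 0" for p x
    using that
  proof (induction "degree p" arbitrary: p x)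
    case 0
    then obtain a where a: "p = [:a:]" "a \<noteq> 0"
      by (metis degree_eq_zeroE pCons_eq_0_iff)
    have "x $ k = 0" for k
      using "0.prems"(4)[of k 0] a by (simp add: shift_act_pCons)
    then show ?case using "0.prems"(3) by (simp add: vec_eq_iff)
  next
    case (Suc n)
    then obtain \<mu> q where q: "p = q * [:- \<mu>, 1:]" "q \<noteq> 0" "degree q = n"
      using poly_root_factor[of p n] by metis
    define y where "y = M *v x + (- \<mu>) *s x"
    have y: "y \<in> V" unfolding y_def using add scale inv Suc.prems(2) by blast
    show ?case
    proof (cases "y = 0")
      case True
      then have "M *v x = \<mu> *s x" by (simp add: y_def vec_eq_iff)
      then show ?thesis using Suc.prems by blast
    next
      case False
      have comm: "matpow M t *v (M *v x) = M *v (matpow M t *v x)" for t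
        by (induction t) (simp_all add: matpow_Suc_vec del: matpow.simps(2))
      have "(matpow M t *v y) $ k = shift_act [:- \<mu>, 1:] (\<lambda>t. (matpow M t *v x) $ k) t" for t k
        unfolding y_def matrix_vector_right_distrib matrix_vector_mult_vector_scalar comm
          matpow_Suc_vec[symmetric]
        by (simp add: shift_act_pCons del: matpow.simps(2))
      then have "shift_act q (\<lambda>t. (matpow M t *v y) $ k) t = 0" for k t
        using Suc.prems(4)[of k t] unfolding q(1) shift_act_mult by simp
      with Suc.hyps(1)[OF q(3)[symmetric] q(2) y False] show ?thesis by blast
    qed
  qed
  show thesis
    using peel[OF det_char_matrix_neq_0 x char_matrix_annihilates] that by blast
qed

lemma matpow_commute: "matpow M k ** M = M ** matpow M k"
  by (induction k) (simp_all add: matrix_mul_assoc flip: matrix_mul_assoc)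

lemma poly_matrix_altdef:
  assumes "degree p \<le> n"
  shows "poly_matrix p M = (\<Sum>k\<le>n. coeff p k *\<^sub>R matpow M k)"
  unfolding poly_matrix_def
  using assms by (intro sum.mono_neutral_left) (auto simp: coeff_eq_0)

lemma matrix_add_rdistrib: "(A + B) ** M = A ** M + B ** (M :: 'a::semiring_1^'k^'n)"
  by (vector matrix_matrix_mult_def sum.distrib[symmetric] distrib_right)

lemma matrix_scaleR_right: "A ** (c *\<^sub>R B) = c *\<^sub>R (A ** (B :: real^'k^'n))"
  by (simp add: matrix_scalar_ac scalar_matrix_assoc)

lemma matrix_scaleR_left: "(c *\<^sub>R A) ** B = c *\<^sub>R (A ** (B :: real^'k^'n))"
  by (simp add: scalar_matrix_assoc)

lemma matrix_mult_sum_right: "M ** (\<Sum>i\<in>I. f i) = (\<Sum>i\<in>I. M ** (f i :: real^'k^'n))"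
  by (induction I rule: infinite_finite_induct) (simp_all add: matrix_add_ldistrib)

lemma matrix_mult_sum_left: "(\<Sum>i\<in>I. f i) ** M = (\<Sum>i\<in>I. (f i :: real^'n^'k) ** M)"
  by (induction I rule: infinite_finite_induct) (simp_all add: matrix_add_rdistrib)

lemma poly_matrix_0 [simp]: "poly_matrix 0 M = 0"
  by (simp add: poly_matrix_def)

lemma poly_matrix_pCons: "poly_matrix (pCons c p) M = c *\<^sub>R mat 1 + M ** poly_matrix p M"
proof -
  have "poly_matrix (pCons c p) M = (\<Sum>k\<le>Suc (degree p). coeff (pCons c p) k *\<^sub>R matpow M k)"
    by (rule poly_matrix_altdef) (rule degree_pCons_le)
  also have "\<dots> = c *\<^sub>R mat 1 + (\<Sum>k\<le>degree p. coeff p k *\<^sub>R (M ** matpow M k))"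
    by (subst sum.atMost_Suc_shift) simp
  finally show ?thesis by (simp add: poly_matrix_def matrix_mult_sum_right matrix_scaleR_right)
qed

lemma poly_matrix_add: "poly_matrix (p + q) M = poly_matrix p M + poly_matrix q M"
proof -
  let ?n = "max (degree p) (degree q)"
  have "poly_matrix (p + q) M = (\<Sum>k\<le>?n. coeff (p + q) k *\<^sub>R matpow M k)"
    by (rule poly_matrix_altdef) (rule degree_add_le_max)
  then show ?thesis
    by (simp add: poly_matrix_altdef[of p ?n] poly_matrix_altdef[of q ?n] scaleR_add_left sum.distrib)
qed

lemma poly_matrix_smult: "poly_matrix (smult c p) M = c *\<^sub>R poly_matrix p M"
proof -
  have "poly_matrix (smult c p) M = (\<Sum>k\<le>degree p. coeff (smult c p) k *\<^sub>R matpow M k)"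
    by (rule poly_matrix_altdef) (rule degree_smult_le)
  then show ?thesis by (simp add: poly_matrix_def scaleR_sum_right)
qed

lemma poly_matrix_mult: "poly_matrix (p * q) M = poly_matrix p M ** poly_matrix q M"
proof (induction p)
  case (pCons c p)
  then show ?case
    by (simp add: poly_matrix_pCons poly_matrix_add poly_matrix_smult matrix_add_rdistrib
        matrix_mul_assoc matrix_scaleR_left)
qed simp

lemma poly_matrix_1: "poly_matrix 1 M = mat 1"
  using poly_matrix_pCons[of 1 0 M] by (simp add: one_pCons)

lemma poly_matrix_commute: "poly_matrix p M ** M = M ** poly_matrix p M"
  by (simp add: poly_matrix_def matrix_mult_sum_left matrix_mult_sum_right matpow_commute
      matrix_scaleR_left matrix_scaleR_right)

lemma sum_matrix_vector: "(\<Sum>i\<in>I. f i) *v x = (\<Sum>i\<in>I. (f i :: 'a::semiring_1^'n^'k) *v x)"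
  by (induction I rule: infinite_finite_induct) (simp_all add: matrix_vector_mult_add_rdistrib)

lemma poly_matrix_vec_nth:
  "(poly_matrix p M *v x) $ k = shift_act p (\<lambda>t. (matpow M t *v x) $ k) 0"
  by (simp add: poly_matrix_def shift_act_def sum_matrix_vector flip: scaleR_matrix_vector_assoc)

lemma char_poly_eq_det_char_matrix: "char_poly M = det (char_matrix M)"
  by (simp add: char_poly_def char_matrix_def)

lemma cayley_hamilton: "poly_matrix (char_poly M) M = 0"
proof -
  have "poly_matrix (char_poly M) M *v x = 0" for x
    by (simp add: vec_eq_iff poly_matrix_vec_nth char_poly_eq_det_char_matrix char_matrix_annihilates)
  then show ?thesis using matrix_eq[of "poly_matrix (char_poly M) M" 0] by simp
qed

section \<open>Complexification of real matrices\<close>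

abbreviation cpoly :: "real poly \<Rightarrow> complex poly" where
  "cpoly \<equiv> map_poly complex_of_real"

lemma cpoly_add: "cpoly (p + q) = cpoly p + cpoly q"
  by (simp add: poly_eq_iff coeff_map_poly)

lemma cpoly_mult: "cpoly (p * q) = cpoly p * cpoly q"
  by (simp add: poly_eq_iff coeff_map_poly coeff_mult)

lemma cpoly_of_int: "cpoly (of_int k) = of_int k"
  by (simp add: poly_eq_iff coeff_map_poly of_int_poly coeff_pCons split: nat.split)

lemma cpoly_sum: "cpoly (sum f I) = (\<Sum>i\<in>I. cpoly (f i))"
  by (induction I rule: infinite_finite_induct) (simp_all add: cpoly_add)

lemma cpoly_prod: "cpoly (prod f I) = (\<Prod>i\<in>I. cpoly (f i))"
  by (induction I rule: infinite_finite_induct) (simp_all add: cpoly_mult)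

lemma cpoly_eq_0_iff: "cpoly p = 0 \<longleftrightarrow> p = 0"
  by (simp add: map_poly_eq_0_iff)

lemma cpoly_char_poly: "cpoly (char_poly M) = det (char_matrix (cmatrix M))"
proof -
  have "cpoly (char_matrix M $ i $ j) = char_matrix (cmatrix M) $ i $ j" for i j
    by (simp add: char_matrix_def mat_def poly_eq_iff coeff_map_poly coeff_pCons split: nat.split)
  then show ?thesis
    by (simp add: char_poly_eq_det_char_matrix det_def cpoly_sum cpoly_mult cpoly_prod cpoly_of_int)
qed

lemma char_poly_root_iff: "poly (cpoly (char_poly M)) \<mu> = 0 \<longleftrightarrow> \<mu> \<in> spectrum M"
  by (simp add: cpoly_char_poly det_char_matrix_eq_0_iff spectrum_def)

lemma char_poly_neq_0: "char_poly M \<noteq> 0"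
  using det_char_matrix_neq_0[of "cmatrix M"] by (auto simp flip: cpoly_char_poly)

lemma spectrum_nonempty: "spectrum M \<noteq> {}"
proof -
  have "(axis undefined 1 :: complex^'a) \<noteq> 0" by (simp add: axis_eq_0_iff)
  then obtain \<mu> y where "y \<noteq> 0" "cmatrix M *v y = \<mu> *s y"
    using invariant_eigenvector[of UNIV "cmatrix M" "axis undefined 1"] by (metis UNIV_I)
  then show ?thesis by (auto simp: spectrum_def)
qed

lemma cmatrix_transpose: "cmatrix (transpose M) = transpose (cmatrix M)"
  by (simp add: vec_eq_iff transpose_def)

lemma cmatrix_mult: "cmatrix (M ** N) = cmatrix M ** cmatrix N"
  by (simp add: vec_eq_iff matrix_matrix_mult_def)

lemma cmatrix_add: "cmatrix (M + N) = cmatrix M + cmatrix N"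
  by (simp add: vec_eq_iff)

lemma cmatrix_diff: "cmatrix (M - N) = cmatrix M - cmatrix N"
  by (simp add: vec_eq_iff)

lemma cmatrix_mat: "cmatrix (mat c) = mat (complex_of_real c)"
  by (simp add: vec_eq_iff mat_def)

lemma cmatrix_0 [simp]: "cmatrix 0 = 0"
  by (simp add: vec_eq_iff)

lemma spectrum_transpose: "spectrum (transpose M) = spectrum M"
proof -
  have "char_matrix (transpose M) = transpose (char_matrix M)"
    by (auto simp: char_matrix_def vec_eq_iff transpose_def mat_def)
  then have "char_poly (transpose M) = char_poly M"
    by (simp add: char_poly_eq_det_char_matrix)
  then have "\<mu> \<in> spectrum (transpose M) \<longleftrightarrow> \<mu> \<in> spectrum M" for \<mu>
    by (simp flip: char_poly_root_iff)
  then show ?thesis by blast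
qed

lemma left_spectrum:
  assumes "x \<noteq> 0" "x v* cmatrix M = \<mu> *s x"
  shows "\<mu> \<in> spectrum M"
proof -
  have "cmatrix (transpose M) *v x = \<mu> *s x"
    using assms(2) by (simp add: cmatrix_transpose)
  then have "\<mu> \<in> spectrum (transpose M)"
    using assms(1) by (auto simp: spectrum_def)
  then show ?thesis by (simp add: spectrum_transpose)
qed

lemma cmatrix_poly_matrix_eigenvector:
  fixes M :: "real^'n^'n"
  assumes "cmatrix M *v x = \<mu> *s x"
  shows "cmatrix (poly_matrix f M) *v x = poly (cpoly f) \<mu> *s x"
proof (induction f)
  case 0
  then show ?case by simp
next
  case (pCons c f)
  have "cmatrix (poly_matrix (pCons c f) M) *v x =
      of_real c *s x + cmatrix M *v (cmatrix (poly_matrix f M) *v x)"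
  proof -
    have "cmatrix (c *\<^sub>R mat 1 :: real^'n^'n) = mat (of_real c)" by (simp add: vec_eq_iff mat_def)
    then show ?thesis
      by (simp add: poly_matrix_pCons cmatrix_add cmatrix_mult matrix_vector_mult_add_rdistrib
          mat_vector_mult matrix_vector_mul_assoc)
  qed
  also have "\<dots> = of_real c *s x + poly (cpoly f) \<mu> *s (\<mu> *s x)"
    by (simp add: pCons.IH matrix_vector_mult_vector_scalar assms)
  finally show ?case
    using pCons.hyps by (simp add: map_poly_pCons vec_eq_iff algebra_simps)
qed

text \<open>A complex vector is split into two real ones, because a real matrix acts on both parts separately and
the real inner product of complex vectors is the sum of those of the parts.\<close>

definition vRe :: "complex^'n \<Rightarrow> real^'n" where "vRe x = (\<chi> i. Re (x $ i))"
definition vIm :: "complex^'n \<Rightarrow> real^'n" where "vIm x = (\<chi> i. Im (x $ i))"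

lemma vRe_nth [simp]: "vRe x $ i = Re (x $ i)" by (simp add: vRe_def)
lemma vIm_nth [simp]: "vIm x $ i = Im (x $ i)" by (simp add: vIm_def)

lemma complex_vec_eq_iff: "x = y \<longleftrightarrow> vRe x = vRe y \<and> vIm x = vIm y"
  by (auto simp: vec_eq_iff complex_eq_iff)

lemma vRe_vIm_zero [simp]: "vRe 0 = 0" "vIm 0 = 0"
  by (simp_all add: vec_eq_iff)

lemma vRe_vIm_add: "vRe (x + y) = vRe x + vRe y" "vIm (x + y) = vIm x + vIm y"
  by (simp_all add: vec_eq_iff)

lemma vRe_vIm_diff: "vRe (x - y) = vRe x - vRe y" "vIm (x - y) = vIm x - vIm y"
  by (simp_all add: vec_eq_iff)

lemma vRe_vIm_sum: "vRe (sum f I) = (\<Sum>i\<in>I. vRe (f i))" "vIm (sum f I) = (\<Sum>i\<in>I. vIm (f i))"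
  by (simp_all add: vec_eq_iff)

lemma vRe_vIm_scaleR: "vRe (c *\<^sub>R x) = c *\<^sub>R vRe x" "vIm (c *\<^sub>R x) = c *\<^sub>R vIm x"
  by (simp_all add: vec_eq_iff)

lemma vRe_vIm_smult: "vRe (z *s x) = Re z *\<^sub>R vRe x - Im z *\<^sub>R vIm x"
  "vIm (z *s x) = Re z *\<^sub>R vIm x + Im z *\<^sub>R vRe x"
  by (simp_all add: vec_eq_iff)

lemma vRe_vIm_cmatrix: "vRe (cmatrix M *v x) = M *v vRe x" "vIm (cmatrix M *v x) = M *v vIm x"
  by (simp_all add: vec_eq_iff matrix_vector_mult_def)

lemma vRe_vIm_cmatrix_left: "vRe (x v* cmatrix M) = vRe x v* M" "vIm (x v* cmatrix M) = vIm x v* M"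
  by (simp_all add: vec_eq_iff vector_matrix_mult_def)

lemma complex_vec_inner: "x \<bullet> y = vRe x \<bullet> vRe y + vIm x \<bullet> vIm (y :: complex^'n)"
  by (simp add: inner_vec_def inner_complex_def sum.distrib)

lemma cmatrix_adjoint: "(x v* cmatrix M) \<bullet> y = x \<bullet> (cmatrix M *v y)"
  by (simp add: complex_vec_inner vRe_vIm_cmatrix vRe_vIm_cmatrix_left dot_lmul_matrix)

lemma vector_scalar_matrix: "(c *s x) v* M = c *s (x v* (M :: 'a::comm_semiring_1^'n^'m))"
  by (simp add: vec_eq_iff vector_matrix_mult_def sum_distrib_left mult_ac)

section \<open>Real polynomials and the unit circle\<close>

text \<open>The generator of the ideal \<open>(p, q)\<close> is an element of least degree.\<close>

lemma real_poly_bezout: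
  fixes p q :: "real poly"
  assumes "p \<noteq> 0"
  obtains d a b where "d = a * p + b * q" "d dvd p" "d dvd q"
proof -
  define I where "I d \<longleftrightarrow> (\<exists>a b. d = a * p + b * q)" for d
  have Ip: "I p" unfolding I_def by (intro exI[of _ 1] exI[of _ 0]) simp
  have Iq: "I q" unfolding I_def by (intro exI[of _ 0] exI[of _ 1]) simp
  obtain d where d: "I d" "d \<noteq> 0" and min: "\<And>e. I e \<and> e \<noteq> 0 \<Longrightarrow> degree d \<le> degree e"
    using arg_min_nat_lemma[of "\<lambda>d. I d \<and> d \<noteq> 0" p degree] Ip assms by blast
  have "d dvd e" if Ie: "I e" for e
  proof -
    have "I (e mod d)"
    proof -
      obtain a b where "d = a * p + b * q" using d(1) unfolding I_def by blast
      moreover obtain a' b' where "e = a' * p + b' * q" using Ie unfolding I_def by blast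
      ultimately have "e mod d = (a' - e div d * a) * p + (b' - e div d * b) * q"
        by (simp add: minus_div_mult_eq_mod[symmetric] algebra_simps)
      then show ?thesis unfolding I_def by blast
    qed
    then have "e mod d = 0"
      using min[of "e mod d"] degree_mod_less[OF d(2), of e] by fastforce
    then show ?thesis by (simp add: mod_eq_0_iff_dvd)
  qed
  with Ip Iq d(1) that show thesis unfolding I_def by blast
qed

lemma cpoly_dvd_root: "p dvd q \<Longrightarrow> poly (cpoly p) z = 0 \<Longrightarrow> poly (cpoly q) z = 0"
  by (auto simp: dvd_def cpoly_mult)

lemma real_poly_root_or_const:
  assumes "d \<noteq> 0" and "\<And>z. poly (cpoly d) z \<noteq> 0"
  obtains c where "d = [:c:]" "c \<noteq> 0"
proof -
  have "constant (poly (cpoly d))"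
    using assms(2) fundamental_theorem_of_algebra by blast
  then have "degree (cpoly d) = 0" by (simp add: constant_degree)
  then have "degree d = 0" by (simp add: degree_map_poly)
  then show thesis using that assms(1) by (metis degree_eq_zeroE pCons_eq_0_iff)
qed

text \<open>The factor carried by the unit circle is collected by removing, for each root \<open>\<mu>\<close> of modulus one, the
greatest common divisor with the real quadratic that has the roots \<open>\<mu>\<close> and \<open>cnj \<mu>\<close>.  The two factors end
up without common roots, which gives the Bezout identity.\<close>

lemma unit_circle_split:
  fixes f :: "real poly"
  assumes "f \<noteq> 0"
  obtains g h a b where "f = g * h" "a * g + b * h = 1"
    "\<And>z. poly (cpoly g) z = 0 \<Longrightarrow> cmod z = 1" "\<And>z. poly (cpoly h) z = 0 \<Longrightarrow> cmod z \<noteq> 1"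
proof -
  have "\<exists>g h. f = g * h \<and> (\<forall>z. poly (cpoly g) z = 0 \<longrightarrow> cmod z = 1) \<and>
      (\<forall>z. poly (cpoly h) z = 0 \<longrightarrow> cmod z \<noteq> 1)"
    using assms
  proof (induction "degree f" arbitrary: f rule: less_induct)
    case less
    show ?case
    proof (cases "\<forall>z. poly (cpoly f) z = 0 \<longrightarrow> cmod z \<noteq> 1")
      case True
      then show ?thesis by (intro exI[of _ 1] exI[of _ f]) simp
    next
      case False
      then obtain \<mu> where \<mu>: "poly (cpoly f) \<mu> = 0" "cmod \<mu> = 1" by blast
      \<comment> \<open>The common factor of f and the real quadratic with roots \<mu> and its conjugate.\<close>
      let ?q = "[:1, - 2 * Re \<mu>, 1:] :: real poly"
      have q: "poly (cpoly ?q) z = (z - \<mu>) * (z - cnj \<mu>)" for z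
      proof -
        have "\<mu> * cnj \<mu> = 1" using \<mu>(2) by (simp add: complex_norm_square[symmetric])
        moreover have "\<mu> + cnj \<mu> = of_real (2 * Re \<mu>)" by (simp add: complex_add_cnj)
        moreover have "(z - \<mu>) * (z - cnj \<mu>) = z * z - (\<mu> + cnj \<mu>) * z + \<mu> * cnj \<mu>"
          by (simp add: algebra_simps)
        ultimately have "(z - \<mu>) * (z - cnj \<mu>) = z * z - of_real (2 * Re \<mu>) * z + 1"
          by (simp only:)
        then show ?thesis by (simp add: map_poly_pCons algebra_simps)
      qed
      obtain d a b where d: "d = a * f + b * ?q" "d dvd f" "d dvd ?q"
        using real_poly_bezout[OF less.prems, of ?q] by blast
      have "poly (cpoly d) \<mu> = 0"
        using \<mu>(1) q[of \<mu>] unfolding d(1) cpoly_add cpoly_mult by simp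
      moreover have "d \<noteq> 0" using d(2) less.prems by auto
      ultimately have "degree d \<noteq> 0"
      proof (intro notI)
        assume root: "poly (cpoly d) \<mu> = 0" and "d \<noteq> 0" and "degree d = 0"
        then obtain c where "d = [:c:]" by (metis degree_eq_zeroE)
        with root \<open>d \<noteq> 0\<close> show False by (simp add: map_poly_pCons)
      qed
      obtain e where e: "f = d * e" using d(2) by (auto simp: dvd_def)
      have "e \<noteq> 0" using e less.prems by auto
      then have "degree e < degree f"
        using \<open>d \<noteq> 0\<close> \<open>degree d \<noteq> 0\<close> by (simp add: e degree_mult_eq)
      from less.hyps[OF this \<open>e \<noteq> 0\<close>] obtain g h where gh: "e = g * h"
        "\<forall>z. poly (cpoly g) z = 0 \<longrightarrow> cmod z = 1" "\<forall>z. poly (cpoly h) z = 0 \<longrightarrow> cmod z \<noteq> 1"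
        by blast
      have "cmod z = 1" if "poly (cpoly d) z = 0" for z
      proof -
        have "z = \<mu> \<or> z = cnj \<mu>"
          using cpoly_dvd_root[OF d(3) that] unfolding q by simp
        then show ?thesis using \<mu>(2) by auto
      qed
      then show ?thesis
        using gh e by (intro exI[of _ "d * g"] exI[of _ h]) (auto simp: cpoly_mult mult.assoc)
    qed
  qed
  then obtain g h where gh: "f = g * h" "\<And>z. poly (cpoly g) z = 0 \<Longrightarrow> cmod z = 1"
    "\<And>z. poly (cpoly h) z = 0 \<Longrightarrow> cmod z \<noteq> 1" by blast
  have "g \<noteq> 0" using gh(1) assms by auto
  then obtain d a b where d: "d = a * g + b * h" "d dvd g" "d dvd h"
    using real_poly_bezout by blast
  have "d \<noteq> 0" using d(2) \<open>g \<noteq> 0\<close> by auto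
  moreover have "poly (cpoly d) z \<noteq> 0" for z
    using cpoly_dvd_root[OF d(2)] cpoly_dvd_root[OF d(3)] gh by blast
  ultimately obtain c where c: "d = [:c:]" "c \<noteq> 0"
    using real_poly_root_or_const by blast
  have "smult (1 / c) a * g + smult (1 / c) b * h = smult (1 / c) d"
    by (simp add: d(1) smult_add_right)
  also have "\<dots> = 1" using c by (simp add: one_pCons)
  finally show thesis using that gh by blast
qed

text \<open>If \<open>\<mu>\<close> were not an eigenvalue, \<open>M - \<mu>\<close> could be cancelled from \<open>f(M) = 0\<close>, and the real part of the
cofactor would be a real annihilating polynomial of smaller degree.\<close>

lemma min_poly_root_in_spectrum:
  assumes f: "is_min_poly M f" and \<mu>: "poly (cpoly f) \<mu> = 0"
  shows "\<mu> \<in> spectrum M"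
proof (rule ccontr)
  assume no: "\<mu> \<notin> spectrum M"
  have lf: "lead_coeff f = 1" and fM: "poly_matrix f M = 0"
    and min: "\<And>g. g \<noteq> 0 \<Longrightarrow> poly_matrix g M = 0 \<Longrightarrow> degree f \<le> degree g"
    using f by (auto simp: is_min_poly_def)
  have f0: "f \<noteq> 0" using lf by auto
  obtain g where g: "cpoly f = [:- \<mu>, 1:] * g"
    using \<mu> unfolding poly_eq_0_iff_dvd dvd_def by blast
  have "g \<noteq> 0" using g f0 cpoly_eq_0_iff by (metis mult_zero_right)
  then have "degree (cpoly f) = Suc (degree g)"
    by (subst g, subst degree_mult_eq) auto
  then have deg: "degree f = Suc (degree g)" by (simp add: degree_map_poly)
  have "lead_coeff (cpoly f) = lead_coeff ([:- \<mu>, 1:] * g)" by (simp only: g)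
  also have "\<dots> = lead_coeff g" by (simp only: lead_coeff_mult) simp
  finally have "lead_coeff (cpoly f) = lead_coeff g" .
  then have lg: "lead_coeff g = 1"
    using lf by (simp add: degree_map_poly coeff_map_poly)
  \<comment> \<open>The matrix g(M) vanishes because M - \<mu> is injective; its real part is a real polynomial in M.\<close>
  define h where "h = map_poly Re g"
  have "degree h \<le> degree g"
    by (rule degree_le) (auto simp: h_def coeff_map_poly coeff_eq_0)
  moreover have "h \<noteq> 0"
  proof
    assume "h = 0"
    then have "coeff h (degree g) = 0" by simp
    then show False using lg by (simp add: h_def coeff_map_poly)
  qed
  moreover have "poly_matrix h M = 0"
  proof -
    have "poly_matrix h M *v x = 0" for x
    proof -
      let ?x = "\<chi> i. complex_of_real (x $ i)"
      have cx: "(matpow (cmatrix M) t *v ?x) $ k = of_real ((matpow M t *v x) $ k)" for t k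
      proof -
        have "matpow (cmatrix M) t = cmatrix (matpow M t)"
          by (induction t) (simp_all add: cmatrix_mat cmatrix_mult)
        then show ?thesis by (simp add: matrix_vector_mult_def)
      qed
      define y where "y t = (\<chi> k. shift_act g (\<lambda>t. (matpow (cmatrix M) t *v ?x) $ k) t)" for t
      have step: "cmatrix M *v y 0 = y 1"
      proof -
        have "(cmatrix M *v y 0) $ i = y 1 $ i" for i
        proof -
          have "(cmatrix M *v y 0) $ i =
              shift_act g (\<lambda>t. \<Sum>j\<in>UNIV. cmatrix M $ i $ j * (matpow (cmatrix M) t *v ?x) $ j) 0"
            unfolding shift_act_seq_sum shift_act_seq_scale y_def
            by (simp add: matrix_vector_mult_def[of "cmatrix M"])
          also have "\<dots> = shift_act g (\<lambda>t. (matpow (cmatrix M) (t + 1) *v ?x) $ i) 0"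
            unfolding Suc_eq_plus1[symmetric] matpow_Suc_vec
            by (subst matrix_vector_mult_def) simp
          also have "\<dots> = y 1 $ i"
            unfolding y_def shift_act_shift[where y = "\<lambda>t. (matpow (cmatrix M) t *v ?x) $ i"]
            by simp
          finally show ?thesis .
        qed
        then show ?thesis by (simp add: vec_eq_iff)
      qed
      have "y 1 $ k - \<mu> * y 0 $ k = 0" for k
      proof -
        have "y 1 $ k - \<mu> * y 0 $ k =
            shift_act ([:- \<mu>, 1:] * g) (\<lambda>t. (matpow (cmatrix M) t *v ?x) $ k) 0"
          unfolding shift_act_mult by (simp add: y_def shift_act_pCons)
        also have "\<dots> = of_real ((poly_matrix f M *v x) $ k)"
          unfolding g[symmetric] cx poly_matrix_vec_nth shift_act_def
          by (simp add: degree_map_poly coeff_map_poly)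
        finally show ?thesis by (simp add: fM)
      qed
      then have "cmatrix M *v y 0 = \<mu> *s y 0"
        unfolding step by (simp add: vec_eq_iff)
      then have y0: "y 0 = 0" using no by (auto simp: spectrum_def)
      have "(poly_matrix h M *v x) $ k = Re (y 0 $ k)" for k
        unfolding y_def cx poly_matrix_vec_nth shift_act_altdef[OF \<open>degree h \<le> degree g\<close>]
        by (simp add: shift_act_def h_def coeff_map_poly)
      then show ?thesis by (simp add: y0 vec_eq_iff)
    qed
    then show ?thesis using matrix_eq[of "poly_matrix h M" 0] by simp
  qed
  ultimately show False using min[of h] deg by linarith
qed

section \<open>Linear systems with one delay\<close>

text \<open>The standard basis as an index type makes determinants available for operators on an arbitrary Euclidean
space, such as the state space of the network.\<close>

typedef (overloaded) ('e::euclidean_space) basis_index = "Basis :: 'e set"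
  by (rule nonempty_Basis[unfolded ex_in_conv[symmetric]])

instance basis_index :: (euclidean_space) finite
proof
  have "(UNIV :: 'a basis_index set) = Abs_basis_index ` Basis"
    using Abs_basis_index_cases by blast
  then show "finite (UNIV :: 'a basis_index set)" by (metis finite_Basis finite_imageI)
qed

lemma sum_basis_index: "(\<Sum>i\<in>UNIV. f (Rep_basis_index i)) = (\<Sum>b\<in>Basis. f b)"
proof -
  have "bij_betw Rep_basis_index UNIV Basis"
    unfolding bij_betw_def
    by (metis Rep_basis_index_inject inj_onI type_definition.Rep_range type_definition_basis_index)
  then show ?thesis by (rule sum.reindex_bij_betw)
qed

text \<open>A pair \<open>(a, b)\<close> stands for \<open>a + i b\<close> in the complexification; this is multiplication by \<open>z\<close>.\<close>

definition cscale :: "complex \<Rightarrow> 'e::real_vector \<times> 'e \<Rightarrow> 'e \<times> 'e" where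
  "cscale z p = (Re z *\<^sub>R fst p - Im z *\<^sub>R snd p, Im z *\<^sub>R fst p + Re z *\<^sub>R snd p)"

text \<open>The condition says that \<open>z\<^sup>t p\<close> solves \<open>X(t + r + 1) = F X(t + r) + G X(t)\<close>; it is stated without
division by \<open>z\<^sup>r\<close>.\<close>

definition no_unstable_mode :: "nat \<Rightarrow> ('e::real_vector \<Rightarrow> 'e) \<Rightarrow> ('e \<Rightarrow> 'e) \<Rightarrow> bool" where
  "no_unstable_mode r F G \<longleftrightarrow> (\<forall>z p. 1 \<le> cmod z \<longrightarrow>
     cscale (z ^ Suc r) p = cscale (z ^ r) (map_prod F F p) + map_prod G G p \<longrightarrow> p = 0)"

lemma cscale_mult: "cscale (z * w) p = cscale z (cscale w p)"
  by (simp add: cscale_def algebra_simps)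

lemma cscale_add: "cscale z (p + q) = cscale z p + cscale z q"
  by (simp add: cscale_def algebra_simps)

lemma cscale_scaleR: "cscale z (c *\<^sub>R p) = c *\<^sub>R cscale z p"
  by (simp add: cscale_def algebra_simps)

lemma cscale_1 [simp]: "cscale 1 p = p"
  by (simp add: cscale_def)

lemma cscale_0 [simp]: "cscale z 0 = 0" "cscale 0 p = 0"
  by (simp_all add: cscale_def zero_prod_def)

lemma continuous_on_cscale:
  fixes g :: "'a::topological_space \<Rightarrow> 'e::real_normed_vector \<times> 'e"
  assumes "continuous_on S f" "continuous_on S g"
  shows "continuous_on S (\<lambda>x. cscale (f x) (g x))"
  unfolding cscale_def by (auto intro!: continuous_intros assms)

text \<open>The polynomial matrix \<open>z\<^sup>r\<^sup>+\<^sup>1 - z\<^sup>r F - G\<close> annihilates every trajectory, so its determinant annihilates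
every coordinate, and a root of the determinant is a mode.\<close>

lemma delay_decay:
  fixes F G :: "'e::euclidean_space \<Rightarrow> 'e"
  assumes F: "linear F" and G: "linear G" and stable: "no_unstable_mode r F G"
  shows "\<exists>c>0. \<exists>\<gamma>. 0 < \<gamma> \<and> \<gamma> < 1 \<and> (\<forall>X. (\<forall>t. X (t + Suc r) = F (X (t + r)) + G (X t)) \<longrightarrow>
      (\<forall>t. norm (X t) \<le> c * \<gamma> ^ t * (\<Sum>k\<le>r. norm (X k))))"
proof -
  let ?e = "Rep_basis_index :: 'e basis_index \<Rightarrow> 'e"
  have e: "?e i \<in> Basis" for i by (rule Rep_basis_index)
  have ee: "?e i \<bullet> ?e j = (if i = j then 1 else 0)" for i j
    using inner_Basis[OF e e] by (simp add: Rep_basis_index_inject)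
  have expand: "x = (\<Sum>j\<in>UNIV. (x \<bullet> ?e j) *\<^sub>R ?e j)" for x
    using euclidean_representation[of x] sum_basis_index[of "\<lambda>b. (x \<bullet> b) *\<^sub>R b"] by simp
  have lin_expand: "L x \<bullet> ?e i = (\<Sum>j\<in>UNIV. L (?e j) \<bullet> ?e i * (x \<bullet> ?e j))" if "linear L" for L x i
  proof -
    have "L x = (\<Sum>j\<in>UNIV. (x \<bullet> ?e j) *\<^sub>R L (?e j))"
      by (subst expand) (simp add: linear_sum[OF that] linear_cmul[OF that])
    then show ?thesis by (simp add: inner_sum_left mult.commute)
  qed
  define Q :: "complex poly^'e basis_index^'e basis_index" where
    "Q = (\<chi> i j. monom (if i = j then 1 else 0) (Suc r) - monom (of_real (F (?e j) \<bullet> ?e i)) r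
        - [:of_real (G (?e j) \<bullet> ?e i):])"
  have root: "cmod z < 1" if "poly (det Q) z = 0" for z
  proof (rule ccontr)
    assume "\<not> cmod z < 1"
    then have z: "1 \<le> cmod z" by simp
    obtain y where y: "y \<noteq> 0" "map_matrix (\<lambda>p. poly p z) Q *v y = 0"
      using \<open>poly (det Q) z = 0\<close> unfolding poly_det det_eq_0_kernel by blast
    define comp where "comp p i = Complex (fst p \<bullet> ?e i) (snd p \<bullet> ?e i)" for p :: "'e \<times> 'e" and i
    define p where "p = (\<Sum>j\<in>UNIV. Re (y $ j) *\<^sub>R ?e j, \<Sum>j\<in>UNIV. Im (y $ j) *\<^sub>R ?e j)"
    have comp_p: "comp p i = y $ i" for i
      by (simp add: comp_def p_def inner_sum_left ee complex_eq_iff if_distrib cong: if_cong)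
    have comp_scale: "comp (cscale w q) i = w * comp q i" for w q i
      by (simp add: comp_def cscale_def complex_eq_iff inner_diff_left inner_add_left)
    have comp_lin: "comp (map_prod L L q) i = (\<Sum>j\<in>UNIV. of_real (L (?e j) \<bullet> ?e i) * comp q j)"
      if "linear L" for L q i
      by (simp add: comp_def complex_eq_iff lin_expand[OF that, of "fst q"] lin_expand[OF that, of "snd q"])
    have comp_add: "comp (q + q') i = comp q i + comp q' i" for q q' i
      by (simp add: comp_def complex_eq_iff inner_add_left)
    have comp_eqI: "q = q'" if "\<And>i. comp q i = comp q' i" for q q'
    proof -
      have "fst q \<bullet> ?e i = fst q' \<bullet> ?e i" "snd q \<bullet> ?e i = snd q' \<bullet> ?e i" for i
        using that[of i] by (simp_all add: comp_def)
      then have "fst q = fst q'" "snd q = snd q'"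
        using expand[of "fst q"] expand[of "fst q'"] expand[of "snd q"] expand[of "snd q'"]
        by simp_all
      then show ?thesis by (simp add: prod_eq_iff)
    qed
    have "cscale (z ^ Suc r) p = cscale (z ^ r) (map_prod F F p) + map_prod G G p"
    proof (rule comp_eqI)
      fix i
      have "0 = (\<Sum>j\<in>UNIV. poly (Q $ i $ j) z * y $ j)"
        using y(2) by (simp add: vec_eq_iff matrix_vector_mult_def)
      also have "\<dots> = (\<Sum>j\<in>UNIV. (if i = j then z ^ Suc r * y $ j else 0)
          - z ^ r * (of_real (F (?e j) \<bullet> ?e i) * y $ j) - of_real (G (?e j) \<bullet> ?e i) * y $ j)"
        by (intro sum.cong refl) (simp add: Q_def poly_monom algebra_simps)
      also have "\<dots> = z ^ Suc r * y $ i - z ^ r * (\<Sum>j\<in>UNIV. of_real (F (?e j) \<bullet> ?e i) * y $ j)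
          - (\<Sum>j\<in>UNIV. of_real (G (?e j) \<bullet> ?e i) * y $ j)"
        by (simp add: sum_subtractf sum_distrib_left)
      finally show "comp (cscale (z ^ Suc r) p) i =
          comp (cscale (z ^ r) (map_prod F F p) + map_prod G G p) i"
        unfolding comp_add comp_scale comp_lin[OF F] comp_lin[OF G] comp_p
        by (simp add: algebra_simps)
    qed
    then have "p = 0" using stable z unfolding no_unstable_mode_def by blast
    then have "comp p i = 0" for i by (simp add: comp_def complex_eq_iff)
    then have "y = 0" unfolding comp_p by (simp add: vec_eq_iff)
    with y(1) show False by simp
  qed
  then have "det Q \<noteq> 0" by (metis norm_one order_less_irrefl poly_0)
  from recurrence_decay[OF this root] obtain c \<gamma> where c: "c > 0" "0 < \<gamma>" "\<gamma> < 1"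
    and decay: "\<And>y t. (\<forall>t. shift_act (det Q) y t = 0) \<Longrightarrow>
      cmod (y t) \<le> c * \<gamma> ^ t * (\<Sum>k\<le>degree (det Q). cmod (y k))"
    by metis
  obtain BF where BF: "\<And>x. norm (F x) \<le> BF * norm x" "BF > 0"
    using linear_bounded_pos[OF F] by blast
  obtain BG where BG: "\<And>x. norm (G x) \<le> BG * norm x" "BG > 0"
    using linear_bounded_pos[OF G] by blast
  let ?d = "degree (det Q)" and ?B = "1 + BF + BG"
  define K where "K = (\<Sum>k\<le>?d. ?B ^ k)"
  have "K > 0" unfolding K_def using BF BG by (intro sum_pos) auto
  define n where "n = real CARD('e basis_index)"
  have "n > 0" by (simp add: n_def)
  have "norm (X t) \<le> n * c * K * \<gamma> ^ t * (\<Sum>k\<le>r. norm (X k))"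
    if X: "\<forall>t. X (t + Suc r) = F (X (t + r)) + G (X t)" for X t
  proof -
    let ?m = "\<Sum>k\<le>r. norm (X k)"
    have m: "?m \<ge> 0" by (simp add: sum_nonneg)
    \<comment> \<open>The order of the scalar recurrences may exceed \<open>r + 1\<close>, so that their initial values go beyond the
      initial data of the system; a crude growth bound covers the difference.\<close>
    have growth: "norm (X k) \<le> ?B ^ k * ?m" for k
    proof (induction k rule: less_induct)
      case (less k)
      show ?case
      proof (cases "k \<le> r")
        case True
        then have "norm (X k) \<le> 1 * ?m" by (simp, intro member_le_sum) auto
        also have "\<dots> \<le> ?B ^ k * ?m"
          using BF BG m by (intro mult_right_mono one_le_power) auto
        finally show ?thesis .
      next
        case False
        then have t: "k = (k - Suc r) + Suc r" by simp
        define t where "t = k - Suc r"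
        have t: "k = t + Suc r" unfolding t_def by (rule t)
        have "norm (X k) \<le> BF * norm (X (t + r)) + BG * norm (X t)"
          unfolding t X[rule_format] by (intro order_trans[OF norm_triangle_ineq] add_mono BF BG)
        also have "\<dots> \<le> BF * (?B ^ (t + r) * ?m) + BG * (?B ^ t * ?m)"
          using BF(2) BG(2) less[of "t + r"] less[of t] by (intro add_mono mult_left_mono) (auto simp: t)
        also have "\<dots> \<le> BF * (?B ^ (t + r) * ?m) + BG * (?B ^ (t + r) * ?m)"
          using BF(2) BG(2) m
          by (intro add_left_mono mult_left_mono mult_right_mono power_increasing) auto
        also have "\<dots> \<le> ?B * (?B ^ (t + r) * ?m)"
          using BF(2) BG(2) m by (simp add: distrib_right)
        finally show ?thesis by (simp add: t mult.assoc)
      qed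
    qed
    have comp: "\<bar>X t \<bullet> ?e j\<bar> \<le> c * \<gamma> ^ t * (K * ?m)" for j
    proof -
      have "\<forall>t. shift_act (det Q) (\<lambda>t. of_real (X t \<bullet> ?e j)) t = 0"
      proof
        fix t
        show "shift_act (det Q) (\<lambda>t. of_real (X t \<bullet> ?e j)) t = 0"
        proof (rule det_annihilates[where X = "\<lambda>j t. of_real (X t \<bullet> ?e j)"])
          fix i t
          have "(\<Sum>j\<in>UNIV. shift_act (Q $ i $ j) (\<lambda>t. of_real (X t \<bullet> ?e j)) t) =
              (\<Sum>j\<in>UNIV. (if i = j then complex_of_real (X (t + Suc r) \<bullet> ?e j) else 0)
                - of_real (F (?e j) \<bullet> ?e i * (X (t + r) \<bullet> ?e j))
                - of_real (G (?e j) \<bullet> ?e i * (X t \<bullet> ?e j)))"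
            by (intro sum.cong refl) (simp add: Q_def shift_act_diff shift_act_monom shift_act_pCons)
          also have "\<dots> = of_real (X (t + Suc r) \<bullet> ?e i
              - (\<Sum>j\<in>UNIV. F (?e j) \<bullet> ?e i * (X (t + r) \<bullet> ?e j))
              - (\<Sum>j\<in>UNIV. G (?e j) \<bullet> ?e i * (X t \<bullet> ?e j)))"
            by (simp add: sum_subtractf)
          also have "\<dots> = of_real (X (t + Suc r) \<bullet> ?e i - F (X (t + r)) \<bullet> ?e i - G (X t) \<bullet> ?e i)"
            by (simp only: lin_expand[OF F, symmetric] lin_expand[OF G, symmetric])
          also have "\<dots> = 0" by (simp only: X[rule_format] inner_add_left) simp
          finally show "(\<Sum>j\<in>UNIV. shift_act (Q $ i $ j) (\<lambda>t. of_real (X t \<bullet> ?e j)) t) = 0" .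
        qed
      qed
      from decay[OF this, of t]
      have "\<bar>X t \<bullet> ?e j\<bar> \<le> c * \<gamma> ^ t * (\<Sum>k\<le>?d. \<bar>X k \<bullet> ?e j\<bar>)" by simp
      also have "\<dots> \<le> c * \<gamma> ^ t * (K * ?m)"
      proof (rule mult_left_mono)
        have "(\<Sum>k\<le>?d. \<bar>X k \<bullet> ?e j\<bar>) \<le> (\<Sum>k\<le>?d. ?B ^ k * ?m)"
          using growth Basis_le_norm[OF e] by (intro sum_mono) (meson order_trans)
        then show "(\<Sum>k\<le>?d. \<bar>X k \<bullet> ?e j\<bar>) \<le> K * ?m"
          unfolding K_def sum_distrib_right .
      qed (use c in simp)
      finally show ?thesis .
    qed
    have "norm (X t) \<le> (\<Sum>b\<in>Basis. \<bar>X t \<bullet> b\<bar>)" by (rule norm_le_l1)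
    also have "\<dots> = (\<Sum>j\<in>UNIV. \<bar>X t \<bullet> ?e j\<bar>)" by (rule sum_basis_index[symmetric])
    also have "\<dots> \<le> n * (c * \<gamma> ^ t * (K * ?m))"
      unfolding n_def by (rule sum_bounded_above) (rule comp)
    finally show ?thesis by (simp add: mult_ac)
  qed
  moreover have "n * c * K > 0" using \<open>n > 0\<close> \<open>K > 0\<close> c by simp
  ultimately show ?thesis using c by blast
qed

text \<open>In the variable \<open>s = 1 / z\<close> the unstable region becomes the closed unit disc, and modes can be normalised
to the unit sphere.  The defect of the mode equation is then a continuous function without zero on a compact
set, and the tube lemma keeps it nonzero for nearby parameters.  At \<open>s = 0\<close> the mode equation reads
\<open>p = 0\<close>, so the point at infinity causes no trouble.\<close>

lemma no_unstable_mode_robust: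
  fixes F G :: "'w::topological_space \<Rightarrow> 'e::euclidean_space \<Rightarrow> 'e"
  assumes F: "\<And>w. linear (F w)" "\<And>x. continuous_on UNIV (\<lambda>w. F w x)"
    and G: "\<And>w. linear (G w)" "\<And>x. continuous_on UNIV (\<lambda>w. G w x)"
    and stable: "no_unstable_mode r (F w0) (G w0)"
  shows "\<exists>W. open W \<and> w0 \<in> W \<and> (\<forall>w\<in>W. no_unstable_mode r (F w) (G w))"
proof -
  define g where "g = (\<lambda>(w, s, p). p - cscale s (map_prod (F w) (F w) p)
      - cscale (s ^ Suc r) (map_prod (G w) (G w) p))"
  have joint: "continuous_on UNIV (\<lambda>(w, s::complex, p::'e \<times> 'e). map_prod (L w) (L w) p)"
    if lin: "\<And>w. linear (L w)" and cont: "\<And>x. continuous_on UNIV (\<lambda>w. L w x)"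
    for L :: "'w \<Rightarrow> 'e \<Rightarrow> 'e"
  proof -
    have Ls: "L w x = (\<Sum>b\<in>Basis. (x \<bullet> b) *\<^sub>R L w b)" for w x
    proof -
      have "L w x = L w (\<Sum>b\<in>Basis. (x \<bullet> b) *\<^sub>R b)" by (simp only: euclidean_representation)
      then show ?thesis by (simp only: linear_sum[OF lin] linear_cmul[OF lin])
    qed
    have Lc: "continuous_on UNIV (\<lambda>q. L (fst q) (f q))"
      if f: "continuous_on UNIV f" for f :: "'w \<times> complex \<times> 'e \<times> 'e \<Rightarrow> 'e"
    proof -
      have "continuous_on UNIV (\<lambda>q. \<Sum>b\<in>Basis. (f q \<bullet> b) *\<^sub>R L (fst q) b)"
        by (intro continuous_intros f continuous_on_compose2[OF cont]) auto
      then show ?thesis by (subst Ls)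
    qed
    have "(\<lambda>(w, s::complex, p::'e \<times> 'e). map_prod (L w) (L w) p) =
        (\<lambda>q. (L (fst q) (fst (snd (snd q))), L (fst q) (snd (snd (snd q)))))"
      by auto
    then show ?thesis
      by (auto intro!: continuous_intros Lc)
  qed
  have "continuous_on UNIV g"
  proof -
    have "g = (\<lambda>q. snd (snd q) - cscale (fst (snd q)) ((\<lambda>(w, s, p). map_prod (F w) (F w) p) q)
        - cscale (fst (snd q) ^ Suc r) ((\<lambda>(w, s, p). map_prod (G w) (G w) p) q))"
      by (auto simp: g_def fun_eq_iff)
    then show ?thesis
      by (simp only:) (intro continuous_intros continuous_on_cscale joint[of F, OF F] joint[of G, OF G])
  qed
  then have op: "open {q. g q \<noteq> 0}"
    by (intro open_Collect_neq continuous_on_const)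
  let ?K = "cball (0::complex) 1 \<times> sphere (0::'e \<times> 'e) 1"
  have mode_iff: "g (w, s, p) = 0 \<longleftrightarrow> cscale (inverse s ^ Suc r) p =
      cscale (inverse s ^ r) (map_prod (F w) (F w) p) + map_prod (G w) (G w) p"
    if "s \<noteq> 0" for w s p
  proof -
    let ?f = "map_prod (F w) (F w) p" and ?g = "map_prod (G w) (G w) p"
    have "g (w, s, p) = 0 \<longleftrightarrow> p = cscale s ?f + cscale (s ^ Suc r) ?g"
      unfolding g_def by (simp add: algebra_simps)
    also have "\<dots> \<longleftrightarrow> cscale (inverse s ^ Suc r) p = cscale (inverse s ^ Suc r) (cscale s ?f + cscale (s ^ Suc r) ?g)"
    proof
      assume eq: "cscale (inverse s ^ Suc r) p = cscale (inverse s ^ Suc r) (cscale s ?f + cscale (s ^ Suc r) ?g)"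
      have inv: "cscale (s ^ Suc r) (cscale (inverse s ^ Suc r) q) = q" for q :: "'e \<times> 'e"
      proof -
        have "s ^ Suc r * inverse s ^ Suc r = 1"
          using that by (simp only: power_mult_distrib[symmetric]) simp
        then show ?thesis by (simp only: cscale_mult[symmetric] cscale_1)
      qed
      show "p = cscale s ?f + cscale (s ^ Suc r) ?g"
        by (metis eq inv)
    qed metis
    also have "cscale (inverse s ^ Suc r) (cscale s ?f + cscale (s ^ Suc r) ?g) = cscale (inverse s ^ r) ?f + ?g"
    proof -
      have "inverse s ^ Suc r * s = inverse s ^ r" using that by (simp add: field_simps)
      moreover have "inverse s ^ Suc r * s ^ Suc r = 1"
        using that by (simp only: power_mult_distrib[symmetric]) simp
      ultimately show ?thesis by (simp only: cscale_add cscale_mult[symmetric] cscale_1)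
    qed
    finally show ?thesis .
  qed
  have sub: "{w0} \<times> ?K \<subseteq> {q. g q \<noteq> 0}"
  proof -
    have "g (w0, s, p) \<noteq> 0" if p: "norm p = 1" and s: "cmod s \<le> 1" for s p
    proof (cases "s = 0")
      case True
      then show ?thesis using p by (auto simp: g_def)
    next
      case False
      then have "1 \<le> cmod (inverse s)" using s by (simp add: norm_inverse one_le_inverse)
      then show ?thesis
        using mode_iff[OF False] stable p unfolding no_unstable_mode_def by fastforce
    qed
    then show ?thesis by auto
  qed
  have "compact ?K" by (intro compact_Times compact_cball compact_sphere)
  from Elementary_Topology.tube_lemma[OF this op sub]
  obtain W where W: "w0 \<in> W" "open W" "W \<times> ?K \<subseteq> {q. g q \<noteq> 0}"
    by (elim exE conjE)
  have "no_unstable_mode r (F w) (G w)" if w: "w \<in> W" for w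
    unfolding no_unstable_mode_def
  proof (intro allI impI)
    fix z p
    assume z: "1 \<le> cmod z"
      and mode: "cscale (z ^ Suc r) p = cscale (z ^ r) (map_prod (F w) (F w) p) + map_prod (G w) (G w) p"
    show "p = 0"
    proof (rule ccontr)
      assume p: "p \<noteq> 0"
      let ?c = "inverse (norm p)"
      have lin: "map_prod L L (c *\<^sub>R p) = c *\<^sub>R map_prod L L p" if "linear L" for L :: "'e \<Rightarrow> 'e" and c
        using linear_cmul[OF that] by (cases p) simp
      have z0: "inverse z \<noteq> 0" using z by auto
      have "g (w, inverse z, ?c *\<^sub>R p) = 0"
        unfolding mode_iff[OF z0] inverse_inverse_eq lin[OF F(1)] lin[OF G(1)] cscale_scaleR mode
        by (simp add: scaleR_add_right)
      moreover have "(inverse z, ?c *\<^sub>R p) \<in> ?K"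
        using z p by (simp add: norm_inverse inverse_le_1_iff)
      ultimately show False using W(3) w by blast
    qed
  qed
  with W show ?thesis by blast
qed

section \<open>Low-gain feedback\<close>

lemma complex_inner_smult: "(z *s x) \<bullet> (z *s y) = (cmod z)\<^sup>2 * (x \<bullet> (y :: complex^'n))"
proof -
  have "(z * a) \<bullet> (z * b) = (cmod z)\<^sup>2 * (a \<bullet> b)" for a b
    by (simp add: inner_complex_def cmod_power2) (simp add: algebra_simps power2_eq_square)
  then show ?thesis by (simp add: inner_vec_def sum_distrib_left)
qed

lemma complex_inner_smult_self: "(z *s x) \<bullet> x = Re z * (norm (x :: complex^'n))\<^sup>2"
proof -
  have "(z * a) \<bullet> a = Re z * (a \<bullet> a)" for a
    by (simp add: inner_complex_def algebra_simps)
  then show ?thesis by (simp add: power2_norm_eq_inner inner_vec_def sum_distrib_left)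
qed

text \<open>The mode equation \<open>z x = A x + B u\<close> is tested with \<open>V(x) = x\<^sup>* P x\<close>, where \<open>\<bullet>\<close> is the real part of the
Hermitian product.  For \<open>s = B\<^sup>T P A x\<close> and \<open>u = - \<nu> \<mu> s\<close> one has
\<open>V(z x) \<le> \<rho> V(x) + |s|\<^sup>2 + 2 u \<bullet> s + V(B u)\<close>; here \<open>2 u \<bullet> s \<le> - 2 |s|\<^sup>2\<close>, while \<open>V(B u)\<close> is at most \<open>\<delta> |u|\<^sup>2\<close>.
With the delay, \<open>z\<^sup>-\<^sup>r A\<^sup>r x\<close> differs from \<open>x\<close> by a sum of terms \<open>A\<^sup>k B u\<close> with coefficients of modulus at
most one; seen through \<open>B\<^sup>T P\<close> each of them has size of order \<open>\<delta> |u|\<close>.  Hence \<open>V(x) \<le> |z|\<^sup>2 V(x) \<le> \<rho> V(x)\<close>.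
The contraction is required only on \<open>X\<close>, which contains the range of \<open>B\<close> and everything that \<open>A\<close> makes of it.\<close>

lemma low_gain_mode_vanishes:
  fixes A P :: "complex^'n^'n" and B :: "complex^'m^'n" and Bt :: "complex^'n^'m"
    and X :: "(complex^'n) set"
  assumes Bt: "\<And>y u. (Bt *v y) \<bullet> u = y \<bullet> (B *v u)"
    and P: "\<And>x y. (P *v x) \<bullet> y = x \<bullet> (P *v y)"
    and pos: "\<And>y. y \<noteq> 0 \<Longrightarrow> 0 < y \<bullet> (P *v y)"
    and XA: "\<And>y. y \<in> X \<Longrightarrow> A *v y \<in> X" and XB: "\<And>u. B *v u \<in> X"
    and contract: "\<And>y. y \<in> X \<Longrightarrow> (A *v y) \<bullet> (P *v (A *v y)) \<le>
        \<rho> * (y \<bullet> (P *v y)) + (norm (Bt *v (P *v (A *v y))))\<^sup>2"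
    and small: "\<And>y. (norm (Bt *v (P *v y)))\<^sup>2 \<le> \<delta> * (y \<bullet> (P *v y))"
    and \<rho>: "0 \<le> \<rho>" "\<rho> < 1" and \<delta>: "0 \<le> \<delta>" "\<delta> \<le> 1 / 2"
      "l * (real r * 2 ^ r * \<delta>) \<le> 1 / 2" "4 * l\<^sup>2 * ((real r * 2 ^ r + 1) * \<delta>) \<le> 1"
    and \<nu>: "0 \<le> \<nu>" "1 \<le> \<nu> * Re \<mu>" "\<nu> * cmod \<mu> \<le> l"
    and z: "1 \<le> cmod z" "\<omega> * z ^ r = 1"
    and x: "x \<in> X" "z *s x = A *v x + B *v u"
    and u: "u = (- of_real \<nu> * \<mu> * \<omega>) *s (Bt *v (P *v (matpow A (Suc r) *v x)))"
  shows "x = 0"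
proof -
  define V where "V y = y \<bullet> (P *v y)" for y
  have V0: "0 \<le> V y" for y using pos[of y] by (cases "y = 0") (auto simp: V_def)
  have V_small: "(norm (Bt *v (P *v y)))\<^sup>2 \<le> \<delta> * V y" for y using small by (simp add: V_def)
  have VB: "V (B *v u) \<le> \<delta> * (norm u)\<^sup>2" for u
  proof -
    have "V (B *v u) = (Bt *v (P *v (B *v u))) \<bullet> u"
      unfolding V_def Bt P ..
    also have "\<dots> \<le> norm (Bt *v (P *v (B *v u))) * norm u" by (rule norm_cauchy_schwarz)
    finally have "(V (B *v u))\<^sup>2 \<le> (norm (Bt *v (P *v (B *v u))))\<^sup>2 * (norm u)\<^sup>2"
      using V0 by (metis power_mono power_mult_distrib)
    also have "\<dots> \<le> (\<delta> * V (B *v u)) * (norm u)\<^sup>2"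
      by (intro mult_right_mono V_small) simp
    finally have le: "V (B *v u) * V (B *v u) \<le> V (B *v u) * (\<delta> * (norm u)\<^sup>2)"
      by (simp add: power2_eq_square mult_ac)
    show ?thesis
    proof (cases "V (B *v u) = 0")
      case False
      then have "0 < V (B *v u)" using V0[of "B *v u"] by linarith
      then show ?thesis using le by simp
    qed (use \<delta> in simp)
  qed
  have VA: "V (A *v y) \<le> 2 * V y" if "y \<in> X" for y
  proof -
    have "V (A *v y) \<le> \<rho> * V y + \<delta> * V (A *v y)"
      using contract[OF that] V_small[of "A *v y"] unfolding V_def by linarith
    also have "\<dots> \<le> 1 * V y + 1 / 2 * V (A *v y)"
      using \<rho> \<delta> V0 by (intro add_mono mult_right_mono) auto
    finally show ?thesis by simp
  qed
  have powB: "matpow A k *v (B *v u) \<in> X \<and> V (matpow A k *v (B *v u)) \<le> 2 ^ k * (\<delta> * (norm u)\<^sup>2)"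
    for k u
  proof (induction k)
    case (Suc k)
    then have IH: "matpow A k *v (B *v u) \<in> X" "V (matpow A k *v (B *v u)) \<le> 2 ^ k * (\<delta> * (norm u)\<^sup>2)"
      by auto
    show ?case
      unfolding matpow_Suc_vec using VA[OF IH(1)] IH(2) XA[OF IH(1)] by simp
  qed (simp add: XB VB)
  have cross: "norm (Bt *v (P *v (matpow A k *v (B *v u)))) \<le> 2 ^ r * \<delta> * norm u" if "k \<le> r" for k u
  proof (rule power2_le_imp_le)
    have "(norm (Bt *v (P *v (matpow A k *v (B *v u)))))\<^sup>2 \<le> \<delta> * V (matpow A k *v (B *v u))"
      by (rule V_small)
    also have "\<dots> \<le> \<delta> * (2 ^ k * (\<delta> * (norm u)\<^sup>2))"
      using powB \<delta> by (intro mult_left_mono) auto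
    also have "\<dots> = 2 ^ k * (\<delta> * norm u)\<^sup>2" by (simp add: power2_eq_square)
    also have "\<dots> \<le> (2 ^ r)\<^sup>2 * (\<delta> * norm u)\<^sup>2"
    proof (intro mult_right_mono)
      have "(2::real) ^ k \<le> 2 ^ (r * 2)" using that by (intro power_increasing) auto
      then show "(2::real) ^ k \<le> (2 ^ r)\<^sup>2" by (simp add: power_mult)
    qed simp
    finally show "(norm (Bt *v (P *v (matpow A k *v (B *v u)))))\<^sup>2 \<le> (2 ^ r * \<delta> * norm u)\<^sup>2"
      by (simp add: power_mult_distrib)
  qed (use \<delta> in simp)
  have z0: "z \<noteq> 0" and \<omega>0: "cmod \<omega> \<le> 1"
  proof -
    show "z \<noteq> 0" using z by auto
    have "cmod \<omega> * cmod z ^ r = 1" using z(2) by (metis norm_mult norm_one norm_power)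
    moreover have "cmod \<omega> * 1 \<le> cmod \<omega> * cmod z ^ r"
      using z(1) by (intro mult_left_mono one_le_power) auto
    ultimately show "cmod \<omega> \<le> 1" by simp
  qed
  \<comment> \<open>Iterating the mode equation compares the predicted state A^k x with z^k x.\<close>
  have iterate: "matpow A k *v x = z ^ k *s x - (\<Sum>j<k. z ^ j *s (matpow A (k - 1 - j) *v (B *v u)))" for k
  proof (induction k)
    case (Suc k)
    have Ax: "A *v x = z *s x - B *v u" using x(2) by (simp add: algebra_simps)
    have "matpow A (Suc k) *v x = z ^ k *s (A *v x) - (\<Sum>j<k. z ^ j *s (A *v (matpow A (k - 1 - j) *v (B *v u))))"
      unfolding matpow_Suc_vec Suc
      by (simp add: matrix_vector_mult_diff_distrib matrix_vector_mult_vector_scalar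
          linear_sum[OF matrix_vector_mul_linear])
    also have "z ^ k *s (A *v x) = z ^ Suc k *s x - z ^ k *s (B *v u)"
      unfolding Ax by (simp add: vec_eq_iff algebra_simps)
    also have "(\<Sum>j<k. z ^ j *s (A *v (matpow A (k - 1 - j) *v (B *v u)))) =
        (\<Sum>j<k. z ^ j *s (matpow A (Suc k - 1 - j) *v (B *v u)))"
    proof (intro sum.cong refl)
      fix j assume "j \<in> {..<k}"
      then have "Suc k - 1 - j = Suc (k - 1 - j)" by auto
      then show "z ^ j *s (A *v (matpow A (k - 1 - j) *v (B *v u))) =
          z ^ j *s (matpow A (Suc k - 1 - j) *v (B *v u))" by (simp only: matpow_Suc_vec)
    qed
    finally show ?case by simp
  qed simp
  define s where "s = Bt *v (P *v (A *v x))"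
  define \<theta> where "\<theta> = (\<Sum>j<r. (\<omega> * z ^ j) *s (Bt *v (P *v (matpow A (r - j) *v (B *v u)))))"
  have u_eq: "u = (- of_real \<nu> * \<mu>) *s (s - \<theta>)"
  proof -
    have "\<omega> *s (Bt *v (P *v (matpow A (Suc r) *v x))) = s - \<theta>"
    proof -
      have "Bt *v (P *v (matpow A (Suc r) *v x)) = z ^ r *s s -
          (\<Sum>j<r. z ^ j *s (Bt *v (P *v (A *v (matpow A (r - 1 - j) *v (B *v u))))))"
        unfolding matpow_Suc_vec iterate[of r] s_def
        by (simp add: matrix_vector_mult_diff_distrib matrix_vector_mult_vector_scalar
          linear_sum[OF matrix_vector_mul_linear])
      also have "(\<Sum>j<r. z ^ j *s (Bt *v (P *v (A *v (matpow A (r - 1 - j) *v (B *v u)))))) =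
          (\<Sum>j<r. z ^ j *s (Bt *v (P *v (matpow A (r - j) *v (B *v u)))))"
      proof (intro sum.cong refl)
        fix j assume "j \<in> {..<r}"
        then have "r - j = Suc (r - 1 - j)" by auto
        then show "z ^ j *s (Bt *v (P *v (A *v (matpow A (r - 1 - j) *v (B *v u))))) =
            z ^ j *s (Bt *v (P *v (matpow A (r - j) *v (B *v u))))" by (simp only: matpow_Suc_vec)
      qed
      finally show ?thesis
        using z(2) by (simp add: \<theta>_def vector_ssub_ldistrib vector_smult_assoc vec.scale_sum_right)
    qed
    then show ?thesis unfolding u by (metis vector_smult_assoc)
  qed
  define \<kappa> where "\<kappa> = real r * 2 ^ r * \<delta>"
  have \<kappa>0: "0 \<le> \<kappa>" using \<delta> by (simp add: \<kappa>_def)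
  have \<theta>: "norm \<theta> \<le> \<kappa> * norm u"
  proof -
    have "norm \<theta> \<le> (\<Sum>j<r. 2 ^ r * \<delta> * norm u)"
      unfolding \<theta>_def
    proof (rule sum_norm_le)
      fix j assume j: "j \<in> {..<r}"
      have "cmod (\<omega> * z ^ j) \<le> cmod (\<omega> * z ^ r)"
        unfolding norm_mult norm_power using z(1) j
        by (intro mult_left_mono power_increasing) auto
      then have "cmod (\<omega> * z ^ j) \<le> 1" using z(2) by simp
      then have "cmod (\<omega> * z ^ j) * norm (Bt *v (P *v (matpow A (r - j) *v (B *v u)))) \<le>
          1 * (2 ^ r * \<delta> * norm u)"
        by (intro mult_mono cross) auto
      then show "norm ((\<omega> * z ^ j) *s (Bt *v (P *v (matpow A (r - j) *v (B *v u))))) \<le> 2 ^ r * \<delta> * norm u"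
        by (simp add: norm_vector_scalar_mult)
    qed
    then show ?thesis by (simp add: \<kappa>_def mult_ac)
  qed
  have l0: "0 \<le> l" using \<nu> by (meson mult_nonneg_nonneg norm_ge_zero order_trans)
  have norm_u: "norm u \<le> 2 * l * norm s"
  proof -
    have "norm u = \<nu> * cmod \<mu> * norm (s - \<theta>)"
      unfolding u_eq norm_vector_scalar_mult using \<nu>(1) by (simp add: norm_mult)
    also have "\<dots> \<le> l * (norm s + \<kappa> * norm u)"
      using \<theta> \<nu>(3) l0 norm_triangle_ineq4[of s \<theta>] by (intro mult_mono) auto
    also have "\<dots> \<le> l * norm s + 1 / 2 * norm u"
    proof -
      have "l * \<kappa> * norm u \<le> 1 / 2 * norm u"
        using \<delta>(3) by (intro mult_right_mono) (auto simp: \<kappa>_def)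
      then show ?thesis by (simp add: algebra_simps)
    qed
    finally show ?thesis by simp
  qed
  have us: "u \<bullet> s \<le> - (norm s)\<^sup>2 + 2 * l\<^sup>2 * \<kappa> * (norm s)\<^sup>2"
  proof -
    have "u = (- of_real \<nu> * \<mu>) *s s + (of_real \<nu> * \<mu>) *s \<theta>"
      unfolding u_eq by (simp add: vec_eq_iff algebra_simps)
    then have "u \<bullet> s = ((- of_real \<nu> * \<mu>) *s s) \<bullet> s + ((of_real \<nu> * \<mu>) *s \<theta>) \<bullet> s"
      by (metis inner_add_left)
    also have "((- of_real \<nu> * \<mu>) *s s) \<bullet> s = - (\<nu> * Re \<mu>) * (norm s)\<^sup>2"
      unfolding complex_inner_smult_self by simp
    also have "\<dots> \<le> - 1 * (norm s)\<^sup>2"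
      using \<nu>(2) by (intro mult_right_mono) auto
    also have "((of_real \<nu> * \<mu>) *s \<theta>) \<bullet> s \<le> norm ((of_real \<nu> * \<mu>) *s \<theta>) * norm s"
      by (rule norm_cauchy_schwarz)
    also have "norm ((of_real \<nu> * \<mu>) *s \<theta>) \<le> l * (\<kappa> * (2 * l * norm s))"
    proof -
      have "norm ((of_real \<nu> * \<mu>) *s \<theta>) = \<nu> * cmod \<mu> * norm \<theta>"
        unfolding norm_vector_scalar_mult using \<nu>(1) by (simp add: norm_mult)
      also have "\<dots> \<le> l * (\<kappa> * (2 * l * norm s))"
      proof (intro mult_mono \<nu>(3) l0)
        show "norm \<theta> \<le> \<kappa> * (2 * l * norm s)"
          using \<theta> mult_left_mono[OF norm_u \<kappa>0] by linarith
      qed auto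
      finally show ?thesis .
    qed
    finally show ?thesis
      by (simp add: mult_right_mono power2_eq_square mult_ac)
  qed
  have "V x \<le> (cmod z)\<^sup>2 * V x"
    using V0[of x] z(1) mult_right_mono[of 1 "(cmod z)\<^sup>2" "V x"] by simp
  also have "\<dots> = V (A *v x + B *v u)"
    unfolding x(2)[symmetric] V_def matrix_vector_mult_vector_scalar complex_inner_smult ..
  also have "\<dots> = V (A *v x) + 2 * (u \<bullet> s) + V (B *v u)"
  proof -
    have "(B *v u) \<bullet> (P *v (A *v x)) = u \<bullet> s" "(A *v x) \<bullet> (P *v (B *v u)) = u \<bullet> s"
      unfolding s_def by (metis Bt inner_commute, metis Bt P inner_commute)
    then show ?thesis by (simp add: V_def matrix_vector_right_distrib inner_add_left inner_add_right)
  qed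
  also have "\<dots> \<le> (\<rho> * V x + (norm s)\<^sup>2) + 2 * (- (norm s)\<^sup>2 + 2 * l\<^sup>2 * \<kappa> * (norm s)\<^sup>2)
      + \<delta> * (2 * l * norm s)\<^sup>2"
  proof -
    have VAx: "V (A *v x) \<le> \<rho> * V x + (norm s)\<^sup>2" using contract[OF x(1)] by (simp add: V_def s_def)
    have VBu: "V (B *v u) \<le> \<delta> * (2 * l * norm s)\<^sup>2"
      using VB[of u] norm_u \<delta>(1) by (meson mult_left_mono norm_ge_zero order_trans power_mono)
    show ?thesis by (intro add_mono mult_left_mono VAx VBu us) simp
  qed
  also have "\<dots> = \<rho> * V x + (4 * l\<^sup>2 * ((real r * 2 ^ r + 1) * \<delta>) - 1) * (norm s)\<^sup>2"
    by (simp add: \<kappa>_def power_mult_distrib algebra_simps)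
  also have "\<dots> \<le> \<rho> * V x"
    using \<delta>(4) by (simp add: mult_nonpos_nonneg)
  finally have "(1 - \<rho>) * V x \<le> 0" by (simp add: algebra_simps)
  then have "V x \<le> 0" using \<rho> by (simp add: mult_le_0_iff)
  then show ?thesis using pos[of x] unfolding V_def by fastforce
qed

lemma shift_act_of_real: "shift_act (cpoly f) (\<lambda>t. of_real (y t)) t = of_real (shift_act f y t)"
  by (simp add: shift_act_def degree_map_poly coeff_map_poly)

lemma spectral_decay:
  assumes "\<forall>\<mu>\<in>spectrum M. cmod \<mu> < 1"
  shows "(\<lambda>k. matpow M k $ i $ j) \<longlonglongrightarrow> 0"
proof -
  let ?p = "cpoly (char_poly M)"
  have p0: "?p \<noteq> 0" by (simp add: cpoly_eq_0_iff char_poly_neq_0)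
  have root: "\<And>z. poly ?p z = 0 \<Longrightarrow> cmod z < 1" using assms by (simp add: char_poly_root_iff)
  define y where "y k = complex_of_real ((matpow M k *v axis j 1) $ i)" for k
  have "\<forall>t. shift_act ?p y t = 0"
    unfolding y_def shift_act_of_real char_poly_eq_det_char_matrix char_matrix_annihilates by simp
  then obtain c \<gamma> where c: "0 < \<gamma>" "\<gamma> < 1"
    "\<And>t. cmod (y t) \<le> c * \<gamma> ^ t * (\<Sum>k\<le>degree ?p. cmod (y k))"
    using recurrence_decay[OF p0 root] by metis
  let ?s = "\<Sum>k\<le>degree ?p. cmod (y k)"
  have "(\<lambda>t. c * \<gamma> ^ t * ?s) \<longlonglongrightarrow> c * 0 * ?s"
    using c(1,2) by (intro tendsto_intros LIMSEQ_power_zero) auto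
  then have lim: "(\<lambda>t. c * \<gamma> ^ t * ?s) \<longlonglongrightarrow> 0" by simp
  have "\<forall>\<^sub>F t in sequentially. norm (y t) \<le> c * \<gamma> ^ t * ?s"
    by (rule always_eventually) (rule allI, rule c(3))
  then have "y \<longlonglongrightarrow> 0" using lim by (rule Lim_null_comparison)
  then have "(\<lambda>k. Re (y k)) \<longlonglongrightarrow> Re 0" by (rule tendsto_Re)
  then show ?thesis
    by (simp add: y_def matrix_vector_mult_def axis_def if_distrib cong: if_cong)
qed

lemma matpow_transpose_conj:
  fixes M W :: "real^'n^'n"
  assumes "W = M ** W ** transpose M"
  shows "W = matpow M k ** W ** transpose (matpow M k)"
proof (induction k)
  case (Suc k)
  have "matpow M (Suc k) = matpow M k ** M" by (simp add: matpow_commute)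
  then have "matpow M (Suc k) ** W ** transpose (matpow M (Suc k)) =
      matpow M k ** (M ** W ** transpose M) ** transpose (matpow M k)"
    by (simp only: matrix_transpose_mul matrix_mul_assoc)
  then show ?case using Suc assms by simp
qed simp

text \<open>Iterating the equation gives \<open>W = M\<^sup>k W (M\<^sup>T)\<^sup>k\<close>, which tends to zero.\<close>

lemma lyapunov_unique:
  fixes M W :: "real^'n^'n"
  assumes "\<forall>\<mu>\<in>spectrum M. cmod \<mu> < 1" and W: "W = M ** W ** transpose M"
  shows "W = 0"
proof -
  have "W $ i $ j = 0" for i j
  proof -
    have eq: "W $ i $ j = (\<Sum>b\<in>UNIV. (\<Sum>a\<in>UNIV. matpow M k $ i $ a * W $ a $ b) * matpow M k $ j $ b)" for k
      by (subst matpow_transpose_conj[OF W, of k]) (simp add: matrix_matrix_mult_def transpose_def)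
    have "(\<lambda>k. \<Sum>b\<in>UNIV. (\<Sum>a\<in>UNIV. matpow M k $ i $ a * W $ a $ b) * matpow M k $ j $ b)
        \<longlonglongrightarrow> (\<Sum>b\<in>(UNIV::'n set). (\<Sum>a\<in>UNIV. 0 * W $ a $ b) * 0)"
      by (intro tendsto_intros spectral_decay assms(1))
    then have "(\<lambda>k::nat. W $ i $ j) \<longlonglongrightarrow> 0" by (simp flip: eq)
    then show ?thesis by (simp add: LIMSEQ_const_iff)
  qed
  then show ?thesis by (simp add: vec_eq_iff)
qed

lemma matrix_sub_ldistrib: "A ** (B - C) = A ** B - A ** (C :: 'a::ring_1^'k^'n)"
  by (vector matrix_matrix_mult_def sum_subtractf[symmetric] right_diff_distrib)

lemma matrix_sub_rdistrib: "(A - B) ** C = A ** C - B ** (C :: 'a::ring_1^'k^'n)"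
  by (vector matrix_matrix_mult_def sum_subtractf[symmetric] left_diff_distrib)

text \<open>An injective linear map on a space of finite dimension is onto.\<close>

lemma lyapunov_exists:
  fixes M Q :: "real^'n^'n"
  assumes "\<forall>\<mu>\<in>spectrum M. cmod \<mu> < 1"
  obtains W where "W = M ** W ** transpose M + Q"
proof -
  define L where "L W = W - M ** W ** transpose M" for W
  have lin: "linear L"
  proof (rule linearI)
    show "L (X + Y) = L X + L Y" for X Y
      by (simp only: L_def matrix_add_ldistrib matrix_add_rdistrib add_diff_add)
    show "L (c *\<^sub>R X) = c *\<^sub>R L X" for c X
      by (simp only: L_def matrix_scaleR_left matrix_scaleR_right scaleR_diff_right)
  qed
  have "W = 0" if "L W = 0" for W
    using that lyapunov_unique[OF assms, of W] by (simp add: L_def)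
  then have "inj L" using linear_injective_0[OF lin] by blast
  then have "surj L" using linear_injective_imp_surjective lin by blast
  then obtain W where "Q = L W" by (metis surjD)
  then show thesis using that[of W] by (simp add: L_def)
qed

lemma spectrum_scaleR:
  assumes "c \<noteq> 0" "\<mu> \<in> spectrum (c *\<^sub>R M)"
  shows "\<mu> / of_real c \<in> spectrum M"
proof -
  obtain x where x: "x \<noteq> 0" "cmatrix (c *\<^sub>R M) *v x = \<mu> *s x"
    using assms(2) by (auto simp: spectrum_def)
  have "cmatrix (c *\<^sub>R M) *v x = of_real c *s (cmatrix M *v x)"
    by (simp add: vec_eq_iff matrix_vector_mult_def sum_distrib_left mult.assoc)
  then have "cmatrix M *v x = (\<mu> / of_real c) *s x"
    using x(2) assms(1) by (simp add: vec_eq_iff field_simps)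
  then show ?thesis using x(1) by (auto simp: spectrum_def)
qed

lemma transpose_add: "transpose (A + B) = transpose A + transpose B"
  by (simp add: vec_eq_iff transpose_def)

lemma transpose_diff: "transpose (A - B) = transpose A - transpose B"
  by (simp add: vec_eq_iff transpose_def)

text \<open>The matrix \<open>W\<close> is the sum of \<open>\<rho>\<^sup>j M\<^sup>j N (M\<^sup>T)\<^sup>j\<close> over \<open>j \<ge> 1\<close>; the last property says that it dominates the
partial sums.  Obtaining it from its Lyapunov equation gives symmetry and commutation by uniqueness.\<close>

lemma discounted_gramian:
  fixes M N P :: "real^'n^'n"
  assumes spec: "\<forall>\<mu>\<in>spectrum M. cmod \<mu> \<le> 1" and \<rho>: "0 < \<rho>" "\<rho> < 1"
    and N: "transpose N = N" "\<And>x. 0 \<le> x \<bullet> (N *v x)"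
    and P: "P ** M = M ** P" "P ** N = N ** transpose P"
  obtains W where "transpose W = W" "W = \<rho> *\<^sub>R (M ** (W + N) ** transpose M)"
    "P ** W = W ** transpose P"
    "\<And>x k. (\<Sum>j=1..k. \<rho> ^ j * ((x v* matpow M j) \<bullet> (N *v (x v* matpow M j)))) \<le> x \<bullet> (W *v x)"
proof -
  define R where "R = sqrt \<rho> *\<^sub>R M"
  have specR: "\<forall>\<mu>\<in>spectrum R. cmod \<mu> < 1"
  proof
    fix \<mu> assume "\<mu> \<in> spectrum R"
    then have "\<mu> / of_real (sqrt \<rho>) \<in> spectrum M"
      using \<rho> unfolding R_def by (intro spectrum_scaleR) simp_all
    then have "cmod (\<mu> / of_real (sqrt \<rho>)) \<le> 1" using spec by blast
    then have "cmod \<mu> \<le> sqrt \<rho>" using \<rho> by (simp add: norm_divide divide_le_eq)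
    then show "cmod \<mu> < 1" using \<rho> real_sqrt_lt_1_iff[of \<rho>] by linarith
  qed
  have conj: "R ** X ** transpose R = \<rho> *\<^sub>R (M ** X ** transpose M)" for X
  proof -
    have "sqrt \<rho> * sqrt \<rho> = \<rho>" using \<rho> by simp
    then show ?thesis
      by (simp add: R_def matrix_scaleR_left matrix_scaleR_right transpose_scalar)
  qed
  obtain W where W: "W = R ** W ** transpose R + R ** N ** transpose R"
    using lyapunov_exists[OF specR] by blast
  have W1: "W = \<rho> *\<^sub>R (M ** (W + N) ** transpose M)"
    by (rule trans[OF W]) (simp only: conj matrix_add_ldistrib matrix_add_rdistrib scaleR_add_right)
  have "W - transpose W = R ** (W - transpose W) ** transpose R"
  proof -
    have "transpose W = R ** transpose W ** transpose R + R ** N ** transpose R"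
      by (rule trans[OF arg_cong[where f = transpose, OF W]])
        (simp only: transpose_add matrix_transpose_mul N(1) matrix_mul_assoc transpose_transpose)
    from arg_cong2[where f = "(-)", OF W this]
    have "W - transpose W = (R ** W ** transpose R + R ** N ** transpose R)
        - (R ** transpose W ** transpose R + R ** N ** transpose R)" .
    also have "\<dots> = R ** (W - transpose W) ** transpose R"
      by (simp only: matrix_sub_ldistrib matrix_sub_rdistrib add_diff_cancel_right)
    finally show ?thesis .
  qed
  then have sym: "transpose W = W" using lyapunov_unique[OF specR] by fastforce
  have "P ** W - W ** transpose P = R ** (P ** W - W ** transpose P) ** transpose R"
  proof -
    have PR: "P ** R = R ** P" by (simp add: R_def matrix_scaleR_left matrix_scaleR_right P(1))
    have "P ** W = R ** (P ** W) ** transpose R + R ** (P ** N) ** transpose R"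
      by (rule trans[OF arg_cong[where f = "\<lambda>X. P ** X", OF W]])
        (simp only: matrix_add_ldistrib matrix_mul_assoc PR)
    moreover have "W ** transpose P = R ** (W ** transpose P) ** transpose R + R ** (N ** transpose P) ** transpose R"
    proof -
      have "transpose R ** transpose P = transpose P ** transpose R"
        using PR by (simp flip: matrix_transpose_mul)
      then have c: "X ** transpose R ** transpose P = X ** transpose P ** transpose R" for X :: "real^'n^'n"
        by (simp only: matrix_mul_assoc[symmetric])
      show ?thesis
        by (rule trans[OF arg_cong[where f = "\<lambda>X. X ** transpose P", OF W]])
          (simp only: matrix_add_rdistrib matrix_mul_assoc c)
    qed
    ultimately have "P ** W - W ** transpose P = (R ** (P ** W) ** transpose R + R ** (P ** N) ** transpose R)
        - (R ** (W ** transpose P) ** transpose R + R ** (N ** transpose P) ** transpose R)"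
      by (rule arg_cong2)
    also have "\<dots> = R ** (P ** W - W ** transpose P) ** transpose R"
      by (simp only: matrix_sub_ldistrib matrix_sub_rdistrib P(2) add_diff_cancel_right)
    finally show ?thesis .
  qed
  then have comm: "P ** W = W ** transpose P" using lyapunov_unique[OF specR] by fastforce
  have quad: "x \<bullet> (W *v x) = (x v* matpow R k) \<bullet> (W *v (x v* matpow R k)) +
      (\<Sum>j=1..k. (x v* matpow R j) \<bullet> (N *v (x v* matpow R j)))" for x k
  proof (induction k)
    case (Suc k)
    let ?y = "x v* matpow R k"
    have "?y \<bullet> (W *v ?y) = ?y \<bullet> ((R ** W ** transpose R) *v ?y) + ?y \<bullet> ((R ** N ** transpose R) *v ?y)"
      by (rule trans[OF arg_cong[where f = "\<lambda>X. ?y \<bullet> (X *v ?y)", OF W]])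
        (simp only: matrix_vector_mult_add_rdistrib inner_add_right)
    also have "\<dots> = (?y v* R) \<bullet> (W *v (?y v* R)) + (?y v* R) \<bullet> (N *v (?y v* R))"
      by (simp add: dot_lmul_matrix flip: matrix_vector_mul_assoc)
    also have "?y v* R = x v* matpow R (Suc k)"
      by (simp add: vector_matrix_mul_assoc matpow_commute)
    finally show ?case using Suc by (simp del: matpow.simps(2))
  qed simp
  have powR: "x v* matpow R j = sqrt \<rho> ^ j *\<^sub>R (x v* matpow M j)" for x j
  proof -
    have "matpow R j = sqrt \<rho> ^ j *\<^sub>R matpow M j"
      by (induction j) (simp_all add: R_def matrix_scaleR_left matrix_scaleR_right)
    then show ?thesis
      by (simp add: vec_eq_iff vector_matrix_mult_def sum_distrib_left mult_ac)
  qed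
  have powR2: "(x v* matpow R j) \<bullet> (N *v (x v* matpow R j)) =
      \<rho> ^ j * ((x v* matpow M j) \<bullet> (N *v (x v* matpow M j)))" for x j
  proof -
    have "sqrt \<rho> ^ j * sqrt \<rho> ^ j = \<rho> ^ j"
      using \<rho> by (simp flip: power_mult_distrib)
    then show ?thesis by (simp add: powR matrix_vector_mult_scaleR flip: mult.assoc)
  qed
  have "(\<Sum>j=1..k. \<rho> ^ j * ((x v* matpow M j) \<bullet> (N *v (x v* matpow M j)))) \<le> x \<bullet> (W *v x)" for x k
  proof -
    let ?s = "\<lambda>k. \<Sum>j=1..k. (x v* matpow R j) \<bullet> (N *v (x v* matpow R j))"
    let ?r = "\<lambda>l. (x v* matpow R l) \<bullet> (W *v (x v* matpow R l))"
    have "?r \<longlonglongrightarrow> 0"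
    proof -
      have comp: "(\<lambda>l. (x v* matpow R l) $ i) \<longlonglongrightarrow> 0" for i
        unfolding vector_matrix_mult_def vec_lambda_beta
        by (intro tendsto_null_sum tendsto_mult_right_zero spectral_decay specR)
      have eq: "?r = (\<lambda>l. \<Sum>i\<in>UNIV. (x v* matpow R l) $ i * (\<Sum>j\<in>UNIV. W $ i $ j * (x v* matpow R l) $ j))"
        by (simp add: inner_vec_def matrix_vector_mult_def)
      have "?r \<longlonglongrightarrow> (\<Sum>i\<in>(UNIV::'n set). 0 * (\<Sum>j\<in>UNIV. W $ i $ j * 0))"
        unfolding eq by (intro tendsto_intros comp)
      then show ?thesis by simp
    qed
    then have "(\<lambda>l. ?r l + ?s k) \<longlonglongrightarrow> 0 + ?s k" by (intro tendsto_intros)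
    moreover have "?r l + ?s k \<le> x \<bullet> (W *v x)" if "k \<le> l" for l
    proof -
      have "?s k \<le> ?s l" using that by (intro sum_mono2) (auto simp: N(2))
      then show ?thesis using quad[of x l] by linarith
    qed
    ultimately have "0 + ?s k \<le> x \<bullet> (W *v x)"
      by (intro LIMSEQ_le_const2) auto
    then show ?thesis by (simp add: powR2)
  qed
  with sym W1 comm that show thesis by blast
qed

text \<open>The numbers \<open>q \<bullet> M\<^sup>k b\<close>, for a column \<open>b\<close> of \<open>B\<close>, satisfy the recurrence of the characteristic polynomial
of \<open>M\<close>, so the mean value bound applies; the factor \<open>1 / L\<close> remains after the Cauchy-Schwarz
inequality.\<close>

lemma input_energy_small:
  fixes M :: "real^'n^'n" and B :: "real^'m^'n"
  assumes "\<forall>\<mu>\<in>spectrum M. cmod \<mu> = 1"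
  obtains c D where "0 \<le> c" "\<And>L q. 1 \<le> L \<Longrightarrow> (norm (q v* B))\<^sup>2 \<le>
      c / real L * (\<Sum>k=1..D * L. (norm ((q v* matpow M k) v* B))\<^sup>2)"
proof -
  let ?p = "cpoly (char_poly M)"
  have p0: "?p \<noteq> 0" by (simp add: cpoly_eq_0_iff char_poly_neq_0)
  have root: "\<And>z. poly ?p z = 0 \<Longrightarrow> cmod z = 1" using assms by (simp add: char_poly_root_iff)
  obtain c D where c: "c \<ge> 0" and mv: "\<And>L y. 1 \<le> L \<Longrightarrow> (\<forall>t. shift_act ?p y t = 0) \<Longrightarrow>
      cmod (y 0) \<le> c / real L * (\<Sum>k=1..D * L. cmod (y k))"
    using unit_circle_mean_value[OF p0 root] by metis
  have comp: "((q v* B) $ i)\<^sup>2 \<le> c\<^sup>2 * real D / real L * (\<Sum>k=1..D * L. (((q v* matpow M k) v* B) $ i)\<^sup>2)"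
    if L: "1 \<le> L" for q i and L :: nat
  proof -
    define y where "y k = ((q v* matpow M k) v* B) $ i" for k
    have y: "y k = (\<Sum>j\<in>UNIV. q $ j * (matpow M k *v column i B) $ j)" for k
    proof -
      have "y k = (q v* matpow M k) \<bullet> column i B"
        by (simp add: y_def vector_matrix_mult_def inner_vec_def column_def mult.commute)
      also have "\<dots> = q \<bullet> (matpow M k *v column i B)" by (rule dot_lmul_matrix)
      finally show ?thesis by (simp add: inner_vec_def)
    qed
    have "\<forall>t. shift_act ?p (\<lambda>k. of_real (y k)) t = 0"
      unfolding shift_act_of_real y shift_act_seq_sum shift_act_seq_scale char_poly_eq_det_char_matrix
        char_matrix_annihilates by simp
    from mv[OF L this] have "\<bar>y 0\<bar> \<le> c / real L * (\<Sum>k=1..D * L. \<bar>y k\<bar>)" by simp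
    then have "(y 0)\<^sup>2 \<le> (c / real L * (\<Sum>k=1..D * L. \<bar>y k\<bar>))\<^sup>2"
      by (metis abs_ge_zero power2_abs power_mono)
    also have "\<dots> = (c / real L)\<^sup>2 * (\<Sum>k=1..D * L. \<bar>y k\<bar>)\<^sup>2" by (rule power_mult_distrib)
    also have "\<dots> \<le> (c / real L)\<^sup>2 * ((\<Sum>k=1..D * L. \<bar>y k\<bar>\<^sup>2) * card {1..D * L})"
      by (intro mult_left_mono sum_squared_le_sum_of_squares) auto
    also have "\<dots> = c\<^sup>2 * real D / real L * (\<Sum>k=1..D * L. (y k)\<^sup>2)"
      using L by (simp add: power2_eq_square field_simps)
    finally show ?thesis by (simp add: y_def)
  qed
  have nrm: "(norm v)\<^sup>2 = (\<Sum>i\<in>UNIV. (v $ i)\<^sup>2)" for v :: "real^'m"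
    by (simp only: power2_norm_eq_inner inner_vec_def) (simp add: power2_eq_square)
  have "(norm (q v* B))\<^sup>2 \<le> (c\<^sup>2 * real D) / real L * (\<Sum>k=1..D * L. (norm ((q v* matpow M k) v* B))\<^sup>2)"
    if "1 \<le> L" for q L
  proof -
    have "(norm (q v* B))\<^sup>2 \<le> (\<Sum>i\<in>UNIV. c\<^sup>2 * real D / real L * (\<Sum>k=1..D * L. (((q v* matpow M k) v* B) $ i)\<^sup>2))"
      unfolding nrm by (intro sum_mono comp that)
    also have "\<dots> = c\<^sup>2 * real D / real L * (\<Sum>k=1..D * L. (norm ((q v* matpow M k) v* B))\<^sup>2)"
      unfolding nrm sum_distrib_left[symmetric] by (subst sum.swap) simp
    finally show ?thesis .
  qed
  with that[of "c\<^sup>2 * real D" D] show thesis by simp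
qed

lemma matpow_commute_of_commute: "P ** M = M ** P \<Longrightarrow> P ** matpow M k = matpow M k ** P"
  by (induction k) (simp_all, metis matrix_mul_assoc)

lemma matrix_vector_mult_scaleR_complex: "M *v (c *\<^sub>R x) = c *\<^sub>R (M *v (x :: complex^'n))"
  unfolding complex_vector_scaleR[symmetric] by (rule matrix_vector_mult_vector_scalar)

lemma spectrum_0_invertible:
  assumes "0 \<notin> spectrum M"
  obtains M' where "M' ** M = mat 1" "M ** M' = mat 1"
proof -
  have "x = 0" if "M *v x = 0" for x :: "real^'a"
  proof (rule ccontr)
    assume x: "x \<noteq> 0"
    let ?x = "\<chi> i. complex_of_real (x $ i)"
    have "?x \<noteq> 0" using x by (simp add: vec_eq_iff)
    moreover have "cmatrix M *v ?x = 0 *s ?x"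
      using that by (simp add: complex_vec_eq_iff vRe_vIm_cmatrix) (simp add: vec_eq_iff matrix_vector_mult_def)
    ultimately show False using assms by (auto simp: spectrum_def)
  qed
  then obtain M' where "M' ** M = mat 1"
    using matrix_left_invertible_ker[of M] by blast
  then show thesis using that matrix_left_right_inverse by blast
qed

text \<open>Let \<open>a g + b h = 1\<close> be the Bezout identity for the splitting of the characteristic polynomial with \<open>g\<close>
carrying the unit circle.  Then \<open>Pr = (b h)(A)\<close> is the spectral projection, and in \<open>A Pr + (1 - Pr)\<close> the
remaining spectrum of \<open>A\<close> has been replaced by the eigenvalue \<open>1\<close>.\<close>

lemma unit_circle_projection:
  fixes A :: "real^'n^'n"
  obtains Pr where "Pr ** Pr = Pr" "Pr ** A = A ** Pr"
    "\<And>\<mu>. \<mu> \<in> spectrum (A ** Pr + (mat 1 - Pr)) \<Longrightarrow> cmod \<mu> = 1"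
    "\<And>\<mu> x. cmod \<mu> = 1 \<Longrightarrow> cmatrix A *v x = \<mu> *s x \<Longrightarrow> cmatrix Pr *v x = x"
proof -
  obtain g h a b where gh: "char_poly A = g * h" and bez: "a * g + b * h = 1"
    and g: "\<And>z. poly (cpoly g) z = 0 \<Longrightarrow> cmod z = 1"
    and h: "\<And>z. poly (cpoly h) z = 0 \<Longrightarrow> cmod z \<noteq> 1"
    using unit_circle_split[OF char_poly_neq_0[of A]] by blast
  define Pr where "Pr = poly_matrix (b * h) A"
  define Qr where "Qr = mat 1 - Pr"
  have Qr: "Qr = poly_matrix (a * g) A"
  proof -
    have "poly_matrix (a * g) A + Pr = mat 1"
      unfolding Pr_def poly_matrix_add[symmetric] bez by (rule poly_matrix_1)
    then show ?thesis by (simp add: Qr_def algebra_simps)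
  qed
  have gPr: "poly_matrix g A ** Pr = 0"
  proof -
    have "poly_matrix g A ** Pr = poly_matrix (g * (b * h)) A"
      by (simp only: Pr_def poly_matrix_mult)
    also have "g * (b * h) = b * char_poly A" by (simp add: gh mult_ac)
    finally show ?thesis by (simp add: poly_matrix_mult cayley_hamilton)
  qed
  have QrPr: "Qr ** Pr = 0"
    by (simp add: Qr poly_matrix_mult gPr flip: matrix_mul_assoc)
  then have PrPr: "Pr ** Pr = Pr"
    by (simp add: Qr_def matrix_sub_rdistrib)
  then have PrQr: "Pr ** Qr = 0"
    by (simp add: Qr_def matrix_sub_ldistrib)
  have PrA: "Pr ** A = A ** Pr" unfolding Pr_def by (rule poly_matrix_commute)
  define A1 where "A1 = A ** Pr + Qr"
  have PrA1: "Pr ** A1 = A ** Pr"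
    by (simp add: A1_def matrix_add_ldistrib matrix_mul_assoc PrA PrQr)
      (simp add: PrPr flip: matrix_mul_assoc)
  have specA1: "cmod \<mu> = 1" if \<mu>: "\<mu> \<in> spectrum A1" for \<mu>
  proof -
    obtain x where x: "x \<noteq> 0" "cmatrix A1 *v x = \<mu> *s x"
      using \<mu> by (auto simp: spectrum_def)
    let ?y = "cmatrix Pr *v x"
    have "cmatrix A *v ?y = cmatrix Pr *v (cmatrix A1 *v x)"
      by (simp only: matrix_vector_mul_assoc cmatrix_mult[symmetric] PrA1)
    then have y: "cmatrix A *v ?y = \<mu> *s ?y"
      by (simp only: x(2) matrix_vector_mult_vector_scalar)
    show ?thesis
    proof (cases "?y = 0")
      case True
      have "cmatrix A1 *v x = cmatrix A *v ?y + (x - ?y)"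
        by (simp add: A1_def Qr_def cmatrix_add cmatrix_diff cmatrix_mult cmatrix_mat
            matrix_vector_mult_add_rdistrib matrix_vector_mult_diff_rdistrib flip: matrix_vector_mul_assoc)
      then have "\<mu> *s x = 1 *s x" using True x(2) by simp
      then have "\<mu> = 1" using x(1) by (simp add: vec.scale_right_imp_eq)
      then show ?thesis by simp
    next
      case False
      have "poly (cpoly g) \<mu> *s ?y = cmatrix (poly_matrix g A) *v ?y"
        by (rule cmatrix_poly_matrix_eigenvector[OF y, symmetric])
      also have "\<dots> = cmatrix (poly_matrix g A ** Pr) *v x"
        by (simp only: matrix_vector_mul_assoc cmatrix_mult)
      also have "\<dots> = 0" by (simp add: gPr)
      finally have "poly (cpoly g) \<mu> = 0" using False by simp
      then show ?thesis by (rule g)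
    qed
  qed
  have fixed: "cmatrix Pr *v x = x" if \<mu>: "cmod \<mu> = 1" and x: "cmatrix A *v x = \<mu> *s x" for \<mu> x
  proof (cases "x = 0")
    case False
    then have "\<mu> \<in> spectrum A" using x by (auto simp: spectrum_def)
    then have "poly (cpoly (char_poly A)) \<mu> = 0" by (simp add: char_poly_root_iff)
    then have "poly (cpoly g) \<mu> = 0" using h \<mu> by (auto simp: gh cpoly_mult)
    moreover have "cmatrix Qr *v x = poly (cpoly (a * g)) \<mu> *s x"
      unfolding Qr by (rule cmatrix_poly_matrix_eigenvector[OF x])
    ultimately have "cmatrix Qr *v x = 0" by (simp add: cpoly_mult)
    then show ?thesis by (simp add: Qr_def cmatrix_diff cmatrix_mat matrix_vector_mult_diff_rdistrib)
  qed simp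
  show thesis
    by (rule that[OF PrPr PrA specA1[unfolded A1_def Qr_def] fixed])
qed

text \<open>The gramian is built from the inverse of \<open>A1\<close>.  The extra input \<open>1 - Pr\<close> makes it definite on the part of
the space that \<open>A1\<close> leaves alone; on the unit-circle part definiteness is the eigenvector test, applied to
the subspace of directions without energy.\<close>

lemma steering_gramian:
  fixes A Pr :: "real^'n^'n" and B :: "real^'m^'n"
  defines "A1 \<equiv> A ** Pr + (mat 1 - Pr)"
  assumes PrPr: "Pr ** Pr = Pr" and PrA: "Pr ** A = A ** Pr"
    and spec: "\<forall>\<mu>\<in>spectrum A1. cmod \<mu> = 1"
    and uncontrollable: "\<forall>\<mu> x. cmod \<mu> = 1 \<longrightarrow> x v* cmatrix A = \<mu> *s x \<longrightarrow> x v* cmatrix B = 0 \<longrightarrow> x = 0"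
    and \<delta>: "0 < \<delta>"
  obtains \<rho> W where "0 < \<rho>" "\<rho> < 1" "transpose W = W" "Pr ** W = W ** transpose Pr"
    "A1 ** W ** transpose A1 =
      \<rho> *\<^sub>R (W + ((Pr ** B) ** transpose (Pr ** B) + (mat 1 - Pr) ** transpose (mat 1 - Pr)))"
    "\<And>q. q \<noteq> 0 \<Longrightarrow> 0 < q \<bullet> (W *v q)"
    "\<And>q. (norm (q v* (Pr ** B)))\<^sup>2 \<le> \<delta> * (q \<bullet> (W *v q))"
proof -
  have specA1: "cmod \<mu> = 1" if "\<mu> \<in> spectrum A1" for \<mu> using spec that by blast
  have PBH: "x = 0" if "cmod \<mu> = 1" "x v* cmatrix A = \<mu> *s x" "x v* cmatrix B = 0" for \<mu> x
    using uncontrollable that by blast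
  define Qr where "Qr = mat 1 - Pr"
  have PrQr: "Pr ** Qr = 0" by (simp add: Qr_def matrix_sub_ldistrib PrPr)
  have QrPr: "Qr ** Pr = 0" by (simp add: Qr_def matrix_sub_rdistrib PrPr)
  have A1_eq: "A1 = A ** Pr + Qr" by (simp add: A1_def Qr_def)
  have comm1: "Pr ** A1 = A1 ** Pr"
    by (simp add: A1_eq matrix_add_ldistrib matrix_add_rdistrib matrix_mul_assoc PrA QrPr PrQr)
  have "0 \<notin> spectrum A1" using specA1 by fastforce
  then obtain Ai where Ai: "Ai ** A1 = mat 1" "A1 ** Ai = mat 1"
    by (rule spectrum_0_invertible)
  have comm2: "Pr ** Ai = Ai ** Pr"
  proof -
    have "Pr ** Ai = (Ai ** A1) ** Pr ** Ai" by (simp add: Ai)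
    also have "\<dots> = Ai ** (A1 ** Pr) ** Ai" by (simp only: matrix_mul_assoc)
    also have "\<dots> = Ai ** (Pr ** A1) ** Ai" by (simp only: comm1)
    also have "\<dots> = Ai ** Pr ** (A1 ** Ai)" by (simp only: matrix_mul_assoc)
    finally show ?thesis by (simp add: Ai)
  qed
  have specAi: "\<forall>\<mu>\<in>spectrum Ai. cmod \<mu> = 1"
  proof
    fix \<mu> assume "\<mu> \<in> spectrum Ai"
    then obtain x where x: "x \<noteq> 0" "cmatrix Ai *v x = \<mu> *s x"
      by (auto simp: spectrum_def)
    have "x = cmatrix A1 *v (cmatrix Ai *v x)"
      by (simp add: matrix_vector_mul_assoc cmatrix_mult[symmetric] Ai cmatrix_mat)
    then have eq: "x = \<mu> *s (cmatrix A1 *v x)"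
      by (simp only: x(2) matrix_vector_mult_vector_scalar)
    then have \<mu>0: "\<mu> \<noteq> 0" using x(1) by auto
    have "cmatrix A1 *v x = inverse \<mu> *s x"
      by (subst (2) eq) (simp add: vector_smult_assoc \<mu>0)
    then have "inverse \<mu> \<in> spectrum A1" using x(1) by (auto simp: spectrum_def)
    then have "cmod (inverse \<mu>) = 1" by (rule specA1)
    then show "cmod \<mu> = 1" by (simp add: norm_inverse)
  qed
  define B1 where "B1 = Pr ** B"
  define N where "N = B1 ** transpose B1 + Qr ** transpose Qr"
  have N_vec: "x \<bullet> (N *v y) = (x v* B1) \<bullet> (y v* B1) + (x v* Qr) \<bullet> (y v* Qr)" for x y
    by (simp add: N_def matrix_vector_mult_add_rdistrib inner_add_right dot_lmul_matrix
        flip: matrix_vector_mul_assoc)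
  have N_sym: "transpose N = N"
    by (simp add: N_def transpose_add matrix_transpose_mul)
  have N_pos: "0 \<le> x \<bullet> (N *v x)" for x by (simp add: N_vec)
  have PrN: "Pr ** N = N ** transpose Pr"
  proof -
    have 1: "Pr ** B1 = B1" by (simp add: B1_def matrix_mul_assoc PrPr)
    then have 2: "transpose B1 ** transpose Pr = transpose B1" by (simp flip: matrix_transpose_mul)
    have 3: "transpose Qr ** transpose Pr = 0"
      using PrQr by (simp flip: matrix_transpose_mul) (simp add: vec_eq_iff transpose_def)
    have "Pr ** N = B1 ** transpose B1"
      by (simp add: N_def matrix_add_ldistrib matrix_mul_assoc 1 PrQr)
    moreover have "N ** transpose Pr = B1 ** transpose B1"
      by (simp add: N_def matrix_add_rdistrib 2 3 flip: matrix_mul_assoc)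
    ultimately show ?thesis by simp
  qed
  obtain c D where c: "0 \<le> c" and energy: "\<And>L q. 1 \<le> L \<Longrightarrow> (norm (q v* B1))\<^sup>2 \<le>
      c / real L * (\<Sum>k=1..D * L. (norm ((q v* matpow Ai k) v* B1))\<^sup>2)"
    using input_energy_small[OF specAi, of B1] by blast
  \<comment> \<open>The window L brings the mean value factor below \<open>\<delta> / 2\<close>; discounting over the window then loses at most
    a factor 2.\<close>
  obtain L :: nat where L: "1 \<le> L" "2 * c / \<delta> \<le> real L"
  proof -
    obtain L :: nat where "2 * c / \<delta> \<le> real L" by (meson real_arch_simple)
    then show thesis using that[of "Suc L"] by simp
  qed
  obtain \<rho> :: real where \<rho>: "0 < \<rho>" "\<rho> < 1" "1 / 2 \<le> \<rho> ^ (D * L)"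
  proof -
    have "((\<lambda>\<rho>::real. \<rho> ^ (D * L)) \<longlongrightarrow> 1 ^ (D * L)) (at_left 1)"
      by (intro tendsto_intros)
    then have "\<forall>\<^sub>F \<rho> in at_left (1::real). 1 / 2 < \<rho> ^ (D * L)"
      by (rule order_tendstoD) simp
    moreover have "\<forall>\<^sub>F \<rho> in at_left (1::real). \<rho> \<in> {0<..<1}"
      by (rule eventually_at_leftI[of 0]) auto
    ultimately have "\<forall>\<^sub>F \<rho> in at_left (1::real). 1 / 2 < \<rho> ^ (D * L) \<and> \<rho> \<in> {0<..<1}"
      by (rule eventually_conj)
    then obtain \<rho> :: real where "1 / 2 < \<rho> ^ (D * L) \<and> \<rho> \<in> {0<..<1}"
      using eventually_happens trivial_limit_at_left_real by blast
    then show thesis using that[of \<rho>] by auto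
  qed
  have specAi1: "\<forall>\<mu>\<in>spectrum Ai. cmod \<mu> \<le> 1" using specAi by simp
  obtain W where W: "transpose W = W" "W = \<rho> *\<^sub>R (Ai ** (W + N) ** transpose Ai)"
    "Pr ** W = W ** transpose Pr"
    "\<And>x k. (\<Sum>j=1..k. \<rho> ^ j * ((x v* matpow Ai j) \<bullet> (N *v (x v* matpow Ai j)))) \<le> x \<bullet> (W *v x)"
    using discounted_gramian[OF specAi1 \<rho>(1,2) N_sym N_pos comm2 PrN] by blast
  have AWA: "A1 ** W ** transpose A1 = \<rho> *\<^sub>R (W + N)"
  proof -
    have AiT: "transpose Ai ** transpose A1 = mat 1"
      using Ai by (simp flip: matrix_transpose_mul)
    have "A1 ** W ** transpose A1 = \<rho> *\<^sub>R ((A1 ** Ai) ** (W + N) ** (transpose Ai ** transpose A1))"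
      by (rule trans[OF arg_cong[where f = "\<lambda>X. A1 ** X ** transpose A1", OF W(2)]])
        (simp only: matrix_scaleR_left matrix_scaleR_right matrix_mul_assoc)
    then show ?thesis by (simp add: Ai AiT)
  qed
  have W_small: "(norm (q v* B1))\<^sup>2 \<le> \<delta> * (q \<bullet> (W *v q))" for q
  proof -
    let ?s = "\<Sum>k=1..D * L. (norm ((q v* matpow Ai k) v* B1))\<^sup>2"
    have "?s / 2 \<le> q \<bullet> (W *v q)"
    proof -
      have "?s / 2 = (\<Sum>k=1..D * L. 1 / 2 * (norm ((q v* matpow Ai k) v* B1))\<^sup>2)"
        by (simp add: sum_divide_distrib)
      also have "\<dots> \<le> (\<Sum>k=1..D * L. \<rho> ^ k * ((q v* matpow Ai k) \<bullet> (N *v (q v* matpow Ai k))))"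
      proof (intro sum_mono mult_mono)
        fix k assume "k \<in> {1..D * L}"
        then have "\<rho> ^ (D * L) \<le> \<rho> ^ k" using \<rho> by (intro power_decreasing) auto
        then show "1 / 2 \<le> \<rho> ^ k" using \<rho>(3) by linarith
        show "(norm ((q v* matpow Ai k) v* B1))\<^sup>2 \<le> (q v* matpow Ai k) \<bullet> (N *v (q v* matpow Ai k))"
          by (simp add: N_vec power2_norm_eq_inner)
      qed (use \<rho> in auto)
      also have "\<dots> \<le> q \<bullet> (W *v q)" by (rule W(4))
      finally show ?thesis .
    qed
    then have "?s \<le> 2 * (q \<bullet> (W *v q))" by simp
    moreover have "0 \<le> c / real L" using c by simp
    ultimately have "c / real L * ?s \<le> c / real L * (2 * (q \<bullet> (W *v q)))" by (rule mult_left_mono)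
    with energy[OF L(1), of q] have "(norm (q v* B1))\<^sup>2 \<le> c / real L * (2 * (q \<bullet> (W *v q)))"
      by linarith
    also have "\<dots> = (2 * c / real L) * (q \<bullet> (W *v q))" by simp
    also have "\<dots> \<le> \<delta> * (q \<bullet> (W *v q))"
    proof (rule mult_right_mono)
      show "2 * c / real L \<le> \<delta>" using L \<delta> by (simp add: field_simps)
      show "0 \<le> q \<bullet> (W *v q)" using W(4)[of q 0] by simp
    qed
    finally show ?thesis .
  qed
  have W_ker: "q = 0" if q: "q \<bullet> (W *v q) \<le> 0" for q
  proof (rule ccontr)
    assume "q \<noteq> 0"
    \<comment> \<open>the directions in which W has no energy, complexified\<close>
    define V where "V = {y. \<forall>j. (y v* matpow (cmatrix Ai) (Suc j)) v* cmatrix B1 = 0 \<and>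
        (y v* matpow (cmatrix Ai) (Suc j)) v* cmatrix Qr = 0}"
    have cpow: "matpow (cmatrix Ai) j = cmatrix (matpow Ai j)" for j
      by (induction j) (simp_all add: cmatrix_mult cmatrix_mat)
    let ?q = "\<chi> i. complex_of_real (q $ i)"
    have vq: "vRe ?q = q" "vIm ?q = 0" by (simp_all add: vec_eq_iff)
    have "?q \<in> V"
    proof -
      have "(q v* matpow Ai (Suc j)) v* B1 = 0 \<and> (q v* matpow Ai (Suc j)) v* Qr = 0" for j
      proof -
        let ?t = "\<lambda>j. \<rho> ^ j * ((q v* matpow Ai j) \<bullet> (N *v (q v* matpow Ai j)))"
        have "?t (Suc j) \<le> (\<Sum>j=1..Suc j. ?t j)"
          using \<rho> N_pos by (intro member_le_sum) auto
        also have "\<dots> \<le> 0" using W(4)[where x = q and k = "Suc j"] q by linarith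
        finally have "(q v* matpow Ai (Suc j)) \<bullet> (N *v (q v* matpow Ai (Suc j))) \<le> 0"
          using zero_less_power[OF \<rho>(1), of "Suc j"] by (metis mult_pos_pos not_le)
        then show ?thesis
          unfolding N_vec by (metis add_nonneg_eq_0_iff inner_eq_zero_iff inner_ge_zero order_antisym add_nonneg_nonneg)
      qed
      then show ?thesis
        by (simp add: V_def cpow complex_vec_eq_iff vRe_vIm_cmatrix_left vq del: matpow.simps)
    qed
    moreover have "?q \<noteq> 0" using \<open>q \<noteq> 0\<close> by (simp add: vec_eq_iff)
    moreover have "x + y \<in> V" if "x \<in> V" "y \<in> V" for x y
      using that by (simp add: V_def vector_matrix_left_distrib del: matpow.simps)
    moreover have "c *s x \<in> V" if "x \<in> V" for c x
      using that by (simp add: V_def vector_scalar_matrix del: matpow.simps)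
    moreover have "transpose (cmatrix Ai) *v x \<in> V" if "x \<in> V" for x
    proof -
      have "(x v* cmatrix Ai) v* matpow (cmatrix Ai) (Suc j) = x v* matpow (cmatrix Ai) (Suc (Suc j))" for j
        by (simp add: vector_matrix_mul_assoc)
      then show ?thesis using that by (simp add: V_def del: matpow.simps)
    qed
    ultimately obtain \<mu> y where y: "y \<in> V" "y \<noteq> 0" "transpose (cmatrix Ai) *v y = \<mu> *s y"
      using invariant_eigenvector[of V "transpose (cmatrix Ai)" ?q] by metis
    have yA: "y v* cmatrix Ai = \<mu> *s y" using y(3) by simp
    have "\<mu> \<in> spectrum Ai" using left_spectrum[OF y(2) yA] .
    then have \<mu>: "cmod \<mu> = 1" using specAi by blast
    then have \<mu>0: "\<mu> \<noteq> 0" by auto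
    have "(y v* matpow (cmatrix Ai) (Suc 0)) v* cmatrix B1 = 0"
      "(y v* matpow (cmatrix Ai) (Suc 0)) v* cmatrix Qr = 0"
      using y(1) unfolding V_def by blast+
    then have yB: "y v* cmatrix B1 = 0" and yQr: "y v* cmatrix Qr = 0"
      using \<mu>0 by (simp_all add: yA vector_scalar_matrix)
    have yPr: "y v* cmatrix Pr = y"
    proof -
      have "Pr = mat 1 - Qr" by (simp add: Qr_def)
      then show ?thesis using yQr by (simp add: cmatrix_diff cmatrix_mat vector_matrix_mult_diff_rdistrib)
    qed
    have "y = (y v* cmatrix Ai) v* cmatrix A1"
      by (simp add: vector_matrix_mul_assoc cmatrix_mult[symmetric] Ai cmatrix_mat)
    then have "y = \<mu> *s (y v* cmatrix A1)" by (simp add: yA vector_scalar_matrix)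
    also have "y v* cmatrix A1 = y v* cmatrix A"
    proof -
      have "A1 = Pr ** A + Qr" by (simp add: A1_eq PrA)
      then have "y v* cmatrix A1 = (y v* cmatrix Pr) v* cmatrix A + y v* cmatrix Qr"
        by (simp add: cmatrix_add cmatrix_mult vector_matrix_mult_add_rdistrib vector_matrix_mul_assoc)
      then show ?thesis by (simp add: yQr yPr)
    qed
    finally have eq: "y = \<mu> *s (y v* cmatrix A)" .
    have "y v* cmatrix A = inverse \<mu> *s y"
      by (subst (2) eq) (simp add: vector_smult_assoc \<mu>0)
    moreover have "y v* cmatrix B = 0"
      using yB by (simp add: B1_def cmatrix_mult yPr flip: vector_matrix_mul_assoc)
    ultimately show False using PBH[of "inverse \<mu>" y] \<mu> y(2) by (simp add: norm_inverse)
  qed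
  have W_pos: "0 < q \<bullet> (W *v q)" if "q \<noteq> 0" for q
    using W_ker[of q] that by fastforce
  show thesis
    by (rule that[OF \<rho>(1,2) W(1,3) AWA[unfolded N_def B1_def Qr_def] W_pos W_small[unfolded B1_def]])
qed

text \<open>For \<open>q = P A y\<close> the number \<open>V(A y)\<close> equals both \<open>q \<bullet> W q\<close> and \<open>A\<^sup>T q \<bullet> y\<close>.  Young's inequality in the form
\<open>2 \<rho> (p \<bullet> y) \<le> p \<bullet> W p + \<rho>\<^sup>2 V(y)\<close> with \<open>p = A\<^sup>T q\<close>, together with the equation of \<open>W\<close>, gives the
contraction; it is the positivity of \<open>V\<close> at \<open>W p - \<rho> y\<close>.\<close>

lemma gramian_contraction:
  fixes A W Q :: "real^'n^'n" and B :: "real^'m^'n"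
  assumes W_sym: "transpose W = W" and \<rho>: "0 < \<rho>"
    and AWA: "A ** W ** transpose A = \<rho> *\<^sub>R (W + (B ** transpose B + Q ** transpose Q))"
    and W_pos: "\<And>q. q \<noteq> 0 \<Longrightarrow> 0 < q \<bullet> (W *v q)"
    and W_small: "\<And>q. (norm (q v* B))\<^sup>2 \<le> \<delta> * (q \<bullet> (W *v q))"
  obtains P where "W ** P = mat 1" "P ** W = mat 1" "transpose P = P"
    "\<And>y. y \<noteq> 0 \<Longrightarrow> 0 < y \<bullet> (cmatrix P *v y)"
    "\<And>y. (norm ((cmatrix P *v y) v* cmatrix B))\<^sup>2 \<le> \<delta> * (y \<bullet> (cmatrix P *v y))"
    "\<And>y. (cmatrix A *v y) \<bullet> (cmatrix P *v (cmatrix A *v y)) \<le> \<rho> * (y \<bullet> (cmatrix P *v y))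
      + (norm ((cmatrix P *v (cmatrix A *v y)) v* cmatrix B))\<^sup>2
      + (norm ((cmatrix P *v (cmatrix A *v y)) v* cmatrix Q))\<^sup>2"
proof -
  obtain P where PW: "P ** W = mat 1"
  proof -
    have "q = 0" if "W *v q = 0" for q using W_pos[of q] that by fastforce
    then show thesis using that matrix_left_invertible_ker[of W] by blast
  qed
  then have WP: "W ** P = mat 1" using matrix_left_right_inverse by blast
  have P_sym: "transpose P = P"
  proof -
    have "transpose P = transpose P ** (W ** P)" by (simp add: WP)
    also have "\<dots> = transpose (W ** P) ** P"
      by (simp add: matrix_transpose_mul W_sym matrix_mul_assoc)
    finally show ?thesis by (simp add: WP)
  qed
  let ?P = "cmatrix P" and ?W = "cmatrix W" and ?A = "cmatrix A"
  have adj: "(?P *v x) \<bullet> y = x \<bullet> (?P *v y)" for x y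
    by (metis P_sym cmatrix_adjoint cmatrix_transpose transpose_matrix_vector)
  have WPv: "?W *v (?P *v y) = y" for y
    by (simp add: matrix_vector_mul_assoc cmatrix_mult[symmetric] WP cmatrix_mat)
  have PWv: "?P *v (?W *v y) = y" for y
    by (simp add: matrix_vector_mul_assoc cmatrix_mult[symmetric] PW cmatrix_mat)
  have W_real: "y \<bullet> (?W *v y) = vRe y \<bullet> (W *v vRe y) + vIm y \<bullet> (W *v vIm y)" for y
    by (simp add: complex_vec_inner vRe_vIm_cmatrix)
  have Wpos: "0 < y \<bullet> (?W *v y)" if "y \<noteq> 0" for y
  proof -
    have "vRe y \<noteq> 0 \<or> vIm y \<noteq> 0" using that by (auto simp: complex_vec_eq_iff)
    moreover have "0 \<le> v \<bullet> (W *v v)" for v using W_pos[of v] by (cases "v = 0") auto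
    ultimately show ?thesis unfolding W_real using W_pos by (metis add_nonneg_pos add_pos_nonneg)
  qed
  have PV: "y \<bullet> (?P *v y) = (?P *v y) \<bullet> (?W *v (?P *v y))" for y
    by (simp add: WPv inner_commute)
  have Ppos: "0 < y \<bullet> (?P *v y)" if "y \<noteq> 0" for y
  proof -
    have "?P *v y \<noteq> 0" using that WPv[of y] by auto
    then show ?thesis unfolding PV by (rule Wpos)
  qed
  have small: "(norm ((?P *v y) v* cmatrix B))\<^sup>2 \<le> \<delta> * (y \<bullet> (?P *v y))" for y
  proof -
    let ?q = "?P *v y"
    have "(norm (?q v* cmatrix B))\<^sup>2 = (norm (vRe ?q v* B))\<^sup>2 + (norm (vIm ?q v* B))\<^sup>2"
      by (simp add: power2_norm_eq_inner complex_vec_inner vRe_vIm_cmatrix_left)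
    also have "\<dots> \<le> \<delta> * (vRe ?q \<bullet> (W *v vRe ?q)) + \<delta> * (vIm ?q \<bullet> (W *v vIm ?q))"
      by (intro add_mono W_small)
    also have "\<dots> = \<delta> * (y \<bullet> (?P *v y))" by (simp add: PV W_real algebra_simps)
    finally show ?thesis .
  qed
  have contract: "(?A *v y) \<bullet> (?P *v (?A *v y)) \<le> \<rho> * (y \<bullet> (?P *v y))
      + (norm ((?P *v (?A *v y)) v* cmatrix B))\<^sup>2 + (norm ((?P *v (?A *v y)) v* cmatrix Q))\<^sup>2" for y
  proof -
    define q where "q = ?P *v (?A *v y)"
    define p where "p = q v* ?A"
    have Wq: "?W *v q = ?A *v y" by (simp add: q_def WPv)
    let ?n = "(norm (q v* cmatrix B))\<^sup>2 + (norm (q v* cmatrix Q))\<^sup>2"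
    have pWp: "p \<bullet> (?W *v p) = \<rho> * (q \<bullet> (?W *v q) + ?n)"
    proof -
      let ?N = "B ** transpose B + Q ** transpose Q"
      have N_vec: "x \<bullet> (?N *v x) = (x v* B) \<bullet> (x v* B) + (x v* Q) \<bullet> (x v* Q)" for x
        by (simp add: matrix_vector_mult_add_rdistrib inner_add_right dot_lmul_matrix
            flip: matrix_vector_mul_assoc)
      have "p \<bullet> (?W *v p) = q \<bullet> (cmatrix (A ** W ** transpose A) *v q)"
        by (simp add: p_def cmatrix_adjoint cmatrix_mult cmatrix_transpose flip: matrix_vector_mul_assoc)
      also have "\<dots> = \<rho> * (q \<bullet> (?W *v q) + q \<bullet> (cmatrix ?N *v q))"
      proof -
        have "cmatrix (\<rho> *\<^sub>R (W + ?N)) *v q = \<rho> *\<^sub>R (?W *v q + cmatrix ?N *v q)"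
          by (simp only: complex_vec_eq_iff vRe_vIm_cmatrix vRe_vIm_add vRe_vIm_scaleR
              matrix_vector_mult_add_rdistrib[of W] scaleR_matrix_vector_assoc[symmetric])
        then show ?thesis by (simp add: AWA inner_add_right)
      qed
      also have "q \<bullet> (cmatrix ?N *v q) = ?n"
        by (simp only: complex_vec_inner power2_norm_eq_inner vRe_vIm_cmatrix vRe_vIm_cmatrix_left
            N_vec)
      finally show ?thesis .
    qed
    have py: "p \<bullet> y = q \<bullet> (?W *v q)" by (simp add: p_def cmatrix_adjoint Wq)
    define v where "v = ?W *v p - \<rho> *\<^sub>R y"
    have "0 \<le> v \<bullet> (?P *v v)" using Ppos[of v] by (cases "v = 0") auto
    also have "v \<bullet> (?P *v v) = p \<bullet> (?W *v p) - 2 * \<rho> * (p \<bullet> y) + \<rho> * \<rho> * (y \<bullet> (?P *v y))"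
    proof -
      have Pv: "?P *v v = p - \<rho> *\<^sub>R (?P *v y)"
        by (simp add: v_def matrix_vector_mult_diff_distrib PWv matrix_vector_mult_scaleR_complex)
      have "(?W *v p) \<bullet> (?P *v y) = p \<bullet> y"
        by (metis PWv adj)
      then show ?thesis
        unfolding Pv by (simp add: v_def inner_diff_left inner_diff_right algebra_simps inner_commute)
    qed
    finally have "0 \<le> \<rho> * (?n + \<rho> * (y \<bullet> (?P *v y)) - q \<bullet> (?W *v q))"
      unfolding pWp py by (simp add: algebra_simps)
    then have "q \<bullet> (?W *v q) \<le> \<rho> * (y \<bullet> (?P *v y)) + ?n"
      using \<rho> by (simp add: zero_le_mult_iff)
    then show ?thesis unfolding Wq by (simp add: q_def inner_commute)
  qed
  show thesis by (rule that[OF WP PW P_sym Ppos small contract])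
qed

text \<open>The feedback sees only the unit-circle part \<open>Pr x\<close>, and on the range of \<open>Pr\<close> the extra input \<open>1 - Pr\<close> of the
gramian does not contribute to the contraction estimate; so \<open>low_gain_mode_vanishes\<close> gives \<open>Pr x = 0\<close> for
every unstable mode \<open>x\<close>.  Such a mode feels no feedback and would be an eigenvector of \<open>A\<close> with an eigenvalue
on the unit circle, but those are fixed by \<open>Pr\<close>.  In the application \<open>\<Lambda>\<close> is the spectrum of the network.\<close>

lemma low_gain_feedback:
  fixes A :: "real^'n^'n" and B :: "real^'m^'n" and \<Lambda> :: "complex set"
  assumes \<Lambda>: "finite \<Lambda>" "\<And>\<mu>. \<mu> \<in> \<Lambda> \<Longrightarrow> 0 < Re \<mu>"
    and spec: "\<And>\<mu>. \<mu> \<in> spectrum A \<Longrightarrow> cmod \<mu> \<le> 1"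
    and PBH: "\<And>\<mu> x. cmod \<mu> = 1 \<Longrightarrow> x v* cmatrix A = \<mu> *s x \<Longrightarrow> x v* cmatrix B = 0 \<Longrightarrow> x = 0"
  shows "\<exists>K. \<forall>\<mu>\<in>\<Lambda>. \<forall>z x. 1 \<le> cmod z \<longrightarrow>
    z *s x = cmatrix A *v x + (\<mu> * inverse z ^ r) *s (cmatrix B *v (cmatrix K *v x)) \<longrightarrow> x = 0"
proof -
  obtain Pr where PrPr: "Pr ** Pr = Pr" and PrA: "Pr ** A = A ** Pr"
    and specA1: "\<And>\<mu>. \<mu> \<in> spectrum (A ** Pr + (mat 1 - Pr)) \<Longrightarrow> cmod \<mu> = 1"
    and fixed: "\<And>\<mu> x. cmod \<mu> = 1 \<Longrightarrow> cmatrix A *v x = \<mu> *s x \<Longrightarrow> cmatrix Pr *v x = x"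
    using unit_circle_projection by blast
  define Qr where "Qr = mat 1 - Pr"
  define A1 where "A1 = A ** Pr + Qr"
  define B1 where "B1 = Pr ** B"
  have PrQr: "Pr ** Qr = 0" by (simp add: Qr_def matrix_sub_ldistrib PrPr)
  have QrPr: "Qr ** Pr = 0" by (simp add: Qr_def matrix_sub_rdistrib PrPr)
  have PrA1: "Pr ** A1 = A ** Pr" and A1Pr: "A1 ** Pr = A ** Pr"
    by (simp_all add: A1_def matrix_add_ldistrib matrix_add_rdistrib matrix_mul_assoc PrA QrPr PrQr)
      (simp_all add: PrPr flip: matrix_mul_assoc)
  have comm1: "Pr ** A1 = A1 ** Pr" by (simp add: PrA1 A1Pr)
  \<comment> \<open>The factor \<nu> makes the feedback dominate for every \<mu>; the bound \<delta> on the input energy depends on \<Lambda>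
    and r only, and \<rho> is chosen afterwards.\<close>
  obtain \<nu> where \<nu>: "0 \<le> \<nu>" "\<And>\<mu>. \<mu> \<in> \<Lambda> \<Longrightarrow> 1 \<le> \<nu> * Re \<mu>"
  proof
    let ?\<nu> = "\<Sum>\<mu>\<in>\<Lambda>. 1 / Re \<mu>"
    show "0 \<le> ?\<nu>" using \<Lambda>(2) by (intro sum_nonneg) (simp add: less_imp_le)
    show "1 \<le> ?\<nu> * Re \<mu>" if "\<mu> \<in> \<Lambda>" for \<mu>
    proof -
      have "1 / Re \<mu> \<le> ?\<nu>"
        using that \<Lambda> by (intro member_le_sum) (auto simp: less_imp_le)
      then show ?thesis using \<Lambda>(2)[OF that] by (simp add: field_simps)
    qed
  qed
  define l where "l = (\<Sum>\<mu>\<in>\<Lambda>. \<nu> * cmod \<mu>)"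
  have l: "\<nu> * cmod \<mu> \<le> l" if "\<mu> \<in> \<Lambda>" for \<mu>
    unfolding l_def using that \<Lambda>(1) \<nu>(1) by (intro member_le_sum) auto
  have l0: "0 \<le> l" unfolding l_def using \<nu>(1) by (intro sum_nonneg) auto
  obtain \<delta> :: real where \<delta>: "0 < \<delta>" "\<delta> \<le> 1 / 2"
    "l * (real r * 2 ^ r * \<delta>) \<le> 1 / 2" "4 * l\<^sup>2 * ((real r * 2 ^ r + 1) * \<delta>) \<le> 1"
  proof
    let ?q = "2 + 2 * l * (real r * 2 ^ r) + 4 * l\<^sup>2 * (real r * 2 ^ r + 1)"
    let ?\<delta> = "1 / ?q"
    have t: "0 \<le> 2 * l * (real r * 2 ^ r)" "0 \<le> 4 * l\<^sup>2 * (real r * 2 ^ r + 1)" using l0 by simp_all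
    then have q: "0 < ?q" by linarith
    then show "0 < ?\<delta>" by simp
    show "?\<delta> \<le> 1 / 2" using t q by (simp add: divide_simps)
    show "l * (real r * 2 ^ r * ?\<delta>) \<le> 1 / 2" using t q by (simp add: divide_simps)
    show "4 * l\<^sup>2 * ((real r * 2 ^ r + 1) * ?\<delta>) \<le> 1" using t q by (simp add: divide_simps)
  qed
  have spec1: "\<forall>\<mu>\<in>spectrum (A ** Pr + (mat 1 - Pr)). cmod \<mu> = 1" using specA1 by blast
  have uncontrollable: "\<forall>\<mu> x. cmod \<mu> = 1 \<longrightarrow> x v* cmatrix A = \<mu> *s x \<longrightarrow> x v* cmatrix B = 0 \<longrightarrow> x = 0"
    using PBH by blast
  obtain W \<rho> where \<rho>: "0 < \<rho>" "\<rho> < 1" and W: "transpose W = W" "Pr ** W = W ** transpose Pr"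
    "A1 ** W ** transpose A1 = \<rho> *\<^sub>R (W + (B1 ** transpose B1 + Qr ** transpose Qr))"
    "\<And>q. q \<noteq> 0 \<Longrightarrow> 0 < q \<bullet> (W *v q)" "\<And>q. (norm (q v* B1))\<^sup>2 \<le> \<delta> * (q \<bullet> (W *v q))"
    using steering_gramian[OF PrPr PrA spec1 uncontrollable \<delta>(1), folded Qr_def,
        folded A1_def B1_def] by blast
  obtain P where WP: "W ** P = mat 1" and PW: "P ** W = mat 1" and P_sym: "transpose P = P"
    and Ppos: "\<And>y. y \<noteq> 0 \<Longrightarrow> 0 < y \<bullet> (cmatrix P *v y)"
    and small: "\<And>y. (norm ((cmatrix P *v y) v* cmatrix B1))\<^sup>2 \<le> \<delta> * (y \<bullet> (cmatrix P *v y))"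
    and contract: "\<And>y. (cmatrix A1 *v y) \<bullet> (cmatrix P *v (cmatrix A1 *v y)) \<le> \<rho> * (y \<bullet> (cmatrix P *v y))
      + (norm ((cmatrix P *v (cmatrix A1 *v y)) v* cmatrix B1))\<^sup>2
      + (norm ((cmatrix P *v (cmatrix A1 *v y)) v* cmatrix Qr))\<^sup>2"
    using gramian_contraction[OF W(1) \<rho>(1) W(3-5)] by blast
  have PPr: "P ** Pr = transpose Pr ** P"
  proof -
    have "P ** Pr = P ** (Pr ** W) ** P" by (simp add: WP flip: matrix_mul_assoc)
    also have "\<dots> = (P ** W) ** transpose Pr ** P" by (simp add: W(2) matrix_mul_assoc)
    finally show ?thesis by (simp add: PW)
  qed
  define K where "K = - \<nu> *\<^sub>R (transpose B1 ** P ** matpow A1 (Suc r))"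
  have KQr: "K ** Qr = 0"
  proof -
    have "Pr ** matpow A1 (Suc r) = matpow A1 (Suc r) ** Pr"
      by (rule matpow_commute_of_commute[OF comm1])
    then have 1: "matpow A1 (Suc r) ** Qr = Qr ** matpow A1 (Suc r)"
      by (simp add: Qr_def matrix_sub_ldistrib matrix_sub_rdistrib del: matpow.simps)
    have "transpose B1 ** P = transpose B ** (transpose Pr ** P)"
      by (simp add: B1_def matrix_transpose_mul matrix_mul_assoc)
    then have "transpose B1 ** P ** Qr = transpose B ** P ** (Pr ** Qr)"
      by (simp add: matrix_mul_assoc flip: PPr)
    then have "transpose B1 ** P ** Qr = 0" by (simp add: PrQr)
    then have "transpose B1 ** P ** (Qr ** matpow A1 (Suc r)) = 0"
      by (simp add: matrix_mul_assoc del: matpow.simps)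
    then have "transpose B1 ** P ** matpow A1 (Suc r) ** Qr = 0"
      by (simp only: 1 matrix_mul_assoc[symmetric])
    then show ?thesis by (simp only: K_def matrix_scaleR_left scaleR_zero_right)
  qed
  have "x = 0" if \<mu>: "\<mu> \<in> \<Lambda>" and z: "1 \<le> cmod z"
    and x: "z *s x = cmatrix A *v x + (\<mu> * inverse z ^ r) *s (cmatrix B *v (cmatrix K *v x))"
    for \<mu> z x
  proof -
    let ?A = "cmatrix A1" and ?P = "cmatrix P" and ?B = "cmatrix B1"
      and ?Bt = "cmatrix (transpose B1)" and ?Pr = "cmatrix Pr"
    define x' where "x' = ?Pr *v x"
    have Kx': "cmatrix K *v x' = cmatrix K *v x"
    proof -
      have "K ** Pr = K" using KQr by (simp add: Qr_def matrix_sub_ldistrib)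
      then show ?thesis by (simp add: x'_def matrix_vector_mul_assoc flip: cmatrix_mult)
    qed
    define u where "u = (\<mu> * inverse z ^ r) *s (cmatrix K *v x)"
    have "x' = 0"
    proof (rule low_gain_mode_vanishes[where A = ?A and P = ?P and B = ?B and Bt = ?Bt and X = "{y. ?Pr *v y = y}"
          and \<omega> = "inverse z ^ r" and u = u])
      show "(?Bt *v y) \<bullet> u = y \<bullet> (?B *v u)" for y u
        by (simp add: cmatrix_transpose cmatrix_adjoint)
      show "(?P *v x) \<bullet> y = x \<bullet> (?P *v y)" for x y
        by (metis P_sym cmatrix_adjoint cmatrix_transpose transpose_matrix_vector)
      show "0 < y \<bullet> (?P *v y)" if "y \<noteq> 0" for y using that by (rule Ppos)
      show "?A *v y \<in> {y. ?Pr *v y = y}" if "y \<in> {y. ?Pr *v y = y}" for y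
      proof -
        have "?Pr *v (?A *v y) = ?A *v (?Pr *v y)"
          by (simp only: matrix_vector_mul_assoc cmatrix_mult[symmetric] comm1)
        then show ?thesis using that by simp
      qed
      show "?B *v u \<in> {y. ?Pr *v y = y}" for u
        by (simp add: matrix_vector_mul_assoc cmatrix_mult[symmetric] B1_def matrix_mul_assoc PrPr)
      show "(norm (?Bt *v (?P *v y)))\<^sup>2 \<le> \<delta> * (y \<bullet> (?P *v y))" for y
        using small by (simp add: cmatrix_transpose)
      show "(?A *v y) \<bullet> (?P *v (?A *v y)) \<le> \<rho> * (y \<bullet> (?P *v y)) + (norm (?Bt *v (?P *v (?A *v y))))\<^sup>2"
        if "y \<in> {y. ?Pr *v y = y}" for y
      proof -
        have y: "?Pr *v y = y" using that by simp
        define q where "q = ?P *v (?A *v y)"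
        have qQr: "q v* cmatrix Qr = 0"
        proof -
          have "q v* ?Pr = cmatrix (transpose Pr ** P) *v (?A *v y)"
            by (simp add: q_def cmatrix_mult cmatrix_transpose flip: matrix_vector_mul_assoc)
          also have "\<dots> = cmatrix (P ** (Pr ** A1)) *v y"
            by (simp only: PPr[symmetric] matrix_vector_mul_assoc cmatrix_mult matrix_mul_assoc)
          also have "\<dots> = ?P *v (?A *v (?Pr *v y))"
            by (simp only: comm1 matrix_vector_mul_assoc cmatrix_mult matrix_mul_assoc)
          also have "\<dots> = q" by (simp only: y q_def)
          finally show ?thesis
            by (simp add: Qr_def cmatrix_diff cmatrix_mat vector_matrix_mult_diff_rdistrib)
        qed
        then show ?thesis using contract[of y] by (simp add: q_def cmatrix_transpose)
      qed
      show "0 \<le> \<rho>" "\<rho> < 1" using \<rho> by auto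
      show "0 \<le> \<delta>" "\<delta> \<le> 1 / 2" "l * (real r * 2 ^ r * \<delta>) \<le> 1 / 2"
        "4 * l\<^sup>2 * ((real r * 2 ^ r + 1) * \<delta>) \<le> 1" using \<delta> by auto
      show "0 \<le> \<nu>" "1 \<le> \<nu> * Re \<mu>" "\<nu> * cmod \<mu> \<le> l" using \<nu> \<mu> l by auto
      show "1 \<le> cmod z" by (rule z)
      have "z \<noteq> 0" using z by auto
      then show "inverse z ^ r * z ^ r = 1" by (simp add: power_mult_distrib[symmetric])
      show x'X: "x' \<in> {y. ?Pr *v y = y}"
        by (simp add: x'_def matrix_vector_mul_assoc cmatrix_mult[symmetric] PrPr)
      show "z *s x' = ?A *v x' + ?B *v u"
      proof -
        have "z *s x' = ?Pr *v (z *s x)" by (simp add: x'_def matrix_vector_mult_vector_scalar)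
        also have "\<dots> = cmatrix (Pr ** A) *v x + ?B *v u"
          unfolding x u_def B1_def
          by (simp add: matrix_vector_right_distrib matrix_vector_mult_vector_scalar cmatrix_mult
              flip: matrix_vector_mul_assoc)
        also have "cmatrix (Pr ** A) *v x = ?A *v x'"
          by (simp only: x'_def matrix_vector_mul_assoc cmatrix_mult[symmetric] A1Pr PrA)
        finally show ?thesis .
      qed
      show "u = (- of_real \<nu> * \<mu> * inverse z ^ r) *s (?Bt *v (?P *v (matpow ?A (Suc r) *v x')))"
      proof -
        have cpow: "matpow ?A j = cmatrix (matpow A1 j)" for j
          by (induction j) (simp_all add: cmatrix_mult cmatrix_mat)
        have "cmatrix K *v x' = (- of_real \<nu>) *s (?Bt *v (?P *v (matpow ?A (Suc r) *v x')))"
          unfolding cpow matrix_vector_mul_assoc cmatrix_mult[symmetric] K_def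
          by (simp add: vec_eq_iff matrix_vector_mult_def sum_distrib_left sum_negf mult.assoc
              matrix_mul_assoc del: matpow.simps)
        then show ?thesis
          unfolding u_def Kx'[symmetric] by (simp only: vector_smult_assoc) (simp add: mult_ac)
      qed
    qed
    then have "cmatrix K *v x = 0" using Kx' by simp
    then have Ax: "cmatrix A *v x = z *s x" using x by simp
    show "x = 0"
    proof (rule ccontr)
      assume "x \<noteq> 0"
      then have zs: "z \<in> spectrum A" using Ax by (auto simp: spectrum_def)
      then have z1: "cmod z = 1" using spec z by force
      have "x = x'" using fixed[OF z1 Ax] by (simp add: x'_def)
      then show False using \<open>x' = 0\<close> \<open>x \<noteq> 0\<close> by simp
    qed
  qed
  then show ?thesis by blast
qed

section \<open>The communication digraph\<close>

text \<open>For the construction every node other than the root takes as parent a predecessor of smaller distance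
from the root.\<close>

lemma directed_spanning_tree_iff_reachable:
  "has_directed_spanning_tree edges r \<longleftrightarrow> (\<forall>j. (r, j) \<in> edges\<^sup>*)"
proof
  assume "has_directed_spanning_tree edges r"
  then obtain T where T: "T \<subseteq> edges" "\<forall>j. (r, j) \<in> T\<^sup>*"
    unfolding has_directed_spanning_tree_def directed_tree_def by blast
  then show "\<forall>j. (r, j) \<in> edges\<^sup>*" using rtrancl_mono[OF T(1)] by blast
next
  assume reach: "\<forall>j. (r, j) \<in> edges\<^sup>*"
  define d where "d j = (LEAST n. (r, j) \<in> edges ^^ n)" for j
  have d: "(r, j) \<in> edges ^^ d j" for j
    unfolding d_def using reach rtrancl_imp_relpow LeastI_ex by metis
  have "\<exists>i. (i, j) \<in> edges \<and> d i < d j" if "j \<noteq> r" for j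
  proof (cases "d j")
    case 0
    then show ?thesis using d[of j] that by simp
  next
    case (Suc n)
    then have "(r, j) \<in> edges ^^ Suc n" using d[of j] by simp
    then obtain i where i: "(r, i) \<in> edges ^^ n" "(i, j) \<in> edges"
      by (rule relpow_Suc_E)
    have "d i \<le> n" unfolding d_def using i(1) by (rule Least_le)
    then show ?thesis using i(2) Suc by (intro exI[of _ i]) simp
  qed
  then obtain p where p: "\<And>j. j \<noteq> r \<Longrightarrow> (p j, j) \<in> edges \<and> d (p j) < d j" by metis
  define T where "T = {(p j, j) |j. j \<noteq> r}"
  have "(r, j) \<in> T\<^sup>*" for j
  proof (induction "d j" arbitrary: j rule: less_induct)
    case less
    show ?case
    proof (cases "j = r")
      case False
      then have "(r, p j) \<in> T\<^sup>*" using less p by blast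
      moreover have "(p j, j) \<in> T" using False by (auto simp: T_def)
      ultimately show ?thesis by (rule rtrancl_into_rtrancl)
    qed simp
  qed
  then have "directed_tree r T" unfolding directed_tree_def by (auto simp: T_def)
  moreover have "T \<subseteq> edges" using p by (auto simp: T_def)
  ultimately show "has_directed_spanning_tree edges r"
    unfolding has_directed_spanning_tree_def by blast
qed

text \<open>The Laplacian of the digraph restricted to the followers; the weights of the edges from the leader enter
the diagonal.\<close>

definition network_matrix ::
  "('N::finite option \<times> 'N option) set \<Rightarrow> ('N option \<Rightarrow> 'N option \<Rightarrow> real) \<Rightarrow> real^'N^'N" where
  "network_matrix edges a = (\<chi> i j. relative_signal edges a 0 (\<lambda>k. if k = j then 1 else 0) i)"

lemma relative_signal_network_matrix:
  "relative_signal edges a 0 f i = (\<Sum>j\<in>UNIV. network_matrix edges a $ i $ j *\<^sub>R f j)"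
proof -
  let ?\<delta> = "\<lambda>j k. if k = j then 1 else (0::real)"
  have eq: "f i - case_option 0 f k = (\<Sum>j\<in>UNIV. (?\<delta> j i - case_option 0 (?\<delta> j) k) *\<^sub>R f j)" for k
  proof -
    have s: "(\<Sum>j\<in>UNIV. ?\<delta> j i *\<^sub>R f j) = f i" for i
    proof -
      have "(\<Sum>j\<in>UNIV. ?\<delta> j i *\<^sub>R f j) = (\<Sum>j\<in>UNIV. if i = j then f j else 0)"
        by (intro sum.cong) auto
      then show ?thesis by simp
    qed
    then have "case_option 0 f k = (\<Sum>j\<in>UNIV. case_option 0 (?\<delta> j) k *\<^sub>R f j)"
      by (cases k) simp_all
    then show ?thesis by (simp add: scaleR_diff_left sum_subtractf s)
  qed
  show ?thesis
    unfolding network_matrix_def relative_signal_def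
    by (simp add: eq scaleR_sum_right scaleR_sum_left) (rule sum.swap)
qed

lemma relative_signal_zero_eq:
  "relative_signal edges a f0 f i = relative_signal edges a 0 (\<lambda>j. f j - f0) i"
proof -
  have "f i - case_option f0 f k = (f i - f0) - case_option 0 (\<lambda>j. f j - f0) k" for k
    by (cases k) simp_all
  then show ?thesis unfolding relative_signal_def by (simp only:)
qed

text \<open>In an eigenvector, let \<open>c\<close> be an entry of greatest modulus.  If the real part of the eigenvalue is at most
zero, the row of such an entry forces all its in-neighbours to have the same value \<open>c\<close>; going back along
a path to the leader, whose value counts as \<open>0\<close>, is a contradiction.\<close>

lemma network_matrix_spectrum_right_half_plane:
  fixes edges :: "('N::finite option \<times> 'N option) set"
  assumes w: "weighted_adjacency edges a" and reach: "\<And>j. (None, j) \<in> edges\<^sup>*"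
    and \<mu>: "\<mu> \<in> spectrum (network_matrix edges a)"
  shows "0 < Re \<mu>"
proof (rule ccontr)
  assume "\<not> 0 < Re \<mu>"
  then have neg: "Re \<mu> \<le> 0" by simp
  obtain x where x: "x \<noteq> 0" "cmatrix (network_matrix edges a) *v x = \<mu> *s x"
    using \<mu> by (auto simp: spectrum_def)
  have rel: "relative_signal edges a 0 (($) x) i = \<mu> * x $ i" for i
  proof -
    have "relative_signal edges a 0 (($) x) i = (cmatrix (network_matrix edges a) *v x) $ i"
      by (simp add: relative_signal_network_matrix matrix_vector_mult_def scaleR_conv_of_real)
    then show ?thesis by (simp add: x(2))
  qed
  have "finite (range (\<lambda>i. cmod (x $ i)))" "range (\<lambda>i. cmod (x $ i)) \<noteq> {}" by auto
  then have "Max (range (\<lambda>i. cmod (x $ i))) \<in> range (\<lambda>i. cmod (x $ i))" by (rule Max_in)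
  then obtain i0 where i0: "cmod (x $ i0) = Max (range (\<lambda>i. cmod (x $ i)))" by (metis imageE)
  define c where "c = x $ i0"
  have max: "cmod (x $ i) \<le> cmod c" for i
    unfolding c_def i0 by (intro Max_ge) auto
  have c0: "c \<noteq> 0"
  proof
    assume "c = 0"
    then have "x $ i = 0" for i using max[of i] by simp
    then show False using x(1) by (simp add: vec_eq_iff)
  qed
  have pred_eq: "\<exists>k. j = Some k \<and> x $ k = c" if e: "(j, Some i) \<in> edges" and i: "x $ i = c" for i j
  proof -
    let ?v = "\<lambda>j. case_option 0 (($) x) j"
    have v: "cmod (?v j) \<le> cmod c" for j using max by (cases j) auto
    have ge: "0 \<le> (c - ?v j) \<bullet> c" for j
    proof -
      have "?v j \<bullet> c \<le> cmod (?v j) * cmod c" by (rule norm_cauchy_schwarz)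
      also have "\<dots> \<le> cmod c * cmod c" using v by (intro mult_right_mono) auto
      finally show ?thesis by (simp add: inner_diff_left power2_norm_eq_inner[symmetric] power2_eq_square)
    qed
    have apos: "0 < a (Some i) j" if "j \<in> neighbors edges (Some i)" for j
      using w that by (simp add: weighted_adjacency_def neighbors_def)
    let ?t = "\<lambda>j. a (Some i) j * ((c - ?v j) \<bullet> c)"
    have "(\<Sum>j\<in>neighbors edges (Some i). ?t j) = relative_signal edges a 0 (($) x) i \<bullet> c"
      by (simp add: relative_signal_def inner_sum_left i)
    also have "\<dots> = (\<mu> * c) \<bullet> c" by (simp add: rel i)
    also have "\<dots> = Re \<mu> * (cmod c)\<^sup>2"
      unfolding power2_norm_eq_inner by (simp add: inner_complex_def algebra_simps)
    also have "\<dots> \<le> 0" using neg by (simp add: mult_nonpos_nonneg)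
    finally have le: "(\<Sum>j\<in>neighbors edges (Some i). ?t j) \<le> 0" .
    have nn: "\<And>j. j \<in> neighbors edges (Some i) \<Longrightarrow> 0 \<le> ?t j"
      using apos ge by (intro mult_nonneg_nonneg) (auto simp: less_imp_le)
    have jn: "j \<in> neighbors edges (Some i)" using e by (simp add: neighbors_def)
    have "?t j \<le> (\<Sum>j\<in>neighbors edges (Some i). ?t j)"
      using jn nn by (intro member_le_sum) auto
    then have "?t j \<le> 0" using le by linarith
    then have "(c - ?v j) \<bullet> c \<le> 0" using apos[OF jn] by (simp add: mult_le_0_iff)
    then have vc: "c \<bullet> c \<le> ?v j \<bullet> c" by (simp add: inner_diff_left)
    show ?thesis
    proof (cases j)
      case None
      then have "c \<bullet> c \<le> 0" using vc by simp
      moreover have "0 < c \<bullet> c" using c0 by simp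
      ultimately show ?thesis by linarith
    next
      case (Some k)
      have "(x $ k - c) \<bullet> (x $ k - c) = (cmod (x $ k))\<^sup>2 - 2 * (x $ k \<bullet> c) + (cmod c)\<^sup>2"
        by (simp add: power2_norm_eq_inner inner_diff_left inner_diff_right inner_commute)
      moreover have "(cmod (x $ k))\<^sup>2 \<le> (cmod c)\<^sup>2" using max by (intro power_mono) auto
      moreover have "(cmod c)\<^sup>2 \<le> x $ k \<bullet> c" using vc Some by (simp add: power2_norm_eq_inner)
      ultimately have "(x $ k - c) \<bullet> (x $ k - c) \<le> 0" by linarith
      then have "x $ k = c" by (metis inner_gt_zero_iff not_le eq_iff_diff_eq_0)
      then show ?thesis using Some by simp
    qed
  qed
  have "\<exists>k. j = Some k \<and> x $ k = c" if "(j, Some i0) \<in> edges\<^sup>*" for j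
    using that
  proof (induction rule: converse_rtrancl_induct)
    case base
    then show ?case by (simp add: c_def)
  next
    case (step y z)
    then show ?case using pred_eq by blast
  qed
  from this[OF reach] show False by simp
qed

text \<open>The solutions of the mode equation form a subspace invariant under \<open>H \<otimes> I\<close>.  An eigenvector in it
has blocks that solve the mode equation with \<open>H\<close> replaced by its eigenvalue.\<close>

lemma network_decoupling:
  fixes H :: "real^'N^'N" and M M' :: "complex^'n^'n" and Y :: "'N \<Rightarrow> complex^'n"
  assumes mode: "\<And>\<mu> x. \<mu> \<in> spectrum H \<Longrightarrow> \<zeta> *s x = M *v x + \<mu> *s (M' *v x) \<Longrightarrow> x = 0"
    and Y: "\<And>i. \<zeta> *s Y i = M *v Y i + M' *v (\<Sum>j\<in>UNIV. H $ i $ j *\<^sub>R Y j)"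
  shows "Y i = 0"
proof (rule ccontr)
  assume Yi: "Y i \<noteq> 0"
  define blk where "blk y i = (\<chi> k. y $ (i, k))" for y :: "complex^('N \<times> 'n)" and i
  define T where "T = kronecker (cmatrix H) (mat 1 :: complex^'n^'n)"
  define V where "V = {y. \<forall>i. \<zeta> *s blk y i = M *v blk y i + M' *v (\<Sum>j\<in>UNIV. H $ i $ j *\<^sub>R blk y j)}"
  have blk_add: "blk (x + y) i = blk x i + blk y i" for x y i
    by (simp add: blk_def vec_eq_iff)
  have blk_scale: "blk (c *s y) i = c *s blk y i" for c y i
    by (simp add: blk_def vec_eq_iff)
  have blk_T: "blk (T *v y) i = (\<Sum>j\<in>UNIV. H $ i $ j *\<^sub>R blk y j)" for y i
  proof -
    have "(T *v y) $ (i, k) = (\<Sum>j\<in>UNIV. complex_of_real (H $ i $ j) * y $ (j, k))" for k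
    proof -
      have "(T *v y) $ (i, k) = (\<Sum>j\<in>UNIV. \<Sum>l\<in>UNIV. T $ (i, k) $ (j, l) * y $ (j, l))"
        by (simp add: matrix_vector_mult_def sum.cartesian_product)
      also have "\<dots> = (\<Sum>j\<in>UNIV. \<Sum>l\<in>UNIV. if k = l then complex_of_real (H $ i $ j) * y $ (j, l) else 0)"
        by (intro sum.cong refl) (simp add: T_def kronecker_def mat_def)
      finally show ?thesis by simp
    qed
    then show ?thesis by (simp add: blk_def vec_eq_iff flip: complex_vector_scaleR)
  qed
  have smult_sum: "c *s (\<Sum>j\<in>J. f j) = (\<Sum>j\<in>J. c *s f j)" for c and f :: "'N \<Rightarrow> complex^'n" and J
    by (rule vec.scale_sum_right)
  have smult_scaleR: "c *s (r *\<^sub>R x) = r *\<^sub>R (c *s x)" for c r and x :: "complex^'n"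
    by (simp add: vec_eq_iff)
  define y0 where "y0 = (\<chi> p. Y (fst p) $ snd p)"
  have blk0: "blk y0 i = Y i" for i by (simp add: blk_def y0_def vec_eq_iff)
  have "y0 \<in> V" by (simp add: V_def blk0 Y)
  moreover have "y0 \<noteq> 0"
  proof
    assume "y0 = 0"
    then have "blk y0 i = 0" by (simp add: blk_def vec_eq_iff)
    then show False using Yi by (simp add: blk0)
  qed
  moreover have "x + y \<in> V" if "x \<in> V" "y \<in> V" for x y
    using that by (simp add: V_def blk_add vector_add_ldistrib matrix_vector_right_distrib
        scaleR_add_right sum.distrib)
  moreover have "c *s x \<in> V" if x: "x \<in> V" for c x
  proof -
    have "\<zeta> *s blk (c *s x) i = c *s (\<zeta> *s blk x i)" for i
      by (simp add: blk_scale vector_smult_assoc mult.commute)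
    also have "\<And>i. c *s (\<zeta> *s blk x i) = c *s (M *v blk x i + M' *v (\<Sum>j\<in>UNIV. H $ i $ j *\<^sub>R blk x j))"
      using x by (simp add: V_def)
    also have "\<And>i. c *s (M *v blk x i + M' *v (\<Sum>j\<in>UNIV. H $ i $ j *\<^sub>R blk x j)) =
        M *v blk (c *s x) i + M' *v (\<Sum>j\<in>UNIV. H $ i $ j *\<^sub>R blk (c *s x) j)"
      by (simp add: blk_scale vector_add_ldistrib matrix_vector_mult_vector_scalar[symmetric]
          smult_sum smult_scaleR)
    finally show ?thesis by (simp add: V_def)
  qed
  moreover have "T *v x \<in> V" if x: "x \<in> V" for x
  proof -
    have "\<zeta> *s blk (T *v x) i = (\<Sum>j\<in>UNIV. H $ i $ j *\<^sub>R (\<zeta> *s blk x j))" for i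
      by (simp add: blk_T smult_sum smult_scaleR)
    also have "\<And>i. (\<Sum>j\<in>UNIV. H $ i $ j *\<^sub>R (\<zeta> *s blk x j)) =
        (\<Sum>j\<in>UNIV. H $ i $ j *\<^sub>R (M *v blk x j + M' *v blk (T *v x) j))"
      using x by (simp add: V_def blk_T)
    also have "\<And>i. (\<Sum>j\<in>UNIV. H $ i $ j *\<^sub>R (M *v blk x j + M' *v blk (T *v x) j)) =
        M *v blk (T *v x) i + M' *v (\<Sum>j\<in>UNIV. H $ i $ j *\<^sub>R blk (T *v x) j)"
      by (simp add: blk_T[of x] scaleR_add_right sum.distrib linear_sum[OF matrix_vector_mul_linear]
          matrix_vector_mult_scaleR_complex)
    finally show ?thesis by (simp add: V_def)
  qed
  ultimately obtain \<mu> y where y: "y \<in> V" "y \<noteq> 0" "T *v y = \<mu> *s y"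
    using invariant_eigenvector[of V T y0] by metis
  have Hy: "(\<Sum>j\<in>UNIV. H $ i $ j *\<^sub>R blk y j) = \<mu> *s blk y i" for i
    using blk_T[of y i] by (simp add: y(3) blk_scale)
  obtain i k where ik: "y $ (i, k) \<noteq> 0" using y(2) by (auto simp: vec_eq_iff)
  define x where "x = (\<chi> i. y $ (i, k))"
  have "cmatrix H *v x = \<mu> *s x"
  proof -
    have "(\<Sum>j\<in>UNIV. H $ i $ j *\<^sub>R blk y j) $ k = (\<mu> *s blk y i) $ k" for i by (simp only: Hy)
    then show ?thesis
      by (simp add: vec_eq_iff matrix_vector_mult_def x_def blk_def flip: complex_vector_scaleR)
  qed
  moreover have "x \<noteq> 0" using ik by (auto simp: x_def vec_eq_iff)
  ultimately have "\<mu> \<in> spectrum H" by (auto simp: spectrum_def)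
  moreover have "\<zeta> *s blk y i = M *v blk y i + \<mu> *s (M' *v blk y i)"
    using y(1) by (simp add: V_def Hy matrix_vector_mult_vector_scalar)
  ultimately have "blk y i = 0" by (rule mode)
  then show False using ik by (simp add: blk_def vec_eq_iff)
qed

section \<open>The closed loop as a linear system with delay\<close>

lemma continuous_on_matrix_vector_mult:
  fixes f :: "'a::topological_space \<Rightarrow> real^'n^'m"
  assumes "continuous_on T f" "continuous_on T g"
  shows "continuous_on T (\<lambda>x. f x *v g x)"
  unfolding matrix_vector_mult_def by (intro continuous_intros assms)

type_synonym ('n, 'k, 'N) loop_state = "((real^'n)^'N) \<times> ((real^'k)^'N) \<times> ((real^'n)^'N)"

locale distributed_loop =
  fixes edges :: "('N::finite option \<times> 'N option) set" and a :: "'N option \<Rightarrow> 'N option \<Rightarrow> real"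
    and A :: "real^'n^'n" and B :: "real^'m^'n" and E :: "real^'q^'n" and C :: "real^'n^'p"
    and F :: "real^'q^'p" and G1 :: "real^'k^'k" and G2 :: "real^'p^'k"
    and K1 :: "real^'k^'m" and K2 :: "real^'n^'m" and L :: "real^'p^'n"
begin

abbreviation "H \<equiv> network_matrix edges a"

definition input :: "('n, 'k, 'N) loop_state \<Rightarrow> 'N \<Rightarrow> real^'m" where
  "input Y i = K1 *v (fst (snd Y) $ i) + K2 *v (\<Sum>j\<in>UNIV. H $ i $ j *\<^sub>R (snd (snd Y) $ j))"

definition tracking_error :: "('n, 'm, 'q, 'p) plant^'N \<Rightarrow> ('n, 'k, 'N) loop_state \<Rightarrow> real^'q \<Rightarrow> 'N \<Rightarrow> real^'p" where
  "tracking_error w X v i = (C + snd (snd (snd (w $ i)))) *v (fst X $ i) + F *v v"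

definition relative_error :: "('n, 'm, 'q, 'p) plant^'N \<Rightarrow> ('n, 'k, 'N) loop_state \<Rightarrow> real^'q \<Rightarrow> 'N \<Rightarrow> real^'p" where
  "relative_error w X v i = (\<Sum>j\<in>UNIV. H $ i $ j *\<^sub>R tracking_error w X v j)"

text \<open>One step of the closed loop.  The argument \<open>X\<close> is the current state and \<open>Y\<close> the state \<open>rcom + rcon\<close> steps
earlier: the two delays enter only through their sum, because the input uses nothing but delayed controller
states.\<close>

definition update :: "('n, 'm, 'q, 'p) plant^'N \<Rightarrow> ('n, 'k, 'N) loop_state \<Rightarrow> ('n, 'k, 'N) loop_state \<Rightarrow>
    real^'q \<Rightarrow> ('n, 'k, 'N) loop_state" where
  "update w X Y v =
    ((\<chi> i. (A + fst (w $ i)) *v (fst X $ i) + (B + fst (snd (w $ i))) *v input Y i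
        + (E + fst (snd (snd (w $ i)))) *v v),
     (\<chi> i. G1 *v (fst (snd X) $ i) + G2 *v relative_error w X v i),
     (\<chi> i. A *v (snd (snd X) $ i) + B *v input Y i
        - (L ** C) *v (\<Sum>j\<in>UNIV. H $ i $ j *\<^sub>R (snd (snd X) $ j)) + L *v relative_error w X v i))"

lemma closed_loop_update:
  "closed_loop edges a (A, B, E, C) S F rcon rcom G1 G2 K1 K2 L w v x z \<xi> \<longleftrightarrow>
    (\<forall>t\<ge>0. v (t + 1) = S *v v t \<and> (x (t + 1), z (t + 1), \<xi> (t + 1)) =
       update w (x t, z t, \<xi> t)
         (x (t - int (rcom + rcon)), z (t - int (rcom + rcon)), \<xi> (t - int (rcom + rcon))) (v t))"
proof -
  have d: "t - int rcon - int rcom = t - int (rcom + rcon)" for t by simp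
  have rel: "relative_signal edges a (leader_output F v t) (follower_output (A, B, E, C) w x t) i =
      relative_error w (x t, z t, \<xi> t) (v t) i" for t i
    unfolding relative_signal_zero_eq[of edges a "leader_output F v t"] relative_signal_network_matrix
      relative_error_def tracking_error_def
    by (cases "w $ i") (simp add: follower_output_def leader_output_def case_prod_beta)
  show ?thesis
    unfolding closed_loop_def control_input_def Let_def d rel relative_signal_network_matrix
    by (simp add: update_def input_def vec_eq_iff[where 'a="real^'n"] vec_eq_iff[where 'a="real^'k"] case_prod_beta)
      (auto simp: all_conj_distrib)
qed

lemma input_add: "input (Y + Y') i = input Y i + input Y' i"
  by (simp add: input_def matrix_vector_right_distrib scaleR_add_right sum.distrib)

lemma network_sum_scaleR:
  "(\<Sum>j\<in>UNIV. H $ i $ j *\<^sub>R (c *\<^sub>R f j)) = c *\<^sub>R (\<Sum>j\<in>UNIV. H $ i $ j *\<^sub>R (f j :: 'v::real_vector))"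
  by (simp add: scaleR_sum_right mult.commute)

lemma input_scaleR: "input (c *\<^sub>R Y) i = c *\<^sub>R input Y i"
  by (simp only: input_def matrix_vector_mult_scaleR scaleR_add_right network_sum_scaleR
      fst_scaleR snd_scaleR vector_scaleR_component)

lemma tracking_error_add:
  "tracking_error w (X + X') (v + v') i = tracking_error w X v i + tracking_error w X' v' i"
  by (simp add: tracking_error_def matrix_vector_right_distrib)

lemma tracking_error_scaleR: "tracking_error w (c *\<^sub>R X) (c *\<^sub>R v) i = c *\<^sub>R tracking_error w X v i"
  by (simp add: tracking_error_def matrix_vector_mult_scaleR scaleR_add_right)

lemma relative_error_add:
  "relative_error w (X + X') (v + v') i = relative_error w X v i + relative_error w X' v' i"
  by (simp add: relative_error_def tracking_error_add scaleR_add_right sum.distrib)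

lemma relative_error_scaleR: "relative_error w (c *\<^sub>R X) (c *\<^sub>R v) i = c *\<^sub>R relative_error w X v i"
  by (simp only: relative_error_def tracking_error_scaleR network_sum_scaleR)

lemma update_add: "update w (X + X') (Y + Y') (v + v') = update w X Y v + update w X' Y' v'"
  by (simp add: update_def input_add relative_error_add matrix_vector_right_distrib
      scaleR_add_right sum.distrib vec_eq_iff[where 'a="real^'n"] vec_eq_iff[where 'a="real^'k"])

lemma update_scaleR: "update w (c *\<^sub>R X) (c *\<^sub>R Y) (c *\<^sub>R v) = c *\<^sub>R update w X Y v"
  by (simp only: update_def input_scaleR relative_error_scaleR matrix_vector_mult_scaleR network_sum_scaleR
      fst_scaleR snd_scaleR vector_scaleR_component)
    (simp add: scaleR_add_right scaleR_diff_right vec_eq_iff[where 'a="real^'n"] vec_eq_iff[where 'a="real^'k"])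

lemma update_linear: "linear (\<lambda>X. update w X 0 0)" "linear (\<lambda>Y. update w 0 Y 0)"
proof -
  show "linear (\<lambda>X. update w X 0 0)"
    using update_add[of w _ _ 0 0 0 0] update_scaleR[of w _ _ 0 0] by (intro linearI) simp_all
  show "linear (\<lambda>Y. update w 0 Y 0)"
    using update_add[of w 0 0 _ _ 0 0] update_scaleR[of w _ 0 _ 0] by (intro linearI) simp_all
qed

lemma update_split: "update w X Y 0 = update w X 0 0 + update w 0 Y 0"
  using update_add[of w X 0 0 Y 0 0] by simp

lemma update_sum:
  "update w (\<Sum>k\<in>I. c k *\<^sub>R X k) (\<Sum>k\<in>I. c k *\<^sub>R Y k) (\<Sum>k\<in>I. c k *\<^sub>R v k) = (\<Sum>k\<in>I. c k *\<^sub>R update w (X k) (Y k) (v k))"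
proof (induction I rule: infinite_finite_induct)
  case (insert x I)
  then show ?case by (simp add: update_add update_scaleR)
qed (use update_scaleR[of _ 0 0 0 0] in simp_all)

lemma update_continuous: "continuous_on UNIV (\<lambda>w. update w X Y v)"
  unfolding update_def relative_error_def tracking_error_def
  by (intro continuous_intros continuous_on_matrix_vector_mult)

text \<open>The time is shifted by the delay, so that the initial data on \<open>{- r..0}\<close> become the first \<open>r + 1\<close>
members of a sequence.\<close>

lemma exp_stable_if_no_unstable_mode:
  assumes "no_unstable_mode (rcom + rcon) (\<lambda>X. update 0 X 0 0) (\<lambda>Y. update 0 0 Y 0)"
  shows "nominally_exp_stable edges a (A, B, E, C) S F rcon rcom G1 G2 K1 K2 L"
proof -
  let ?r = "rcom + rcon"
  obtain c \<gamma> where c: "0 < c" "0 < \<gamma>" "\<gamma> < 1" and decay: "\<And>X t. (\<forall>t. X (t + Suc ?r) =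
      update 0 (X (t + ?r)) 0 0 + update 0 0 (X t) 0) \<Longrightarrow> norm (X t) \<le> c * \<gamma> ^ t * (\<Sum>k\<le>?r. norm (X k))"
    using delay_decay[OF update_linear assms] by blast
  have "norm (x (int t), z (int t), \<xi> (int t)) \<le>
      (c * real (Suc ?r)) * \<gamma> ^ t * (MAX s\<in>{- int ?r..0}. norm (x s, z s, \<xi> s))"
    if cl: "closed_loop edges a (A, B, E, C) S F rcon rcom G1 G2 K1 K2 L 0 (\<lambda>_. 0) x z \<xi>" for x z \<xi> t
  proof -
    let ?M = "MAX s\<in>{- int ?r..0}. norm (x s, z s, \<xi> s)"
    define X where "X k = (x (int k - int ?r), z (int k - int ?r), \<xi> (int k - int ?r))" for k :: nat
    have "X (t + Suc ?r) = update 0 (X (t + ?r)) 0 0 + update 0 0 (X t) 0" for t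
    proof -
      have "X (t + Suc ?r) = (x (int t + 1), z (int t + 1), \<xi> (int t + 1))"
        by (simp add: X_def add.commute)
      also have "\<dots> = update 0 (x (int t), z (int t), \<xi> (int t))
          (x (int t - int ?r), z (int t - int ?r), \<xi> (int t - int ?r)) 0"
        using cl unfolding closed_loop_update by simp
      also have "\<dots> = update 0 (X (t + ?r)) (X t) 0" by (simp add: X_def)
      finally show ?thesis using update_split by metis
    qed
    then have "norm (X (t + ?r)) \<le> c * \<gamma> ^ (t + ?r) * (\<Sum>k\<le>?r. norm (X k))"
      using decay[of X] by blast
    also have "\<dots> \<le> c * \<gamma> ^ t * (real (Suc ?r) * ?M)"
    proof (intro mult_mono)
      show "\<gamma> ^ (t + ?r) \<le> \<gamma> ^ t" using c by (intro power_decreasing) auto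
      have "norm (X k) \<le> ?M" if "k \<le> ?r" for k
        unfolding X_def by (rule Max_ge) (use that in auto)
      then have "(\<Sum>k\<le>?r. norm (X k)) \<le> real (card {..?r}) * ?M"
        by (intro sum_bounded_above) auto
      then show "(\<Sum>k\<le>?r. norm (X k)) \<le> real (Suc ?r) * ?M" by simp
    qed (use c in \<open>auto intro: sum_nonneg\<close>)
    also have "X (t + ?r) = (x (int t), z (int t), \<xi> (int t))" by (simp add: X_def)
    finally show ?thesis by (simp add: mult_ac)
  qed
  moreover have "0 < c * real (Suc ?r)" using c by simp
  ultimately show ?thesis unfolding nominally_exp_stable_def using c(2,3) by blast
qed

end

section \<open>The internal model principle\<close>

lemma degree_char_poly_le: "degree (char_poly (M :: real^'n^'n)) \<le> CARD('n)"
  unfolding char_poly_eq_det_char_matrix det_def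
proof (intro degree_sum_le)
  fix p assume "p \<in> {p. p permutes (UNIV :: 'n set)}"
  have "degree (\<Prod>i\<in>UNIV. char_matrix M $ i $ p i) \<le> sum (degree \<circ> (\<lambda>i. char_matrix M $ i $ p i)) UNIV"
    by (rule degree_prod_sum_le) simp
  also have "\<dots> \<le> (\<Sum>i\<in>(UNIV :: 'n set). 1)"
    by (intro sum_mono) (simp add: char_matrix_def mat_def degree_diff_le)
  finally have "degree (\<Prod>i\<in>UNIV. char_matrix M $ i $ p i) \<le> CARD('n)" by simp
  moreover have "degree (of_int (sign p) * (\<Prod>i\<in>UNIV. char_matrix M $ i $ p i)) \<le> degree (\<Prod>i\<in>UNIV. char_matrix M $ i $ p i)"
    by (cases p rule: sign_cases) auto
  ultimately show "degree (of_int (sign p) * (\<Prod>i\<in>UNIV. char_matrix M $ i $ p i)) \<le> CARD('n)"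
    by linarith
qed (simp add: finite_permutations)

text \<open>The columns of the controllability matrix are the vectors \<open>\<beta>\<^sup>k \<sigma>\<close>.\<close>

lemma controllable_orthogonal:
  fixes \<beta> :: "real^'s^'s" and \<sigma> :: "real^1^'s"
  assumes "controllable \<beta> \<sigma>" and "\<And>k. k < CARD('s) \<Longrightarrow> \<phi> \<bullet> (matpow \<beta> k *v column 1 \<sigma>) = 0"
  shows "\<phi> = 0"
proof -
  let ?S = "\<Union>k<CARD('s). columns (matpow \<beta> k ** \<sigma>)"
  have "dim ?S = DIM(real^'s)" using assms(1) by (simp add: controllable_def)
  then have "span ?S = UNIV" by (rule dim_eq_full[THEN iffD1])
  then have "\<phi> \<in> span ?S" by simp
  moreover have "orthogonal \<phi> v" if v: "v \<in> ?S" for v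
  proof -
    obtain k and i :: 1 where "k < CARD('s)" "v = column i (matpow \<beta> k ** \<sigma>)"
      using v unfolding columns_def by blast
    moreover have i1: "i = 1" by (rule num1_eq1)
    have "column i (matpow \<beta> k ** \<sigma>) = matpow \<beta> k *v column 1 \<sigma>"
      unfolding i1 by (simp add: vec_eq_iff column_def matrix_matrix_mult_def matrix_vector_mult_def)
    ultimately show ?thesis using assms(2) by (simp add: orthogonal_def)
  qed
  ultimately have "orthogonal \<phi> \<phi>" by (rule orthogonal_to_span)
  then show ?thesis by (simp add: orthogonal_def)
qed

text \<open>Let \<open>f\<close> be the characteristic polynomial, of degree \<open>d + 1\<close>.  Filtering with \<open>f\<close> removes the free
response of the model and leaves a combination of \<open>\<sigma>, \<dots>, \<beta>\<^sup>d \<sigma>\<close> in which \<open>\<beta>\<^sup>d \<sigma>\<close> has coefficient \<open>e(t)\<close>.  A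
vector \<open>\<phi>\<close> orthogonal to all \<open>\<beta>\<^sup>k \<sigma>\<close> with \<open>k < d\<close> isolates this coefficient.\<close>

lemma internal_model_error_tendsto_0:
  fixes \<beta> :: "real^'s^'s" and \<sigma> :: "real^1^'s"
  assumes ctrl: "controllable \<beta> \<sigma>" and lead: "lead_coeff (char_poly \<beta>) = 1"
    and \<zeta>: "\<And>t. \<zeta> (Suc t) = \<beta> *v \<zeta> t + e t *\<^sub>R column 1 \<sigma>"
    and lim: "(\<lambda>t. \<Sum>k\<le>degree (char_poly \<beta>). coeff (char_poly \<beta>) k *\<^sub>R \<zeta> (t + k)) \<longlonglongrightarrow> 0"
  shows "e \<longlonglongrightarrow> 0"
proof -
  let ?f = "char_poly \<beta>" and ?b = "column 1 \<sigma>"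
  have "degree ?f \<noteq> 0"
  proof
    assume "degree ?f = 0"
    then have "?f = 1" using lead by (metis degree_eq_zeroE lead_coeff_pCons(2) one_pCons)
    then have "(mat 1 :: real^'s^'s) = 0" using cayley_hamilton[of \<beta>] by (simp add: poly_matrix_1)
    then have "(mat 1 :: real^'s^'s) $ undefined $ undefined = 0" by simp
    then show False by (simp add: mat_def)
  qed
  then obtain d where d: "degree ?f = Suc d" by (cases "degree ?f") auto
  let ?S = "(\<lambda>k. matpow \<beta> k *v ?b) ` {..<d}"
  have "dim ?S \<le> card ?S" by (rule dim_le_card') simp
  also have "\<dots> \<le> d" using card_image_le[of "{..<d}"] by (metis card_lessThan finite_lessThan)
  also have "d < DIM(real^'s)" using degree_char_poly_le[of \<beta>] d by simp
  finally obtain \<phi> where \<phi>: "\<phi> \<noteq> 0" "\<And>v. v \<in> span ?S \<Longrightarrow> orthogonal \<phi> v"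
    using orthogonal_to_subspace_exists by blast
  have low: "\<phi> \<bullet> (matpow \<beta> k *v ?b) = 0" if "k < d" for k
    using \<phi>(2)[of "matpow \<beta> k *v ?b"] that by (auto simp: orthogonal_def intro: span_base)
  have annih: "(\<Sum>k\<le>Suc d. coeff ?f k *\<^sub>R (matpow \<beta> (t + k) *v x)) = 0" for t x
  proof -
    have pow: "matpow \<beta> (t + k) = matpow \<beta> t ** matpow \<beta> k" for k
      by (induction t) (simp_all add: matrix_mul_assoc)
    have "(\<Sum>k\<le>Suc d. coeff ?f k *\<^sub>R (matpow \<beta> (t + k) *v x)) = (matpow \<beta> t ** poly_matrix ?f \<beta>) *v x"
      by (simp only: poly_matrix_def d matrix_mult_sum_right sum_matrix_vector pow matrix_scaleR_right
          scaleR_matrix_vector_assoc)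
    then show ?thesis by (simp add: cayley_hamilton)
  qed
  let ?g = "\<phi> \<bullet> (matpow \<beta> d *v ?b)"
  have g: "?g \<noteq> 0"
  proof
    assume g0: "?g = 0"
    have "\<phi> \<bullet> (matpow \<beta> k *v ?b) = 0" for k
    proof (induction k rule: less_induct)
      case (less k)
      show ?case
      proof (cases "k \<le> d")
        case True
        then show ?thesis using low[of k] g0 by (cases "k = d") auto
      next
        case False
        then have k: "k - Suc d + Suc d = k" by simp
        have "0 = \<phi> \<bullet> (\<Sum>j\<le>Suc d. coeff ?f j *\<^sub>R (matpow \<beta> (k - Suc d + j) *v ?b))"
          by (simp only: annih inner_zero_right)
        also have "\<dots> = (\<Sum>j\<le>Suc d. coeff ?f j * (\<phi> \<bullet> (matpow \<beta> (k - Suc d + j) *v ?b)))"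
          by (simp only: inner_sum_right inner_scaleR_right)
        also have "\<dots> = (\<Sum>j\<le>d. coeff ?f j * (\<phi> \<bullet> (matpow \<beta> (k - Suc d + j) *v ?b))) +
            coeff ?f (Suc d) * (\<phi> \<bullet> (matpow \<beta> k *v ?b))"
          by (simp only: sum.atMost_Suc k)
        also have "(\<Sum>j\<le>d. coeff ?f j * (\<phi> \<bullet> (matpow \<beta> (k - Suc d + j) *v ?b))) = 0"
          using less False by (intro sum.neutral) auto
        finally show ?thesis using lead d by simp
      qed
    qed
    then have "\<phi> = 0" using controllable_orthogonal[OF ctrl] by blast
    with \<phi>(1) show False ..
  qed
  have expand: "\<zeta> (t + k) = matpow \<beta> k *v \<zeta> t + (\<Sum>j<k. e (t + j) *\<^sub>R (matpow \<beta> (k - 1 - j) *v ?b))" for t k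
  proof (induction k)
    case (Suc k)
    have "\<zeta> (t + Suc k) = \<beta> *v \<zeta> (t + k) + e (t + k) *\<^sub>R ?b" using \<zeta> by simp
    also have "\<beta> *v \<zeta> (t + k) = matpow \<beta> (Suc k) *v \<zeta> t
        + (\<Sum>j<k. e (t + j) *\<^sub>R (matpow \<beta> (Suc (k - 1 - j)) *v ?b))"
      unfolding Suc matpow_Suc_vec
      by (simp add: matrix_vector_right_distrib linear_sum[OF matrix_vector_mul_linear] matrix_vector_mult_scaleR)
    also have "(\<Sum>j<k. e (t + j) *\<^sub>R (matpow \<beta> (Suc (k - 1 - j)) *v ?b)) =
        (\<Sum>j<k. e (t + j) *\<^sub>R (matpow \<beta> (Suc k - 1 - j) *v ?b))"
    proof (intro sum.cong refl)
      fix j assume "j \<in> {..<k}"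
      then have "Suc (k - 1 - j) = Suc k - 1 - j" by auto
      then show "e (t + j) *\<^sub>R (matpow \<beta> (Suc (k - 1 - j)) *v ?b) =
          e (t + j) *\<^sub>R (matpow \<beta> (Suc k - 1 - j) *v ?b)" by (simp only:)
    qed
    finally show ?case by simp
  qed simp
  define y where "y t = (\<Sum>k\<le>degree ?f. coeff ?f k *\<^sub>R \<zeta> (t + k))" for t
  have "\<phi> \<bullet> y t = e t * ?g" for t
  proof -
    have inner: "\<phi> \<bullet> (\<Sum>j<k. e (t + j) *\<^sub>R (matpow \<beta> (k - 1 - j) *v ?b)) = (if k = Suc d then e t * ?g else 0)"
      if "k \<le> Suc d" for k
    proof -
      have "\<phi> \<bullet> (\<Sum>j<k. e (t + j) *\<^sub>R (matpow \<beta> (k - 1 - j) *v ?b)) =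
          (\<Sum>j<k. e (t + j) * (\<phi> \<bullet> (matpow \<beta> (k - 1 - j) *v ?b)))"
        by (simp only: inner_sum_right inner_scaleR_right)
      also have "\<dots> = (\<Sum>j<k. if j = 0 \<and> k = Suc d then e t * ?g else 0)"
      proof (intro sum.cong refl)
        fix j assume j: "j \<in> {..<k}"
        show "e (t + j) * (\<phi> \<bullet> (matpow \<beta> (k - 1 - j) *v ?b)) = (if j = 0 \<and> k = Suc d then e t * ?g else 0)"
        proof (cases "j = 0 \<and> k = Suc d")
          case False
          then have lt: "k - 1 - j < d" using j that by auto
          show ?thesis by (simp only: low[OF lt] False if_False mult_zero_right)
        qed simp
      qed
      also have "\<dots> = (if k = Suc d then e t * ?g else 0)"
        by (cases "k = Suc d") (simp_all add: sum.delta)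
      finally show ?thesis .
    qed
    have "y t = 0
        + (\<Sum>k\<le>Suc d. coeff ?f k *\<^sub>R (\<Sum>j<k. e (t + j) *\<^sub>R (matpow \<beta> (k - 1 - j) *v ?b)))"
      unfolding y_def d expand scaleR_add_right sum.distrib using annih[of 0 "\<zeta> t"] by simp
    then have "\<phi> \<bullet> y t = (\<Sum>k\<le>Suc d. coeff ?f k * (\<phi> \<bullet> (\<Sum>j<k. e (t + j) *\<^sub>R (matpow \<beta> (k - 1 - j) *v ?b))))"
      by (simp only: add_0_left inner_sum_right inner_scaleR_right)
    also have "\<dots> = (\<Sum>k\<le>Suc d. if k = Suc d then coeff ?f (Suc d) * (e t * ?g) else 0)"
    proof (intro sum.cong refl)
      fix k assume "k \<in> {..Suc d}"
      then have "k \<le> Suc d" by simp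
      then show "coeff ?f k * (\<phi> \<bullet> (\<Sum>j<k. e (t + j) *\<^sub>R (matpow \<beta> (k - 1 - j) *v ?b))) =
          (if k = Suc d then coeff ?f (Suc d) * (e t * ?g) else 0)"
        unfolding inner[OF \<open>k \<le> Suc d\<close>] by simp
    qed
    also have "\<dots> = coeff ?f (Suc d) * (e t * ?g)" by (simp add: sum.delta)
    finally show ?thesis using lead d by simp
  qed
  then have e: "e = (\<lambda>t. (\<phi> \<bullet> y t) / ?g)" using g by auto
  have "(\<lambda>t. (\<phi> \<bullet> y t) / ?g) \<longlonglongrightarrow> (\<phi> \<bullet> 0) / ?g"
    using lim unfolding y_def by (intro tendsto_intros g)
  then show ?thesis by (subst e) simp
qed

context distributed_loop
begin

text \<open>Filtering with \<open>f\<close> annihilates the exosystem, so that the filtered state is a trajectory of the homogeneous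
loop.\<close>

lemma filtered_state_tendsto_0:
  assumes stable: "no_unstable_mode (rcom + rcon) (\<lambda>X. update w X 0 0) (\<lambda>Y. update w 0 Y 0)"
    and f: "poly_matrix f S = 0"
    and cl: "closed_loop edges a (A, B, E, C) S F rcon rcom G1 G2 K1 K2 L w v x z \<xi>"
  shows "(\<lambda>t. \<Sum>k\<le>degree f. coeff f k *\<^sub>R (x (int (t + k)), z (int (t + k)), \<xi> (int (t + k)))) \<longlonglongrightarrow> 0"
proof -
  let ?r = "rcom + rcon"
  define Z where "Z s = (x s, z s, \<xi> s)" for s :: int
  have Z: "Z (int t + 1) = update w (Z (int t)) (Z (int t - int ?r)) (v (int t))"
    and v: "v (int t + 1) = S *v v (int t)" for t
    using cl unfolding closed_loop_update Z_def by auto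
  have v_pow: "v (int (t + k)) = matpow S k *v v (int t)" for t k
  proof (induction k)
    case (Suc k)
    have "v (int (t + Suc k)) = v (int (t + k) + 1)" by (simp add: add.commute add.left_commute)
    then show ?case unfolding v Suc matpow_Suc_vec .
  qed simp
  define Y where "Y t = (\<Sum>k\<le>degree f. coeff f k *\<^sub>R Z (int (t + k) - int ?r))" for t
  have "Y (t + Suc ?r) = update w (Y (t + ?r)) 0 0 + update w 0 (Y t) 0" for t
  proof -
    have "Y (t + Suc ?r) = (\<Sum>k\<le>degree f. coeff f k *\<^sub>R update w (Z (int (t + k)))
        (Z (int (t + k) - int ?r)) (v (int (t + k))))"
      unfolding Y_def Z[symmetric] by (intro sum.cong refl) (simp add: algebra_simps)
    also have "\<dots> = update w (\<Sum>k\<le>degree f. coeff f k *\<^sub>R Z (int (t + k)))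
        (Y t) (\<Sum>k\<le>degree f. coeff f k *\<^sub>R v (int (t + k)))"
      unfolding update_sum[symmetric] Y_def ..
    also have "(\<Sum>k\<le>degree f. coeff f k *\<^sub>R Z (int (t + k))) = Y (t + ?r)"
      unfolding Y_def by (intro sum.cong refl) (simp add: algebra_simps)
    also have "(\<Sum>k\<le>degree f. coeff f k *\<^sub>R v (int (t + k))) = poly_matrix f S *v v (int t)"
      by (simp only: v_pow poly_matrix_def sum_matrix_vector scaleR_matrix_vector_assoc)
    also have "\<dots> = 0" by (simp add: f)
    finally show ?thesis using update_split by metis
  qed
  then obtain c \<gamma> where c: "0 < \<gamma>" "\<gamma> < 1"
    "\<And>t. norm (Y t) \<le> c * \<gamma> ^ t * (\<Sum>k\<le>?r. norm (Y k))"
    using delay_decay[OF update_linear stable] by metis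
  let ?s = "\<Sum>k\<le>?r. norm (Y k)"
  have "(\<lambda>t. c * \<gamma> ^ t * ?s) \<longlonglongrightarrow> c * 0 * ?s"
    using c(1,2) by (intro tendsto_intros LIMSEQ_power_zero) auto
  then have lim: "(\<lambda>t. c * \<gamma> ^ t * ?s) \<longlonglongrightarrow> 0" by simp
  have "\<forall>\<^sub>F t in sequentially. norm (Y t) \<le> c * \<gamma> ^ t * ?s"
    by (rule always_eventually) (rule allI, rule c(3))
  then have "Y \<longlonglongrightarrow> 0" using lim by (rule Lim_null_comparison)
  then have "(\<lambda>t. Y (t + ?r)) \<longlonglongrightarrow> 0" by (rule LIMSEQ_ignore_initial_segment)
  moreover have "Y (t + ?r) = (\<Sum>k\<le>degree f. coeff f k *\<^sub>R (x (int (t + k)), z (int (t + k)), \<xi> (int (t + k))))" for t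
    unfolding Y_def Z_def by (intro sum.cong refl) (simp add: algebra_simps)
  ultimately show ?thesis by simp
qed

lemma regulated_output_eq:
  "regulated_output (A, B, E, C) w F v x t i = tracking_error w (x t, z, \<xi>) (v t) i"
  by (cases "w $ i") (simp add: regulated_output_def follower_output_def leader_output_def tracking_error_def)

lemma regulated_output_tendsto_0:
  fixes H' :: "real^'N^'N"
  assumes "H' ** H = mat 1"
    and "\<And>i. (\<lambda>t. relative_error w (x (int t), z (int t), \<xi> (int t)) (v (int t)) i) \<longlonglongrightarrow> 0"
  shows "(\<lambda>t. regulated_output (A, B, E, C) w F v x (int t) i) \<longlonglongrightarrow> 0"
proof -
  let ?e = "\<lambda>t. tracking_error w (x (int t), z (int t), \<xi> (int t)) (v (int t))"
  have eq: "regulated_output (A, B, E, C) w F v x (int t) i =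
      (\<Sum>j\<in>UNIV. H' $ i $ j *\<^sub>R relative_error w (x (int t), z (int t), \<xi> (int t)) (v (int t)) j)" for t
  proof -
    have "(\<Sum>j\<in>UNIV. H' $ i $ j *\<^sub>R relative_error w (x (int t), z (int t), \<xi> (int t)) (v (int t)) j) =
        (\<Sum>j\<in>UNIV. \<Sum>k\<in>UNIV. (H' $ i $ j * H $ j $ k) *\<^sub>R ?e t k)"
      by (simp add: relative_error_def scaleR_sum_right)
    also have "\<dots> = (\<Sum>k\<in>UNIV. (H' ** H) $ i $ k *\<^sub>R ?e t k)"
      by (subst sum.swap) (simp add: matrix_matrix_mult_def scaleR_sum_left)
    also have "\<dots> = (\<Sum>k\<in>UNIV. if i = k then ?e t k else 0)"
      unfolding assms(1) by (intro sum.cong refl) (simp add: mat_def)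
    also have "\<dots> = ?e t i" by simp
    finally show ?thesis by (simp add: regulated_output_eq[where z = "z (int t)" and \<xi> = "\<xi> (int t)"])
  qed
  have "(\<lambda>t. \<Sum>j\<in>UNIV. H' $ i $ j *\<^sub>R relative_error w (x (int t), z (int t), \<xi> (int t)) (v (int t)) j)
      \<longlonglongrightarrow> (\<Sum>j\<in>(UNIV :: 'N set). H' $ i $ j *\<^sub>R 0)"
    by (intro tendsto_intros assms(2))
  then show ?thesis by (simp add: eq)
qed

section \<open>Necessity of the spanning tree\<close>

text \<open>The history is extended by one value at a time.\<close>

lemma trajectory_exists:
  fixes X0 :: "int \<Rightarrow> ('n, 'k, 'N) loop_state"
  obtains X where "\<And>s. s \<le> 0 \<Longrightarrow> X s = X0 s"
    "\<And>t. 0 \<le> t \<Longrightarrow> X (t + 1) = update w (X t) (X (t - int r)) 0"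
proof -
  define hist where "hist = rec_nat X0 (\<lambda>k h. h(int k + 1 := update w (h (int k)) (h (int k - int r)) 0))"
  have h0: "hist 0 = X0" by (simp add: hist_def)
  have hS: "hist (Suc k) = (hist k)(int k + 1 := update w (hist k (int k)) (hist k (int k - int r)) 0)" for k
    by (simp add: hist_def)
  have stable: "hist (k + m) s = hist k s" if "s \<le> int k" for k m s
    using that by (induction m) (simp_all add: hS)
  define X where "X s = hist (nat s) s" for s
  have X_hist: "X s = hist k s" if "s \<le> int k" for s k
  proof -
    have "hist (nat s + (k - nat s)) s = hist (nat s) s" by (rule stable) simp
    moreover have "nat s + (k - nat s) = k" using that by simp
    ultimately show ?thesis by (simp add: X_def)
  qed
  have "X s = X0 s" if "s \<le> 0" for s using X_hist[of s 0] that by (simp add: h0)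
  moreover have "X (t + 1) = update w (X t) (X (t - int r)) 0" if "0 \<le> t" for t
  proof -
    define k where "k = nat t"
    have k: "t = int k" using that by (simp add: k_def)
    have "X (t + 1) = hist (Suc k) (int k + 1)" unfolding k by (rule X_hist) simp
    also have "\<dots> = update w (hist k (int k)) (hist k (int k - int r)) 0"
      by (simp only: hS fun_upd_same)
    also have "hist k (int k) = X t" unfolding k by (rule X_hist[symmetric]) simp
    also have "hist k (int k - int r) = X (t - int r)" unfolding k by (rule X_hist[symmetric]) simp
    finally show ?thesis .
  qed
  ultimately show thesis using that by blast
qed

text \<open>All followers get the initial state \<open>(0, z0, 0)\<close> and zero past.  On the set \<open>U\<close> of unreachable followers
the states stay equal, hence relative signals vanish there and \<open>z\<^sub>i(t) = G1\<^sup>t z0\<close>; the vector \<open>z0\<close> is the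
real or the imaginary part of an eigenvector whose eigenvalue has modulus one.\<close>

lemma reachable_if_exp_stable:
  assumes stable: "nominally_exp_stable edges a (A, B, E, C) S F rcon rcom G1 G2 K1 K2 L"
    and \<mu>: "\<mu> \<in> spectrum G1" "cmod \<mu> = 1"
  shows "(None, j) \<in> edges\<^sup>*"
proof (rule ccontr)
  assume unreachable: "(None, j) \<notin> edges\<^sup>*"
  let ?r = "rcom + rcon"
  define U where "U = {i. (None, Some i) \<notin> edges\<^sup>*}"
  obtain i0 where i0: "i0 \<in> U"
    using unreachable by (cases j) (auto simp: U_def)
  have isolated: "relative_signal edges a 0 f i = 0" if i: "i \<in> U" and f: "\<And>k. k \<in> U \<Longrightarrow> f k = f i"
    for f :: "'N \<Rightarrow> 'v::real_vector" and i
    unfolding relative_signal_def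
  proof (intro sum.neutral ballI)
    fix k assume "k \<in> neighbors edges (Some i)"
    then have e: "(k, Some i) \<in> edges" by (simp add: neighbors_def)
    have "(None, k) \<notin> edges\<^sup>*"
      using i e unfolding U_def by (metis mem_Collect_eq rtrancl_into_rtrancl)
    then obtain l where "k = Some l" "l \<in> U" by (cases k) (auto simp: U_def)
    then show "a (Some i) k *\<^sub>R (f i - case_option 0 f k) = 0" using f by simp
  qed
  obtain z0 where z0: "\<not> (\<lambda>t. matpow G1 t *v z0) \<longlonglongrightarrow> 0"
  proof -
    obtain y where y: "y \<noteq> 0" "cmatrix G1 *v y = \<mu> *s y" using \<mu>(1) by (auto simp: spectrum_def)
    have cpow: "matpow (cmatrix G1) t = cmatrix (matpow G1 t)" for t
      by (induction t) (simp_all add: cmatrix_mult cmatrix_mat)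
    have ypow: "cmatrix (matpow G1 t) *v y = \<mu> ^ t *s y" for t
    proof (induction t)
      case (Suc t)
      then show ?case unfolding cpow[symmetric] matpow_Suc_vec
        by (simp add: matrix_vector_mult_vector_scalar y(2) vector_smult_assoc mult.commute)
    qed (simp add: cmatrix_mat)
    have ny: "(norm (matpow G1 t *v vRe y))\<^sup>2 + (norm (matpow G1 t *v vIm y))\<^sup>2 = (norm y)\<^sup>2" for t
    proof -
      have "(norm (\<mu> ^ t *s y))\<^sup>2 = (norm (vRe (\<mu> ^ t *s y)))\<^sup>2 + (norm (vIm (\<mu> ^ t *s y)))\<^sup>2"
        unfolding power2_norm_eq_inner by (rule complex_vec_inner)
      then show ?thesis
        unfolding ypow[symmetric] vRe_vIm_cmatrix
        unfolding ypow by (simp add: norm_vector_scalar_mult norm_power \<mu>(2))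
    qed
    have False if "(\<lambda>t. matpow G1 t *v vRe y) \<longlonglongrightarrow> 0" "(\<lambda>t. matpow G1 t *v vIm y) \<longlonglongrightarrow> 0"
    proof -
      have "(\<lambda>t. (norm (matpow G1 t *v vRe y))\<^sup>2 + (norm (matpow G1 t *v vIm y))\<^sup>2) \<longlonglongrightarrow>
          (norm (0 :: real^'k))\<^sup>2 + (norm (0 :: real^'k))\<^sup>2"
        by (intro tendsto_intros that)
      then have "(\<lambda>t::nat. (norm y)\<^sup>2) \<longlonglongrightarrow> 0" unfolding ny by simp
      then show False using y(1) by (simp add: LIMSEQ_const_iff)
    qed
    then show thesis using that by blast
  qed
  obtain X where X0: "\<And>s. s \<le> 0 \<Longrightarrow> X s = (if s = 0 then (0, \<chi> i. z0, 0) else 0)"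
    and Xstep: "\<And>t. 0 \<le> t \<Longrightarrow> X (t + 1) = update 0 (X t) (X (t - int ?r)) 0"
    using trajectory_exists[of "\<lambda>s. if s = 0 then (0, \<chi> i. z0, 0) else 0" 0 ?r] by blast
  have Xs: "X (int t + 1) = update 0 (X (int t)) (X (int t - int ?r)) 0" for t
    by (rule Xstep) simp
  define same where "same Y \<longleftrightarrow> (\<forall>i\<in>U. fst Y $ i = fst Y $ i0 \<and> fst (snd Y) $ i = fst (snd Y) $ i0 \<and>
      snd (snd Y) $ i = snd (snd Y) $ i0)" for Y :: "('n, 'k, 'N) loop_state"
  have net0: "(\<Sum>j\<in>UNIV. H $ i $ j *\<^sub>R (snd (snd Y) $ j)) = 0" if "same Y" "i \<in> U" for Y i
    unfolding relative_signal_network_matrix[symmetric]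
    by (rule isolated[OF that(2)]) (use that in \<open>unfold same_def, metis\<close>)
  have err0: "relative_error 0 Y 0 i = 0" if "same Y" "i \<in> U" for Y i
    unfolding relative_error_def relative_signal_network_matrix[symmetric]
    by (rule isolated[OF that(2)]) (use that in \<open>unfold same_def tracking_error_def, metis zero_index\<close>)
  have step: "same (update 0 Y Y' 0) \<and> (\<forall>i\<in>U. fst (snd (update 0 Y Y' 0)) $ i = G1 *v (fst (snd Y) $ i))"
    if "same Y" "same Y'" for Y Y'
  proof -
    have inp: "input Y' i = K1 *v (fst (snd Y') $ i0)" if "i \<in> U" for i
    proof -
      have "fst (snd Y') $ i = fst (snd Y') $ i0" using \<open>same Y'\<close> that unfolding same_def by blast
      then show ?thesis by (simp add: input_def net0[OF \<open>same Y'\<close> that])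
    qed
    have upd: "fst (update 0 Y Y' 0) $ i = A *v (fst Y $ i0) + B *v (K1 *v (fst (snd Y') $ i0)) \<and>
        fst (snd (update 0 Y Y' 0)) $ i = G1 *v (fst (snd Y) $ i) \<and>
        fst (snd Y) $ i = fst (snd Y) $ i0 \<and>
        snd (snd (update 0 Y Y' 0)) $ i = A *v (snd (snd Y) $ i0) + B *v (K1 *v (fst (snd Y') $ i0))"
      if "i \<in> U" for i
    proof -
      have Y: "fst Y $ i = fst Y $ i0" "fst (snd Y) $ i = fst (snd Y) $ i0" "snd (snd Y) $ i = snd (snd Y) $ i0"
        using \<open>same Y\<close> that unfolding same_def by blast+
      show ?thesis
        by (simp add: update_def inp[OF that] net0[OF \<open>same Y\<close> that] err0[OF \<open>same Y\<close> that] Y)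
    qed
    show ?thesis using upd i0 unfolding same_def by metis
  qed
  have same: "same (X s)" if "s \<le> int t" for s t
    using that
  proof (induction t arbitrary: s)
    case 0
    then have "X s = (if s = 0 then (0, \<chi> i. z0, 0) else 0)" using X0 by simp
    then show ?case by (simp add: same_def)
  next
    case (Suc t)
    show ?case
    proof (cases "s \<le> int t")
      case False
      then have s: "s = int t + 1" using Suc.prems by simp
      have "same (X (int t))" "same (X (int t - int ?r))" using Suc.IH by simp_all
      then show ?thesis unfolding s Xs using step by blast
    qed (rule Suc.IH)
  qed
  have Xz: "fst (snd (X (int t))) $ i0 = matpow G1 t *v z0" for t
  proof (induction t)
    case 0
    then show ?case using X0[of 0] by simp
  next
    case (Suc t)
    have "same (X (int t))" "same (X (int t - int ?r))" using same[of _ t] by simp_all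
    from step[OF this] have "fst (snd (X (int t + 1))) $ i0 = G1 *v (fst (snd (X (int t))) $ i0)"
      unfolding Xs using i0 by blast
    then show ?case unfolding Suc matpow_Suc_vec[symmetric] by (simp add: add.commute)
  qed
  have cl: "closed_loop edges a (A, B, E, C) S F rcon rcom G1 G2 K1 K2 L 0 (\<lambda>_. 0)
      (\<lambda>s. fst (X s)) (\<lambda>s. fst (snd (X s))) (\<lambda>s. snd (snd (X s)))"
    unfolding closed_loop_update using Xstep by simp
  from stable obtain c \<gamma> where c: "0 < \<gamma>" "\<gamma> < 1" and
    dec: "\<forall>x z \<xi>. closed_loop edges a (A, B, E, C) S F rcon rcom G1 G2 K1 K2 L 0 (\<lambda>_. 0) x z \<xi> \<longrightarrow>
      (\<forall>t. norm (x (int t), z (int t), \<xi> (int t)) \<le>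
        c * \<gamma> ^ t * (MAX s\<in>{- int (rcom + rcon)..0}. norm (x s, z s, \<xi> s)))"
    unfolding nominally_exp_stable_def by (elim exE conjE)
  have decX: "norm (X (int t)) \<le> c * \<gamma> ^ t * (MAX s\<in>{- int ?r..0}. norm (X s))" for t
    using dec[rule_format, OF cl, of t] by (simp only: prod.collapse)
  let ?s = "MAX s\<in>{- int ?r..0}. norm (X s)"
  have "(\<lambda>t. c * \<gamma> ^ t * ?s) \<longlonglongrightarrow> c * 0 * ?s"
    using c by (intro tendsto_intros LIMSEQ_power_zero) auto
  then have lim: "(\<lambda>t. c * \<gamma> ^ t * ?s) \<longlonglongrightarrow> 0" by simp
  have "norm (matpow G1 t *v z0) \<le> c * \<gamma> ^ t * ?s" for t
  proof -
    have "norm (fst (snd (X (int t))) $ i0) \<le> norm (fst (snd (X (int t))))" by (rule Finite_Cartesian_Product.norm_nth_le)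
    also have "\<dots> \<le> norm (snd (X (int t)))" by (metis norm_fst_le prod.collapse)
    also have "\<dots> \<le> norm (X (int t))" by (metis norm_snd_le prod.collapse)
    also have "\<dots> \<le> c * \<gamma> ^ t * ?s" by (rule decX)
    finally show ?thesis by (simp only: Xz)
  qed
  then have "\<forall>\<^sub>F t in sequentially. norm (matpow G1 t *v z0) \<le> c * \<gamma> ^ t * ?s" by simp
  then have "(\<lambda>t. matpow G1 t *v z0) \<longlonglongrightarrow> 0" using lim by (rule Lim_null_comparison)
  with z0 show False ..
qed

end

section \<open>Block matrices and copies\<close>

lemma sum_UNIV_Plus:
  fixes f :: "'a::finite + 'b::finite \<Rightarrow> 'c::comm_monoid_add"
  shows "(\<Sum>i\<in>UNIV. f i) = (\<Sum>i\<in>UNIV. f (Inl i)) + (\<Sum>i\<in>UNIV. f (Inr i))"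
proof -
  have "(\<Sum>i\<in>UNIV. f i) = (\<Sum>i\<in>UNIV <+> UNIV. f i)" by simp
  also have "\<dots> = (\<Sum>i\<in>UNIV. f (Inl i)) + (\<Sum>i\<in>UNIV. f (Inr i))"
    by (subst sum.Plus) auto
  finally show ?thesis .
qed

definition join :: "'a^'n \<Rightarrow> 'a^'k \<Rightarrow> 'a^('n::finite + 'k::finite)" where
  "join u v = (\<chi> i. case i of Inl k \<Rightarrow> u $ k | Inr k \<Rightarrow> v $ k)"

lemma join_nth [simp]: "join u v $ Inl k = u $ k" "join u v $ Inr l = v $ l"
  by (simp_all add: join_def)

lemma vec_sum_eqI: "(\<And>k. x $ Inl k = y $ Inl k) \<Longrightarrow> (\<And>k. x $ Inr k = y $ Inr k) \<Longrightarrow> x = y"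
  unfolding vec_eq_iff by (metis old.sum.exhaust)

lemma join_eq_iff [simp]: "join u v = join u' v' \<longleftrightarrow> u = u' \<and> v = v'"
  unfolding vec_eq_iff by (metis join_nth old.sum.exhaust)

lemma join_exhaust: obtains u v where "x = join u v"
proof -
  have "x = join (\<chi> k. x $ Inl k) (\<chi> k. x $ Inr k)"
    by (rule vec_sum_eqI) simp_all
  then show thesis using that by blast
qed

lemma join_zero [simp]: "join 0 0 = 0"
  by (rule vec_sum_eqI) simp_all

lemma join_add: "join u v + join u' v' = join (u + u') (v + v')"
  by (rule vec_sum_eqI) simp_all

lemma join_smult: "c *s join u v = join (c *s u) (c *s v)"
  by (rule vec_sum_eqI) simp_all

lemma join_scaleR: "c *\<^sub>R join u v = join (c *\<^sub>R u) (c *\<^sub>R v)"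
  by (rule vec_sum_eqI) simp_all

lemma join_sum: "(\<Sum>j\<in>J. join (u j) (v j)) = join (\<Sum>j\<in>J. u j) (\<Sum>j\<in>J. v j)"
  by (induction J rule: infinite_finite_induct) (simp_all add: join_add)

definition stack :: "'a^'m^'n \<Rightarrow> 'a^'m^'k \<Rightarrow> 'a^'m^('n::finite + 'k::finite)" where
  "stack M M' = (\<chi> i. case i of Inl k \<Rightarrow> M $ k | Inr k \<Rightarrow> M' $ k)"

definition beside :: "'a^'n^'m \<Rightarrow> 'a^'k^'m \<Rightarrow> 'a^('n::finite + 'k::finite)^'m" where
  "beside M M' = (\<chi> i. join (M $ i) (M' $ i))"

lemma beside_exhaust: obtains M M' where "N = beside M M'"
proof -
  have "N = beside (\<chi> i k. N $ i $ Inl k) (\<chi> i k. N $ i $ Inr k)"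
    unfolding beside_def by (subst vec_eq_iff) (auto intro: vec_sum_eqI)
  then show thesis using that by blast
qed

lemma block_matrix_join:
  "block_matrix M11 M12 M21 M22 *v join u v = join (M11 *v u + M12 *v v) (M21 *v u + M22 *v v)"
  by (rule vec_sum_eqI) (simp_all add: matrix_vector_mult_def block_matrix_def sum_UNIV_Plus)

lemma join_block_matrix:
  "join p q v* block_matrix M11 M12 M21 M22 = join (p v* M11 + q v* M21) (p v* M12 + q v* M22)"
  by (rule vec_sum_eqI) (simp_all add: vector_matrix_mult_def block_matrix_def sum_UNIV_Plus)

lemma stack_vector: "stack M M' *v u = join (M *v u) (M' *v u)"
  by (rule vec_sum_eqI) (simp_all add: matrix_vector_mult_def stack_def)

lemma join_stack: "join p q v* stack M M' = p v* M + q v* M'"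
  by (simp add: vec_eq_iff vector_matrix_mult_def stack_def sum_UNIV_Plus)

lemma beside_join: "beside M M' *v join u v = M *v u + M' *v v"
  by (simp add: vec_eq_iff matrix_vector_mult_def beside_def sum_UNIV_Plus)

lemma cmatrix_block_matrix:
  "cmatrix (block_matrix M11 M12 M21 M22) = block_matrix (cmatrix M11) (cmatrix M12) (cmatrix M21) (cmatrix M22)"
  by (simp add: vec_eq_iff block_matrix_def split: sum.split)

lemma cmatrix_stack: "cmatrix (stack M M') = stack (cmatrix M) (cmatrix M')"
  by (simp add: vec_eq_iff stack_def split: sum.split)

lemma cmatrix_beside: "cmatrix (beside M M') = beside (cmatrix M) (cmatrix M')"
  by (simp add: vec_eq_iff beside_def join_def split: sum.split)

lemma kronecker_id_vector:
  fixes \<beta> :: "'a::comm_semiring_1^'s^'s"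
  shows "(kronecker (mat 1 :: 'a^'p^'p) \<beta> *v z) $ (k, s) = (\<beta> *v (\<chi> s. z $ (k, s))) $ s"
proof -
  have "(kronecker (mat 1 :: 'a^'p^'p) \<beta> *v z) $ (k, s) =
      (\<Sum>j\<in>UNIV. \<Sum>l\<in>UNIV. kronecker (mat 1 :: 'a^'p^'p) \<beta> $ (k, s) $ (j, l) * z $ (j, l))"
    by (simp add: matrix_vector_mult_def sum.cartesian_product)
  also have "\<dots> = (\<Sum>j\<in>UNIV. if k = j then \<Sum>l\<in>UNIV. \<beta> $ s $ l * z $ (j, l) else 0)"
    by (intro sum.cong refl) (simp add: kronecker_def mat_def)
  finally show ?thesis by (simp add: matrix_vector_mult_def)
qed

lemma vector_kronecker_id:
  fixes \<beta> :: "'a::comm_semiring_1^'s^'s"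
  shows "(z v* kronecker (mat 1 :: 'a^'p^'p) \<beta>) $ (k, s) = ((\<chi> s. z $ (k, s)) v* \<beta>) $ s"
proof -
  have "(z v* kronecker (mat 1 :: 'a^'p^'p) \<beta>) $ (k, s) =
      (\<Sum>j\<in>UNIV. \<Sum>l\<in>UNIV. kronecker (mat 1 :: 'a^'p^'p) \<beta> $ (j, l) $ (k, s) * z $ (j, l))"
    by (simp add: vector_matrix_mult_def sum.cartesian_product mult.commute)
  also have "\<dots> = (\<Sum>j\<in>UNIV. if j = k then \<Sum>l\<in>UNIV. \<beta> $ l $ s * z $ (j, l) else 0)"
    by (intro sum.cong refl) (simp add: kronecker_def mat_def)
  finally show ?thesis by (simp add: vector_matrix_mult_def mult.commute)
qed

lemma cmatrix_kronecker_id: "cmatrix (kronecker (mat 1) \<beta>) = kronecker (mat 1) (cmatrix \<beta>)"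
  by (simp add: vec_eq_iff kronecker_def mat_def)

lemma spectrum_kronecker_id:
  fixes \<beta> :: "real^'s^'s"
  shows "spectrum (kronecker (mat 1 :: real^'p^'p) \<beta>) = spectrum \<beta>"
proof (intro set_eqI iffI)
  fix \<mu> assume "\<mu> \<in> spectrum (kronecker (mat 1 :: real^'p^'p) \<beta>)"
  then obtain z where z: "z \<noteq> 0" "kronecker (mat 1 :: complex^'p^'p) (cmatrix \<beta>) *v z = \<mu> *s z"
    by (auto simp: spectrum_def cmatrix_kronecker_id)
  obtain k s where ks: "z $ (k, s) \<noteq> 0" using z(1) by (auto simp: vec_eq_iff)
  have "cmatrix \<beta> *v (\<chi> s. z $ (k, s)) = \<mu> *s (\<chi> s. z $ (k, s))"
  proof -
    have "(cmatrix \<beta> *v (\<chi> s. z $ (k, s))) $ s = \<mu> * z $ (k, s)" for s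
      unfolding kronecker_id_vector[symmetric, where 'p = 'p] z(2) by simp
    then show ?thesis by (simp add: vec_eq_iff)
  qed
  moreover have "(\<chi> s. z $ (k, s)) \<noteq> 0" using ks by (auto simp: vec_eq_iff)
  ultimately show "\<mu> \<in> spectrum \<beta>" by (auto simp: spectrum_def)
next
  fix \<mu> assume "\<mu> \<in> spectrum \<beta>"
  then obtain y where y: "y \<noteq> 0" "cmatrix \<beta> *v y = \<mu> *s y" by (auto simp: spectrum_def)
  let ?z = "(\<chi> p. y $ snd p) :: complex^('p \<times> 's)"
  have "kronecker (mat 1 :: complex^'p^'p) (cmatrix \<beta>) *v ?z = \<mu> *s ?z"
    using y(2) by (simp add: vec_eq_iff kronecker_id_vector split_paired_all)
  moreover have "?z \<noteq> 0" using y(1) by (auto simp: vec_eq_iff)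
  ultimately show "\<mu> \<in> spectrum (kronecker (mat 1 :: real^'p^'p) \<beta>)"
    by (auto simp: spectrum_def cmatrix_kronecker_id)
qed

lemma copy_input_vector:
  fixes \<sigma> :: "real^1^'s"
  shows "((\<chi> i j. kronecker (mat 1 :: real^'p^'p) \<sigma> $ i $ (j, 1)) *v y) $ (k, s) = y $ k * \<sigma> $ s $ 1"
proof -
  have "((\<chi> i j. kronecker (mat 1 :: real^'p^'p) \<sigma> $ i $ (j, 1)) *v y) $ (k, s) =
      (\<Sum>j\<in>UNIV. kronecker (mat 1 :: real^'p^'p) \<sigma> $ (k, s) $ (j, 1) * y $ j)"
    by (simp add: matrix_vector_mult_def)
  also have "\<dots> = (\<Sum>j\<in>UNIV. if k = j then \<sigma> $ s $ 1 * y $ j else 0)"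
    by (intro sum.cong refl) (simp add: kronecker_def mat_def)
  finally show ?thesis by simp
qed

lemma vector_copy_input:
  fixes \<sigma> :: "real^1^'s"
  shows "(q v* cmatrix (\<chi> i j. kronecker (mat 1 :: real^'p^'p) \<sigma> $ i $ (j, 1))) $ k =
    (\<Sum>s\<in>UNIV. of_real (\<sigma> $ s $ 1) * q $ (k, s))"
proof -
  have "(q v* cmatrix (\<chi> i j. kronecker (mat 1 :: real^'p^'p) \<sigma> $ i $ (j, 1))) $ k =
      (\<Sum>j\<in>UNIV. \<Sum>s\<in>UNIV. of_real (kronecker (mat 1 :: real^'p^'p) \<sigma> $ (j, s) $ (k, 1)) * q $ (j, s))"
    by (simp add: vector_matrix_mult_def sum.cartesian_product mult.commute)
  also have "\<dots> = (\<Sum>j\<in>UNIV. if j = k then \<Sum>s\<in>UNIV. of_real (\<sigma> $ s $ 1) * q $ (j, s) else 0)"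
    by (intro sum.cong refl) (simp add: kronecker_def mat_def)
  finally show ?thesis by simp
qed

section \<open>Eigenvector tests for controllability\<close>

text \<open>The rank counts independent rows; if it equals the number of rows, these are distinct and independent.\<close>

lemma full_row_rank_left_kernel:
  fixes M :: "'a::field^'n^'m"
  assumes rank: "rank M = CARD('m)" and x: "x v* M = 0"
  shows "x = 0"
proof -
  have rows: "rows M = range (\<lambda>i. row i M)" by (auto simp: rows_def)
  have "vec.dim (rows M) \<le> card (rows M)"
    by (rule vec.dim_le_card) (auto simp: rows vec.span_base)
  moreover have "card (rows M) \<le> CARD('m)" unfolding rows by (rule card_image_le) simp
  moreover have dim: "vec.dim (rows M) = CARD('m)" using rank by (simp add: row_rank_def_gen)
  ultimately have card: "card (rows M) = CARD('m)" by simp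
  then have inj: "inj (\<lambda>i. row i M)" unfolding rows by (rule eq_card_imp_inj_on[rotated]) simp
  have indep: "vec.independent (rows M)"
    using vec.card_eq_dim[of "rows M" "rows M"] card dim by (simp add: rows vec.span_superset)
  let ?u = "\<lambda>v. x $ (inv (\<lambda>i. row i M) v)"
  have "(\<Sum>v\<in>rows M. ?u v *s v) = (\<Sum>i\<in>UNIV. x $ i *s row i M)"
    unfolding rows by (subst sum.reindex[OF inj]) (simp add: inv_f_f[OF inj])
  also have "\<dots> = x v* M"
    by (simp add: vec_eq_iff vector_matrix_mult_def row_def mult.commute)
  finally have "(\<Sum>v\<in>rows M. ?u v *s v) = 0" using x by simp
  then have "?u (row i M) = 0" for i
    by (intro vec.independentD[OF indep]) (auto simp: rows)
  then show ?thesis by (simp add: vec_eq_iff inv_f_f[OF inj])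
qed

lemma stabilizable_PBH:
  assumes "stabilizable A B" "1 \<le> cmod \<mu>" "x v* cmatrix A = \<mu> *s x" "x v* cmatrix B = 0"
  shows "x = 0"
proof (rule ccontr)
  assume "x \<noteq> 0"
  obtain K where K: "schur (A + B ** K)" using assms(1) by (auto simp: stabilizable_def)
  have "x v* cmatrix (A + B ** K) = \<mu> *s x"
    by (simp add: cmatrix_add cmatrix_mult vector_matrix_mult_add_rdistrib assms(3,4)
        flip: vector_matrix_mul_assoc)
  then have "\<mu> \<in> spectrum (A + B ** K)" by (rule left_spectrum[OF \<open>x \<noteq> 0\<close>])
  then show False using K assms(2) by (auto simp: schur_def)
qed

lemma detectable_PBH:
  assumes "detectable C A" "1 \<le> cmod \<mu>" "cmatrix A *v x = \<mu> *s x" "cmatrix C *v x = 0"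
  shows "x = 0"
proof (rule ccontr)
  assume "x \<noteq> 0"
  obtain L where L: "schur (A + L ** C)" using assms(1) by (auto simp: detectable_def)
  have "cmatrix (A + L ** C) *v x = \<mu> *s x"
    by (simp add: cmatrix_add cmatrix_mult matrix_vector_mult_add_rdistrib assms(3,4)
        flip: matrix_vector_mul_assoc)
  then have "\<mu> \<in> spectrum (A + L ** C)" using \<open>x \<noteq> 0\<close> by (auto simp: spectrum_def)
  then show False using L assms(2) by (auto simp: schur_def)
qed

text \<open>A left eigenvector orthogonal to \<open>\<sigma>\<close> is orthogonal to all \<open>\<beta>\<^sup>k \<sigma>\<close>.\<close>

lemma controllable_PBH:
  fixes \<beta> :: "real^'s^'s" and \<sigma> :: "real^1^'s"
  assumes ctrl: "controllable \<beta> \<sigma>" and y: "y v* cmatrix \<beta> = \<mu> *s y"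
    and b: "(\<Sum>s\<in>UNIV. of_real (\<sigma> $ s $ 1) * y $ s) = 0"
  shows "y = 0"
proof -
  let ?b = "column 1 \<sigma>"
  have pow: "y v* cmatrix (matpow \<beta> k) = \<mu> ^ k *s y" for k
  proof (induction k)
    case (Suc k)
    have "y v* cmatrix (matpow \<beta> (Suc k)) = (y v* cmatrix \<beta>) v* cmatrix (matpow \<beta> k)"
      by (simp add: cmatrix_mult vector_matrix_mul_assoc)
    then show ?case using Suc by (simp add: y vector_scalar_matrix vector_smult_assoc)
  qed (simp add: cmatrix_mat)
  have cb: "vRe y \<bullet> ?b = 0" "vIm y \<bullet> ?b = 0"
  proof -
    have "vRe y \<bullet> ?b = Re (\<Sum>s\<in>UNIV. of_real (\<sigma> $ s $ 1) * y $ s)"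
      "vIm y \<bullet> ?b = Im (\<Sum>s\<in>UNIV. of_real (\<sigma> $ s $ 1) * y $ s)"
      by (simp_all add: inner_vec_def column_def mult.commute)
    then show "vRe y \<bullet> ?b = 0" "vIm y \<bullet> ?b = 0" unfolding b by simp_all
  qed
  have "vRe y \<bullet> (matpow \<beta> k *v ?b) = 0" "vIm y \<bullet> (matpow \<beta> k *v ?b) = 0" for k
    unfolding dot_lmul_matrix[symmetric] vRe_vIm_cmatrix_left[symmetric] pow vRe_vIm_smult
    by (simp_all add: inner_diff_left inner_add_left cb)
  then have "vRe y = 0" "vIm y = 0" using controllable_orthogonal[OF ctrl] by blast+
  then show ?thesis by (simp add: complex_vec_eq_iff)
qed

section \<open>The choice of the gains\<close>

lemma transpose_kernel:
  fixes M :: "complex^'n^'n"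
  assumes "\<And>x. M *v x = 0 \<Longrightarrow> x = 0" and "transpose M *v x = 0"
  shows "x = 0"
proof (rule ccontr)
  assume "x \<noteq> 0"
  then have "det (transpose M) = 0" using assms(2) det_eq_0_kernel by blast
  then have "det M = 0" by simp
  then show False using assms(1) det_eq_0_kernel by blast
qed

text \<open>The transposed plant satisfies the assumptions of \<open>low_gain_feedback\<close>, and a matrix and its transpose are
singular together.\<close>

lemma observer_gain:
  fixes A :: "real^'n^'n" and C :: "real^'n^'p"
  assumes \<Lambda>: "finite \<Lambda>" "\<And>\<mu>. \<mu> \<in> \<Lambda> \<Longrightarrow> 0 < Re \<mu>"
    and spec: "\<And>\<mu>. \<mu> \<in> spectrum A \<Longrightarrow> cmod \<mu> \<le> 1" and det: "detectable C A"
  shows "\<exists>L. \<forall>\<mu>\<in>\<Lambda>. \<forall>\<zeta> x. 1 \<le> cmod \<zeta> \<longrightarrow>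
    \<zeta> *s x = cmatrix A *v x + \<mu> *s (- cmatrix (L ** C) *v x) \<longrightarrow> x = 0"
proof -
  have "\<exists>K. \<forall>\<mu>\<in>\<Lambda>. \<forall>z x. 1 \<le> cmod z \<longrightarrow>
    z *s x = cmatrix (transpose A) *v x +
      (\<mu> * inverse z ^ 0) *s (cmatrix (transpose C) *v (cmatrix K *v x)) \<longrightarrow> x = 0"
  proof (rule low_gain_feedback[OF \<Lambda>])
    show "cmod \<mu> \<le> 1" if "\<mu> \<in> spectrum (transpose A)" for \<mu>
      using that spec by (simp add: spectrum_transpose)
    show "x = 0" if "cmod \<mu> = 1" "x v* cmatrix (transpose A) = \<mu> *s x" "x v* cmatrix (transpose C) = 0"
      for \<mu> x
      using detectable_PBH[OF det, of \<mu> x] that by (simp add: cmatrix_transpose)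
  qed
  then obtain K :: "real^'n^'p" where K: "\<And>\<mu> z x. \<mu> \<in> \<Lambda> \<Longrightarrow> 1 \<le> cmod z \<Longrightarrow>
    z *s x = cmatrix (transpose A) *v x + \<mu> *s (cmatrix (transpose C) *v (cmatrix K *v x)) \<Longrightarrow> x = 0"
    by auto
  define L where "L = - transpose K"
  have "x = 0" if \<mu>: "\<mu> \<in> \<Lambda>" and z: "1 \<le> cmod \<zeta>"
    and x: "\<zeta> *s x = cmatrix A *v x + \<mu> *s (- cmatrix (L ** C) *v x)" for \<mu> \<zeta> x
  proof -
    let ?M = "mat \<zeta> - cmatrix (transpose A) - mat \<mu> ** (cmatrix (transpose C) ** cmatrix K)"
    have "y = 0" if "?M *v y = 0" for y
    proof (rule K[OF \<mu> z])
      show "\<zeta> *s y = cmatrix (transpose A) *v y + \<mu> *s (cmatrix (transpose C) *v (cmatrix K *v y))"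
        using that by (simp add: matrix_vector_mult_diff_rdistrib mat_vector_mult
            diff_eq_eq add.commute del: transpose_matrix_vector flip: matrix_vector_mul_assoc)
    qed
    moreover have "transpose ?M *v x = 0"
    proof -
      have LC: "- cmatrix (L ** C) = transpose (cmatrix K) ** cmatrix C"
        by (simp add: L_def vec_eq_iff matrix_matrix_mult_def transpose_def sum_negf)
      have "transpose ?M = mat \<zeta> - cmatrix A - transpose (cmatrix K) ** cmatrix C ** mat \<mu>"
        by (simp add: transpose_diff matrix_transpose_mul cmatrix_transpose[symmetric])
      then have "transpose ?M *v x = \<zeta> *s x - cmatrix A *v x - \<mu> *s ((transpose (cmatrix K) ** cmatrix C) *v x)"
        by (simp only: matrix_vector_mult_diff_rdistrib matrix_vector_mul_assoc[symmetric]
            mat_vector_mult matrix_vector_mult_vector_scalar)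
      then show ?thesis using x unfolding LC by (simp only:) simp
    qed
    ultimately show ?thesis by (rule transpose_kernel)
  qed
  then show ?thesis by blast
qed

text \<open>The plant followed by the internal model of its output.  A left eigenvector \<open>(p, q)\<close> with \<open>q \<noteq> 0\<close> belongs to
an eigenvalue of \<open>S\<close>; the rank condition at this eigenvalue gives \<open>p = 0\<close> and \<open>G2\<^sup>T q = 0\<close>, and then
controllability of \<open>(\<beta>, \<sigma>)\<close> gives \<open>q = 0\<close>.  If \<open>q = 0\<close>, stabilizability of \<open>(A, B)\<close> applies.\<close>

lemma servo_gain:
  fixes A :: "real^'n^'n" and B :: "real^'m^'n" and C :: "real^'n^'p" and S :: "real^'q^'q"
    and G1 :: "real^('p::finite \<times> 's::finite)^('p \<times> 's)" and G2 :: "real^'p^('p \<times> 's)"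
  assumes \<Lambda>: "finite \<Lambda>" "\<And>\<mu>. \<mu> \<in> \<Lambda> \<Longrightarrow> 0 < Re \<mu>"
    and stab: "stabilizable A B"
    and rank: "\<forall>\<mu>\<in>spectrum S. rank (block_matrix (cmatrix A - mat \<mu>) (cmatrix B) (cmatrix C) 0) = CARD('n) + CARD('p)"
    and specS: "\<forall>\<mu>\<in>spectrum S. cmod \<mu> = 1"
    and specA: "\<forall>\<mu>\<in>spectrum A. cmod \<mu> \<le> 1"
    and im: "minimal_p_copy_internal_model S G1 G2"
  shows "\<exists>K1 K2. \<forall>\<mu>\<in>\<Lambda>. \<forall>\<zeta> x. 1 \<le> cmod \<zeta> \<longrightarrow>
    \<zeta> *s x = cmatrix (block_matrix A 0 (G2 ** C) G1) *v x +
      (\<mu> * inverse \<zeta> ^ r) *s (cmatrix (stack B 0) *v (cmatrix (beside K2 K1) *v x)) \<longrightarrow> x = 0"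
proof -
  obtain \<beta> :: "real^'s^'s" and \<sigma> :: "real^1^'s" where im: "is_min_poly S (char_poly \<beta>)" "controllable \<beta> \<sigma>"
    "G1 = kronecker (mat 1) \<beta>" "G2 = (\<chi> i j. kronecker (mat 1 :: real^'p^'p) \<sigma> $ i $ (j, 1))"
    using im by (auto simp: minimal_p_copy_internal_model_def)
  have specG1: "\<mu> \<in> spectrum S" if "\<mu> \<in> spectrum G1" for \<mu>
    using that min_poly_root_in_spectrum[OF im(1)] by (simp add: im(3) spectrum_kronecker_id char_poly_root_iff)
  let ?A = "block_matrix A 0 (G2 ** C) G1" and ?B = "stack B 0 :: real^'m^('n + 'p \<times> 's)"
  have "\<exists>K. \<forall>\<mu>\<in>\<Lambda>. \<forall>\<zeta> x. 1 \<le> cmod \<zeta> \<longrightarrow> \<zeta> *s x = cmatrix ?A *v x +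
      (\<mu> * inverse \<zeta> ^ r) *s (cmatrix ?B *v (cmatrix K *v x)) \<longrightarrow> x = 0"
  proof (rule low_gain_feedback[OF \<Lambda>])
    fix \<mu> assume "\<mu> \<in> spectrum ?A"
    then obtain x where x: "x \<noteq> 0" "cmatrix ?A *v x = \<mu> *s x" by (auto simp: spectrum_def)
    obtain u v where uv: "x = join u v" by (rule join_exhaust)
    have eq: "cmatrix A *v u = \<mu> *s u" "cmatrix (G2 ** C) *v u + cmatrix G1 *v v = \<mu> *s v"
      using x(2) by (simp_all add: uv cmatrix_block_matrix block_matrix_join join_smult)
    show "cmod \<mu> \<le> 1"
    proof (cases "u = 0")
      case False
      then show ?thesis using eq(1) specA by (auto simp: spectrum_def)
    next
      case True
      then have "cmatrix G1 *v v = \<mu> *s v" "v \<noteq> 0" using eq(2) x(1) uv by auto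
      then have "\<mu> \<in> spectrum G1" by (auto simp: spectrum_def)
      then show ?thesis using specG1 specS by force
    qed
  next
    fix \<mu> x assume \<mu>: "cmod \<mu> = 1" and x: "x v* cmatrix ?A = \<mu> *s x" "x v* cmatrix ?B = 0"
    obtain p q where pq: "x = join p q" by (rule join_exhaust)
    have eq: "p v* cmatrix A + q v* cmatrix (G2 ** C) = \<mu> *s p" "q v* cmatrix G1 = \<mu> *s q"
      "p v* cmatrix B = 0"
      using x by (simp_all add: pq cmatrix_block_matrix join_block_matrix join_smult cmatrix_stack join_stack)
    show "x = 0"
    proof (cases "q = 0")
      case True
      then have "p = 0" using stabilizable_PBH[OF stab, of \<mu> p] eq \<mu> by simp
      then show ?thesis using True pq by simp
    next
      case False
      have "\<mu> \<in> spectrum S" using specG1 left_spectrum[OF False eq(2)] .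
      then have rk: "rank (block_matrix (cmatrix A - mat \<mu>) (cmatrix B) (cmatrix C) 0) = CARD('n + 'p)"
        using rank by simp
      have "p v* mat \<mu> = \<mu> *s p"
        using mat_vector_mult[of \<mu> p] by (metis transpose_mat transpose_matrix_vector)
      then have "join p (q v* cmatrix G2) v* block_matrix (cmatrix A - mat \<mu>) (cmatrix B) (cmatrix C) 0 = 0"
        using eq(1,3) by (simp add: join_block_matrix vector_matrix_mult_diff_rdistrib cmatrix_mult
            flip: vector_matrix_mul_assoc) (simp add: algebra_simps flip: join_zero)
      from full_row_rank_left_kernel[OF rk this]
      have p0: "p = 0" and q0: "q v* cmatrix G2 = 0" by (simp_all flip: join_zero)
      have "(\<chi> s. q $ (k, s)) = 0" for k
      proof (rule controllable_PBH[OF im(2)])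
        have "((\<chi> s. q $ (k, s)) v* cmatrix \<beta>) $ s = \<mu> * q $ (k, s)" for s
          unfolding vector_kronecker_id[symmetric, where 'p = 'p] cmatrix_kronecker_id[symmetric] im(3)[symmetric] eq(2)
          by simp
        then show "(\<chi> s. q $ (k, s)) v* cmatrix \<beta> = \<mu> *s (\<chi> s. q $ (k, s))" by (simp add: vec_eq_iff)
        have "(q v* cmatrix G2) $ k = 0" by (simp add: q0)
        then show "(\<Sum>s\<in>UNIV. of_real (\<sigma> $ s $ 1) * (\<chi> s. q $ (k, s)) $ s) = 0"
          unfolding im(4) vector_copy_input by simp
      qed
      then have "q = 0" by (simp add: vec_eq_iff split_paired_all)
      with False show ?thesis ..
    qed
  qed
  then obtain K where K: "\<forall>\<mu>\<in>\<Lambda>. \<forall>\<zeta> x. 1 \<le> cmod \<zeta> \<longrightarrow> \<zeta> *s x = cmatrix ?A *v x +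
      (\<mu> * inverse \<zeta> ^ r) *s (cmatrix ?B *v (cmatrix K *v x)) \<longrightarrow> x = 0" by blast
  obtain K2 K1 where "K = beside K2 K1" by (rule beside_exhaust)
  with K show ?thesis by blast
qed

section \<open>The nominal closed loop\<close>

definition cvec :: "real^'n \<Rightarrow> real^'n \<Rightarrow> complex^'n" where
  "cvec u v = (\<chi> i. Complex (u $ i) (v $ i))"

lemma cvec_parts [simp]: "vRe (cvec u v) = u" "vIm (cvec u v) = v"
  by (simp_all add: vec_eq_iff cvec_def)

lemma cvec_add: "cvec (u + u') (v + v') = cvec u v + cvec u' v'"
  by (simp add: complex_vec_eq_iff vRe_vIm_add)

lemma cvec_diff: "cvec (u - u') (v - v') = cvec u v - cvec u' v'"
  by (simp add: complex_vec_eq_iff vRe_vIm_diff)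

lemma cvec_scaleR: "cvec (c *\<^sub>R u) (c *\<^sub>R v) = c *\<^sub>R cvec u v"
  by (simp add: complex_vec_eq_iff vRe_vIm_scaleR)

lemma cvec_sum: "cvec (\<Sum>j\<in>J. u j) (\<Sum>j\<in>J. v j) = (\<Sum>j\<in>J. cvec (u j) (v j))"
  by (simp add: complex_vec_eq_iff vRe_vIm_sum)

lemma cvec_matrix: "cvec (M *v u) (M *v v) = cmatrix M *v cvec u v"
  by (simp add: complex_vec_eq_iff vRe_vIm_cmatrix)

lemma cvec_smult:
  "cvec (Re w *\<^sub>R u - Im w *\<^sub>R v) (Im w *\<^sub>R u + Re w *\<^sub>R v) = w *s cvec u v"
  by (simp add: complex_vec_eq_iff vRe_vIm_smult add.commute)

lemma cvec_eq_0_iff: "cvec u v = 0 \<longleftrightarrow> u = 0 \<and> v = 0"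
  by (simp add: complex_vec_eq_iff)

lemma cscale_map_prod:
  assumes "linear M"
  shows "cscale w (map_prod M M p) = map_prod M M (cscale w p)"
  by (cases p) (simp add: cscale_def linear_add[OF assms] linear_diff[OF assms] linear_cmul[OF assms])

context distributed_loop
begin

lemma input_linear: "linear (\<lambda>Y. input Y i)"
  by (rule linearI) (rule input_add input_scaleR)+

text \<open>The estimation error \<open>x - \<xi>\<close> is an autonomous mode of the network and vanishes by the choice of \<open>L\<close>.
Then \<open>(H \<xi>, z)\<close> is a mode of the augmented plant under the delayed feedback \<open>H \<otimes> K\<close> and vanishes by the choice
of \<open>K1\<close> and \<open>K2\<close>.  Finally \<open>H \<xi> = 0\<close> implies \<open>\<xi> = 0\<close>.\<close>

lemma closed_loop_no_unstable_mode:
  assumes H: "0 \<notin> spectrum H"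
    and observer: "\<And>\<mu> \<zeta> x. \<mu> \<in> spectrum H \<Longrightarrow> 1 \<le> cmod \<zeta> \<Longrightarrow>
      \<zeta> *s x = cmatrix A *v x + \<mu> *s (- cmatrix (L ** C) *v x) \<Longrightarrow> x = 0"
    and servo: "\<And>\<mu> \<zeta> x. \<mu> \<in> spectrum H \<Longrightarrow> 1 \<le> cmod \<zeta> \<Longrightarrow>
      \<zeta> *s x = cmatrix (block_matrix A 0 (G2 ** C) G1) *v x +
        (\<mu> * inverse \<zeta> ^ r) *s (cmatrix (stack B 0) *v (cmatrix (beside K2 K1) *v x)) \<Longrightarrow> x = 0"
  shows "no_unstable_mode r (\<lambda>X. update 0 X 0 0) (\<lambda>Y. update 0 0 Y 0)"
  unfolding no_unstable_mode_def
proof (intro allI impI)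
  fix z and p :: "('n, 'k, 'N) loop_state \<times> ('n, 'k, 'N) loop_state"
  let ?F = "\<lambda>X. update 0 X 0 0" and ?G = "\<lambda>Y. update 0 0 Y 0"
  assume z: "1 \<le> cmod z"
    and mode: "cscale (z ^ Suc r) p = cscale (z ^ r) (map_prod ?F ?F p) + map_prod ?G ?G p"
  define \<omega> where "\<omega> = inverse z ^ r"
  define q where "q = cscale \<omega> p"
  have z0: "z \<noteq> 0" using z by auto
  then have \<omega>: "\<omega> * z ^ r = 1" unfolding \<omega>_def by (simp flip: power_mult_distrib)
  have "\<omega> * z ^ Suc r = z" using \<omega> by (simp add: mult.left_commute)
  then have "cscale z p = cscale \<omega> (cscale (z ^ Suc r) p)" by (simp only: cscale_mult[symmetric])
  also have "\<dots> = map_prod ?F ?F p + map_prod ?G ?G q"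
    unfolding mode cscale_add cscale_mult[symmetric] \<omega> q_def
    by (simp add: cscale_map_prod[OF update_linear(2)])
  finally have zp: "cscale z p = map_prod ?F ?F p + map_prod ?G ?G q" .
  have upd: "fst (cscale z p) = update 0 (fst p) (fst q) 0" "snd (cscale z p) = update 0 (snd p) (snd q) 0"
    unfolding zp by (simp_all add: update_split[of 0 "fst p" "fst q"] update_split[of 0 "snd p" "snd q"])
  define x where "x i = cvec (fst (fst p) $ i) (fst (snd p) $ i)" for i
  define y where "y i = cvec (fst (snd (fst p)) $ i) (fst (snd (snd p)) $ i)" for i
  define s where "s i = cvec (snd (snd (fst p)) $ i) (snd (snd (snd p)) $ i)" for i
  define u where "u i = \<omega> *s (cmatrix K1 *v y i + cmatrix K2 *v (\<Sum>j\<in>UNIV. H $ i $ j *\<^sub>R s j))" for i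
  define e where "e i = (\<Sum>j\<in>UNIV. H $ i $ j *\<^sub>R (cmatrix C *v x j))" for i
  have u: "cvec (input (fst q) i) (input (snd q) i) = u i" for i
  proof -
    have "cvec (input (fst q) i) (input (snd q) i) = \<omega> *s cvec (input (fst p) i) (input (snd p) i)"
      unfolding q_def cscale_def fst_conv snd_conv linear_add[OF input_linear] linear_diff[OF input_linear]
        linear_cmul[OF input_linear] by (rule cvec_smult)
    also have "cvec (input (fst p) i) (input (snd p) i) =
        cmatrix K1 *v y i + cmatrix K2 *v (\<Sum>j\<in>UNIV. H $ i $ j *\<^sub>R s j)"
      unfolding input_def cvec_add cvec_matrix cvec_sum cvec_scaleR y_def s_def ..
    finally show ?thesis unfolding u_def .
  qed
  have e: "cvec (relative_error 0 (fst p) 0 i) (relative_error 0 (snd p) 0 i) = e i" for i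
    unfolding relative_error_def tracking_error_def cvec_sum cvec_scaleR e_def x_def
    by (simp add: cvec_matrix)
  have zx: "z *s x i = cmatrix A *v x i + cmatrix B *v u i" for i
  proof -
    have "z *s x i = cvec (fst (fst (cscale z p)) $ i) (fst (snd (cscale z p)) $ i)"
      unfolding x_def cscale_def by (simp add: cvec_smult)
    also have "\<dots> = cvec (A *v (fst (fst p) $ i) + B *v input (fst q) i) (A *v (fst (snd p) $ i) + B *v input (snd q) i)"
      unfolding upd by (simp add: update_def)
    also have "\<dots> = cmatrix A *v x i + cmatrix B *v u i"
      by (simp only: cvec_add cvec_matrix u x_def)
    finally show ?thesis .
  qed
  have zy: "z *s y i = cmatrix G1 *v y i + cmatrix G2 *v e i" for i
  proof -
    have "z *s y i = cvec (fst (snd (fst (cscale z p))) $ i) (fst (snd (snd (cscale z p))) $ i)"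
      unfolding y_def cscale_def by (simp add: cvec_smult)
    also have "\<dots> = cvec (G1 *v (fst (snd (fst p)) $ i) + G2 *v relative_error 0 (fst p) 0 i)
        (G1 *v (fst (snd (snd p)) $ i) + G2 *v relative_error 0 (snd p) 0 i)"
      unfolding upd by (simp add: update_def)
    also have "\<dots> = cmatrix G1 *v y i + cmatrix G2 *v e i"
      by (simp only: cvec_add cvec_matrix e y_def)
    finally show ?thesis .
  qed
  have zs: "z *s s i = cmatrix A *v s i + cmatrix B *v u i
      - cmatrix (L ** C) *v (\<Sum>j\<in>UNIV. H $ i $ j *\<^sub>R s j) + cmatrix L *v e i" for i
  proof -
    have "z *s s i = cvec (snd (snd (fst (cscale z p))) $ i) (snd (snd (snd (cscale z p))) $ i)"
      unfolding s_def cscale_def by (simp add: cvec_smult)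
    also have "\<dots> = cvec (A *v (snd (snd (fst p)) $ i) + B *v input (fst q) i
          - (L ** C) *v (\<Sum>j\<in>UNIV. H $ i $ j *\<^sub>R (snd (snd (fst p)) $ j)) + L *v relative_error 0 (fst p) 0 i)
        (A *v (snd (snd (snd p)) $ i) + B *v input (snd q) i
          - (L ** C) *v (\<Sum>j\<in>UNIV. H $ i $ j *\<^sub>R (snd (snd (snd p)) $ j)) + L *v relative_error 0 (snd p) 0 i)"
      unfolding upd by (simp add: update_def)
    also have "\<dots> = cmatrix A *v s i + cmatrix B *v u i
      - cmatrix (L ** C) *v (\<Sum>j\<in>UNIV. H $ i $ j *\<^sub>R s j) + cmatrix L *v e i"
      by (simp only: cvec_add cvec_diff cvec_matrix cvec_sum cvec_scaleR e u s_def)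
    finally show ?thesis .
  qed
  have linH: "M *v (\<Sum>j\<in>UNIV. H $ i $ j *\<^sub>R f j) = (\<Sum>j\<in>UNIV. H $ i $ j *\<^sub>R (M *v f j))"
    for M :: "complex^'b^'c" and f i
    by (simp only: linear_sum[OF matrix_vector_mul_linear] matrix_vector_mult_scaleR_complex)
  have smultH: "c *s (\<Sum>j\<in>UNIV. H $ i $ j *\<^sub>R f j) = (\<Sum>j\<in>UNIV. H $ i $ j *\<^sub>R (c *s f j))"
    for c and f :: "'N \<Rightarrow> complex^'b" and i
    by (simp add: vec.scale_sum_right vec_eq_iff)
  have LC: "cmatrix L *v e i = cmatrix (L ** C) *v (\<Sum>j\<in>UNIV. H $ i $ j *\<^sub>R x j)" for i
    unfolding e_def linH by (simp add: cmatrix_mult matrix_vector_mul_assoc)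
  have xs: "x i = s i" for i
  proof -
    have "x i - s i = 0"
    proof (rule network_decoupling[where Y = "\<lambda>i. x i - s i"])
      show "z *s (x i - s i) = cmatrix A *v (x i - s i) +
          - cmatrix (L ** C) *v (\<Sum>j\<in>UNIV. H $ i $ j *\<^sub>R (x j - s j))" for i
      proof -
        have neg: "- M *v v = - (M *v v)" for M :: "complex^'n^'n" and v
          by (simp add: vec_eq_iff matrix_vector_mult_def sum_negf)
        show ?thesis
          unfolding vector_ssub_ldistrib zx zs LC neg
          by (simp add: scaleR_diff_right sum_subtractf matrix_vector_mult_diff_distrib)
      qed
    qed (rule observer[OF _ z])
    then show ?thesis by simp
  qed
  define h where "h i = (\<Sum>j\<in>UNIV. H $ i $ j *\<^sub>R s j)" for i
  let ?B = "mat \<omega> ** (cmatrix (stack B 0) ** cmatrix (beside K2 K1))"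
  have hy: "join (h i) (y i) = 0" for i
  proof (rule network_decoupling[where Y = "\<lambda>i. join (h i) (y i)"])
    show "z *s join (h i) (y i) = cmatrix (block_matrix A 0 (G2 ** C) G1) *v join (h i) (y i) +
        ?B *v (\<Sum>j\<in>UNIV. H $ i $ j *\<^sub>R join (h j) (y j))" for i
    proof -
      have "(\<Sum>j\<in>UNIV. H $ i $ j *\<^sub>R u j) = \<omega> *s (cmatrix K1 *v (\<Sum>j\<in>UNIV. H $ i $ j *\<^sub>R y j)
          + cmatrix K2 *v (\<Sum>j\<in>UNIV. H $ i $ j *\<^sub>R h j))"
        unfolding u_def h_def[symmetric] linH smultH[symmetric]
        by (simp add: scaleR_add_right sum.distrib)
      then have Bu: "?B *v (\<Sum>j\<in>UNIV. H $ i $ j *\<^sub>R join (h j) (y j)) =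
          join (cmatrix B *v (\<Sum>j\<in>UNIV. H $ i $ j *\<^sub>R u j)) 0"
        unfolding join_scaleR join_sum cmatrix_stack cmatrix_beside
        by (simp add: matrix_vector_mul_assoc[symmetric] beside_join stack_vector mat_vector_mult
            join_smult matrix_vector_mult_vector_scalar matrix_vector_right_distrib vector_add_ldistrib join_add
            add.commute)
      have zh: "z *s h i = cmatrix A *v h i + cmatrix B *v (\<Sum>j\<in>UNIV. H $ i $ j *\<^sub>R u j)"
        unfolding h_def smultH linH xs[symmetric] zx by (simp add: scaleR_add_right sum.distrib)
      have eC: "cmatrix G2 *v e i = cmatrix (G2 ** C) *v h i"
        unfolding e_def h_def xs linH by (simp add: cmatrix_mult matrix_vector_mul_assoc)
      show ?thesis
        unfolding Bu join_smult cmatrix_block_matrix block_matrix_join join_add zh zy eC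
        by (simp add: add.commute)
    qed
    show "v = 0" if "\<mu> \<in> spectrum H" and
      "z *s v = cmatrix (block_matrix A 0 (G2 ** C) G1) *v v + \<mu> *s (?B *v v)" for \<mu> v
    proof (rule servo[OF that(1) z])
      show "z *s v = cmatrix (block_matrix A 0 (G2 ** C) G1) *v v +
        (\<mu> * inverse z ^ r) *s (cmatrix (stack B 0) *v (cmatrix (beside K2 K1) *v v))"
        using that(2) by (simp add: matrix_vector_mul_assoc[symmetric] mat_vector_mult vector_smult_assoc \<omega>_def)
    qed
  qed
  then have h0: "h i = 0" and y0: "y i = 0" for i by (metis join_eq_iff join_zero)+
  have s0: "s i = 0" for i
  proof (rule network_decoupling[where \<zeta> = 0 and M = 0 and M' = "mat 1" and Y = s])
    show "0 *s s i = 0 *v s i + mat 1 *v (\<Sum>j\<in>UNIV. H $ i $ j *\<^sub>R s j)" for i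
      using h0[of i] by (simp add: h_def)
    show "v = 0" if "\<mu> \<in> spectrum H" "0 *s v = 0 *v v + \<mu> *s (mat 1 *v v)" for \<mu> and v :: "complex^'n"
      using that H by (auto simp: vector_mul_eq_0)
  qed
  have "x i = 0" for i using xs s0 by simp
  with y0 s0 have "\<And>i. fst (fst p) $ i = 0 \<and> fst (snd p) $ i = 0"
    "\<And>i. fst (snd (fst p)) $ i = 0 \<and> fst (snd (snd p)) $ i = 0"
    "\<And>i. snd (snd (fst p)) $ i = 0 \<and> snd (snd (snd p)) $ i = 0"
    unfolding x_def y_def s_def cvec_eq_0_iff by blast+
  then have "fst (fst p) = 0" "fst (snd p) = 0" "fst (snd (fst p)) = 0" "fst (snd (snd p)) = 0"
    "snd (snd (fst p)) = 0" "snd (snd (snd p)) = 0"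
    by (simp_all add: vec_eq_iff[where 'a = "real^'n"] vec_eq_iff[where 'a = "real^'k"])
  then show "p = 0" by (simp add: prod_eq_iff)
qed

end

theorem theorem4p2:
  fixes A :: "real^'n^'n" and B :: "real^'m^'n" and E :: "real^'q^'n" and C :: "real^'n^'p"
    and S :: "real^'q^'q" and F :: "real^'q^'p"
    and rcon rcom :: nat
    and edges :: "('N::finite option \<times> 'N option) set"
    and a :: "'N option \<Rightarrow> 'N option \<Rightarrow> real"
    and G1 :: "real^('p::finite \<times> 's::finite)^('p \<times> 's)" and G2 :: "real^'p^('p \<times> 's)"
  assumes "weighted_adjacency edges a"
    and "stabilizable A B"
    and "detectable C A"
    and "\<forall>\<mu>\<in>spectrum S.
      rank (block_matrix (cmatrix A - mat \<mu>) (cmatrix B) (cmatrix C) 0) = CARD('n) + CARD('p)"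
    and "\<forall>\<mu>\<in>spectrum S. cmod \<mu> = 1"
    and "\<forall>\<mu>\<in>spectrum A. cmod \<mu> \<le> 1"
    and "minimal_p_copy_internal_model S G1 G2"
  shows "(\<exists>(K1 :: real^('p \<times> 's)^'m) (K2 :: real^'n^'m) (L :: real^'p^'n).
            solves_cooperative_robust_output_regulation
              edges a (A, B, E, C) S F rcon rcom G1 G2 K1 K2 L)
         \<longleftrightarrow> has_directed_spanning_tree edges None"
proof
  obtain \<beta> :: "real^'s^'s" and \<sigma> :: "real^1^'s" where im: "is_min_poly S (char_poly \<beta>)" "controllable \<beta> \<sigma>"
    "G1 = kronecker (mat 1) \<beta>" "G2 = (\<chi> i j. kronecker (mat 1 :: real^'p^'p) \<sigma> $ i $ (j, 1))"
    using assms(7) by (auto simp: minimal_p_copy_internal_model_def)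
  let ?f = "char_poly \<beta>"
  have fS: "poly_matrix ?f S = 0" and lead: "lead_coeff ?f = 1" using im(1) by (auto simp: is_min_poly_def)
  {
    assume "\<exists>K1 K2 L. solves_cooperative_robust_output_regulation
              edges a (A, B, E, C) S F rcon rcom G1 G2 K1 K2 L"
    then obtain K1 K2 L where stable: "nominally_exp_stable edges a (A, B, E, C) S F rcon rcom G1 G2 K1 K2 L"
      by (auto simp: solves_cooperative_robust_output_regulation_def)
    obtain \<mu> where \<mu>: "\<mu> \<in> spectrum S" using spectrum_nonempty[of S] by blast
    then obtain v where v: "v \<noteq> 0" "cmatrix S *v v = \<mu> *s v" by (auto simp: spectrum_def)
    have "poly (cpoly ?f) \<mu> *s v = 0"
      using cmatrix_poly_matrix_eigenvector[OF v(2), of ?f] by (simp add: fS)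
    then have "\<mu> \<in> spectrum G1"
      using v(1) by (simp add: im(3) spectrum_kronecker_id char_poly_root_iff[symmetric])
    then show "has_directed_spanning_tree edges None"
      unfolding directed_spanning_tree_iff_reachable
      using distributed_loop.reachable_if_exp_stable[OF stable] assms(5) \<mu> by blast
  }
  assume "has_directed_spanning_tree edges None"
  then have reach: "(None, j) \<in> edges\<^sup>*" for j
    by (simp add: directed_spanning_tree_iff_reachable)
  define H where "H = network_matrix edges a"
  have H_pos: "0 < Re \<mu>" if "\<mu> \<in> spectrum H" for \<mu>
    using network_matrix_spectrum_right_half_plane[OF assms(1) reach] that by (simp add: H_def)
  have H_finite: "finite (spectrum H)"
  proof -
    have eq: "spectrum H = {\<mu>. poly (cpoly (char_poly H)) \<mu> = 0}" by (auto simp: char_poly_root_iff)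
    show ?thesis unfolding eq by (rule poly_roots_finite) (simp add: cpoly_eq_0_iff char_poly_neq_0)
  qed
  have H0: "0 \<notin> spectrum H" using H_pos by force
  obtain L where L: "\<And>\<mu> \<zeta> x. \<mu> \<in> spectrum H \<Longrightarrow> 1 \<le> cmod \<zeta> \<Longrightarrow>
      \<zeta> *s x = cmatrix A *v x + \<mu> *s (- cmatrix (L ** C) *v x) \<Longrightarrow> x = 0"
    using observer_gain[OF H_finite H_pos _ assms(3)] assms(6) by blast
  obtain K1 K2 where K: "\<And>\<mu> \<zeta> x. \<mu> \<in> spectrum H \<Longrightarrow> 1 \<le> cmod \<zeta> \<Longrightarrow>
      \<zeta> *s x = cmatrix (block_matrix A 0 (G2 ** C) G1) *v x +
        (\<mu> * inverse \<zeta> ^ (rcom + rcon)) *s (cmatrix (stack B 0) *v (cmatrix (beside K2 K1) *v x)) \<Longrightarrow> x = 0"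
    using servo_gain[OF H_finite H_pos assms(2,4,5,6,7), of "rcom + rcon"] by blast
  interpret distributed_loop edges a A B E C F G1 G2 K1 K2 L .
  have nominal: "no_unstable_mode (rcom + rcon) (\<lambda>X. update 0 X 0 0) (\<lambda>Y. update 0 0 Y 0)"
    using closed_loop_no_unstable_mode[OF H0[unfolded H_def] L[unfolded H_def] K[unfolded H_def]] .
  obtain W where W: "open W" "0 \<in> W" and robust: "\<And>w. w \<in> W \<Longrightarrow>
      no_unstable_mode (rcom + rcon) (\<lambda>X. update w X 0 0) (\<lambda>Y. update w 0 Y 0)"
    using no_unstable_mode_robust[where F = "\<lambda>w X. update w X 0 0" and G = "\<lambda>w Y. update w 0 Y 0",
        OF update_linear(1) update_continuous update_linear(2) update_continuous nominal] by blast
  obtain H' where H': "H' ** network_matrix edges a = mat 1"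
    using spectrum_0_invertible[OF H0] unfolding H_def by blast
  have "(\<lambda>t::nat. regulated_output (A, B, E, C) w F v x (int t) i) \<longlonglongrightarrow> 0"
    if w: "w \<in> W" and cl: "closed_loop edges a (A, B, E, C) S F rcon rcom G1 G2 K1 K2 L w v x z \<xi>"
    for w v x z \<xi> i
  proof (rule regulated_output_tendsto_0[OF H'])
    fix i
    let ?e = "\<lambda>t. relative_error w (x (int t), z (int t), \<xi> (int t)) (v (int t)) i"
    have "(\<lambda>t. \<Sum>k\<le>degree ?f. coeff ?f k *\<^sub>R (x (int (t + k)), z (int (t + k)), \<xi> (int (t + k)))) \<longlonglongrightarrow> 0"
      by (rule filtered_state_tendsto_0[OF robust[OF w] fS cl])
    then have "(\<lambda>t. fst (snd (\<Sum>k\<le>degree ?f. coeff ?f k *\<^sub>R (x (int (t + k)), z (int (t + k)), \<xi> (int (t + k))))) $ i)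
        \<longlonglongrightarrow> fst (snd (0 :: ((real^'n)^'N) \<times> ((real^('p \<times> 's))^'N) \<times> ((real^'n)^'N))) $ i"
      by (intro tendsto_vec_nth tendsto_fst tendsto_snd)
    then have lim: "(\<lambda>t. \<Sum>k\<le>degree ?f. coeff ?f k *\<^sub>R z (int (t + k)) $ i) \<longlonglongrightarrow> 0"
      by (simp add: fst_sum snd_sum)
    have "(\<lambda>t. ?e t $ \<kappa>) \<longlonglongrightarrow> 0" for \<kappa>
    proof (rule internal_model_error_tendsto_0[OF im(2) lead])
      let ?\<zeta> = "\<lambda>t. \<chi> s. z (int t) $ i $ (\<kappa>, s)"
      show "?\<zeta> (Suc t) = \<beta> *v ?\<zeta> t + ?e t $ \<kappa> *\<^sub>R column 1 \<sigma>" for t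
      proof -
        have "(x (int t + 1), z (int t + 1), \<xi> (int t + 1)) = update w (x (int t), z (int t), \<xi> (int t))
            (x (int t - int (rcom + rcon)), z (int t - int (rcom + rcon)), \<xi> (int t - int (rcom + rcon))) (v (int t))"
          using cl unfolding closed_loop_update by simp
        then have "z (int t + 1) $ i = G1 *v (z (int t) $ i) + G2 *v ?e t"
          by (simp add: update_def)
        then have "z (int t + 1) $ i $ (\<kappa>, s) = (\<beta> *v ?\<zeta> t) $ s + ?e t $ \<kappa> * \<sigma> $ s $ 1" for s
          by (simp add: im(3,4) kronecker_id_vector copy_input_vector)
        then show ?thesis by (simp add: vec_eq_iff column_def add.commute)
      qed
      have "(\<lambda>t. (\<Sum>k\<le>degree ?f. coeff ?f k *\<^sub>R ?\<zeta> (t + k)) $ s) \<longlonglongrightarrow> 0 $ s" for s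
        using tendsto_vec_nth[OF lim, of "(\<kappa>, s)"] by simp
      then show "(\<lambda>t. \<Sum>k\<le>degree ?f. coeff ?f k *\<^sub>R ?\<zeta> (t + k)) \<longlonglongrightarrow> 0"
        by (rule vec_tendstoI)
    qed
    then have "(\<lambda>t. ?e t $ \<kappa>) \<longlonglongrightarrow> 0 $ \<kappa>" for \<kappa> by simp
    then show "?e \<longlonglongrightarrow> 0" by (rule vec_tendstoI)
  qed
  then show "\<exists>K1 K2 L. solves_cooperative_robust_output_regulation
              edges a (A, B, E, C) S F rcon rcom G1 G2 K1 K2 L"
    unfolding solves_cooperative_robust_output_regulation_def
    using exp_stable_if_no_unstable_mode[OF nominal] W by blast
qed

end
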